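(* Let $X$ be a separable and piecewise quasiconvex metric space (with quasiconvexity constant $c\ge1$) and let $T\in\mathbf M_1(X)$. Then for any $\delta\in(0,1)$ there exists a rectifiable current $R\in\mathcal R_1(X)$ satisfying $$\partial R=\partial T\qquad\text{and}\qquad\mathbf M(R)\le c(1+\delta)\|\partial T\|_{\mathrm{KR}}.$$
   Context: Let $(X,d)$ be a metric space (not assumed complete). $\mathrm{Lip}(X)$ is the space of real-valued Lipschitz functions on $X$, $\mathrm{Lip}(f)$ the Lipschitz constant, $\mathrm{Lip}_b(X)$ the bounded ones, $\mathrm{Lip}_1(X)$ those with Lipschitz constant at most $1$. A metric $1$-current on $X$ (element of $\mathbf M_1(X)$) is a bilinear functional $T:\mathrm{Lip}_b(X)\times \mathrm{Lip}(X)\to\mathbb R$ such that: (i) (finite mass) there is a finite Borel measure $\mu$ on $X$ with $|T(f,\pi)|\le \mathrm{Lip}(\pi)\int_X |f|\,d\mu$ for all $(f,\pi)$; the minimal such measure is the mass measure $\|T\|$, and $\mathbf M(T):=\|T\|(X)$; (ii) (continuity) if $\pi_j\to\pi$ pointwise and $\sup_j\mathrm{Lip}(\pi_j)<\infty$, then $T(f,\pi_j)\to T(f,\pi)$; (iii) (locality) $T(f,\pi)=0$ whenever $\pi$ is constant on a neighborhood of $\operatorname{spt}f$. The boundary is $\partial T(f):=T(1,f)$, $f\in\mathrm{Lip}(X)$, and $\|\partial T\|_{\mathrm{KR}}:=\sup\{\partial T(f):f\in\mathrm{Lip}_1(X)\}$. $\mathcal R_1(X)$ (rectifiable $1$-currents)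 is the set of $R\in\mathbf M_1(X)$ such that $\|R\|$ is concentrated on a countable union of Lipschitz images of bounded subsets of $\mathbb R$ and $\|R\|\ll\mathcal H^1$ (Hausdorff measure). For a Lipschitz curve $\theta:[0,1]\to X$, $\ell(\theta):=\int_0^1|\dot\theta|(t)\,dt$ with $|\dot\theta|(t)=\limsup_{h\to0^+}d(\theta(t+h),\theta(t))/h$. $X$ is piecewise quasiconvex with constant $c\ge1$ if for all $x,y\in X$ and $\varepsilon>0$ there exist finitely many pairs $(x_1,y_1),\dots,(x_m,y_m)\in X^2$ with $d(x,x_1)+d(y_m,y)+\sum_{i=1}^{m-1}d(x_{i+1},y_i)<\varepsilon$ and Lipschitz curves $\theta_1,\dots,\theta_m:[0,1]\to X$ with $\theta_i(0)=x_i$, $\theta_i(1)=y_i$ and $\sum_{i=1}^m\ell(\theta_i)\le c\,d(x,y)$. *)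

theory Defs
  imports "HOL-Analysis.Analysis"
begin

section \<open>Lipschitz functions\<close>

definition Lip :: "('a::metric_space \<Rightarrow> real) set" where
  "Lip = {f. \<exists>L. L-lipschitz_on UNIV f}"

definition lip_const :: "('a::metric_space \<Rightarrow> real) \<Rightarrow> real" where
  "lip_const f = Inf {L. L-lipschitz_on UNIV f}"

definition Lip_b :: "('a::metric_space \<Rightarrow> real) set" where
  "Lip_b = {f \<in> Lip. bounded (range f)}"

definition Lip_1 :: "('a::metric_space \<Rightarrow> real) set" where
  "Lip_1 = {f \<in> Lip. lip_const f \<le> 1}"

definition spt :: "('a::topological_space \<Rightarrow> real) \<Rightarrow> 'a set" where
  "spt f = closure {x. f x \<noteq> 0}"


section \<open>Metric 1-currents\<close>

text \<open>A functional on \<open>Lip_b \<times> Lip\<close> is represented by a total function of two arguments;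
  its values outside \<open>Lip_b \<times> Lip\<close> are irrelevant.\<close>

type_synonym 'a functional1 = "('a \<Rightarrow> real) \<Rightarrow> ('a \<Rightarrow> real) \<Rightarrow> real"

definition bilinear_on_Lip :: "'a::metric_space functional1 \<Rightarrow> bool" where
  "bilinear_on_Lip T \<longleftrightarrow>
     (\<forall>f\<in>Lip_b. \<forall>g\<in>Lip_b. \<forall>\<pi>\<in>Lip. \<forall>a b.
        T (\<lambda>x. a * f x + b * g x) \<pi> = a * T f \<pi> + b * T g \<pi>) \<and>
     (\<forall>f\<in>Lip_b. \<forall>\<pi>\<in>Lip. \<forall>\<rho>\<in>Lip. \<forall>a b.
        T f (\<lambda>x. a * \<pi> x + b * \<rho> x) = a * T f \<pi> + b * T f \<rho>)"

definition mass_bound :: "'a::metric_space functional1 \<Rightarrow> 'a measure \<Rightarrow> bool" where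
  "mass_bound T \<mu> \<longleftrightarrow> sets \<mu> = sets borel \<and> finite_measure \<mu> \<and>
     (\<forall>f\<in>Lip_b. \<forall>\<pi>\<in>Lip. \<bar>T f \<pi>\<bar> \<le> lip_const \<pi> * (\<integral>x. \<bar>f x\<bar> \<partial>\<mu>))"

definition current_continuous :: "'a::metric_space functional1 \<Rightarrow> bool" where
  "current_continuous T \<longleftrightarrow>
     (\<forall>f\<in>Lip_b. \<forall>\<pi>\<in>Lip. \<forall>\<pi>s :: nat \<Rightarrow> 'a \<Rightarrow> real.
        (\<forall>j. \<pi>s j \<in> Lip) \<longrightarrow> bdd_above (range (\<lambda>j. lip_const (\<pi>s j))) \<longrightarrow>
        (\<forall>x. (\<lambda>j. \<pi>s j x) \<longlonglongrightarrow> \<pi> x) \<longrightarrow> (\<lambda>j. T f (\<pi>s j)) \<longlonglongrightarrow> T f \<pi>)"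

definition current_local :: "'a::metric_space functional1 \<Rightarrow> bool" where
  "current_local T \<longleftrightarrow>
     (\<forall>f\<in>Lip_b. \<forall>\<pi>\<in>Lip.
        (\<exists>U k. open U \<and> spt f \<subseteq> U \<and> (\<forall>x\<in>U. \<pi> x = k)) \<longrightarrow> T f \<pi> = 0)"

definition currents1 :: "'a::metric_space functional1 set" where
  "currents1 = {T. bilinear_on_Lip T \<and> (\<exists>\<mu>. mass_bound T \<mu>) \<and>
                   current_continuous T \<and> current_local T}"

text \<open>The minimal measure exists for every \<open>T \<in> currents1\<close>, because the measures satisfying the
  mass bound are closed under lattice minima of two measures and under decreasing limits; a least
  measure is unique. For other \<open>T\<close> the value is unspecified.\<close>

definition mass_measure :: "'a::metric_space functional1 \<Rightarrow> 'a measure" where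
  "mass_measure T = (THE \<mu>. mass_bound T \<mu> \<and>
     (\<forall>\<nu>. mass_bound T \<nu> \<longrightarrow> (\<forall>B\<in>sets borel. emeasure \<mu> B \<le> emeasure \<nu> B)))"

definition mass :: "'a::metric_space functional1 \<Rightarrow> real" where
  "mass T = measure (mass_measure T) UNIV"

text \<open>As a functional, the boundary is only meaningful on \<open>Lip\<close>.\<close>

definition boundary :: "'a::metric_space functional1 \<Rightarrow> ('a \<Rightarrow> real) \<Rightarrow> real" where
  "boundary T f = T (\<lambda>_. 1) f"

text \<open>For the boundary of a current the set of values is bounded above by the total mass of any
  measure as in \<open>mass_bound\<close>, so the real-valued supremum is the intended one.\<close>

definition KR_norm :: "(('a::metric_space \<Rightarrow> real) \<Rightarrow> real) \<Rightarrow> real" where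
  "KR_norm S = (SUP f\<in>Lip_1. S f)"


section \<open>Rectifiable 1-currents\<close>

text \<open>One-dimensional Hausdorff (outer) measure. The boundedness condition on the covering sets
  is needed because \<open>diameter\<close> is a real number, unspecified for unbounded sets.\<close>

definition hausdorff1 :: "'a::metric_space set \<Rightarrow> ennreal" where
  "hausdorff1 A =
     (SUP \<delta>\<in>{0<..}.
        INF C\<in>{C :: nat \<Rightarrow> 'a set. A \<subseteq> (\<Union>i. C i) \<and> (\<forall>i. bounded (C i) \<and> diameter (C i) \<le> \<delta>)}.
          (\<Sum>i. ennreal (diameter (C i))))"

text \<open>Lipschitz images of bounded sets need not be Borel, so ``concentrated'' is expressed
  by \<open>AE\<close>: the complement is contained in a null set.\<close>

definition rectifiable1 :: "'a::metric_space functional1 set" where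
  "rectifiable1 = {R \<in> currents1.
     (\<exists>(S :: nat \<Rightarrow> real set) (\<phi> :: nat \<Rightarrow> real \<Rightarrow> 'a).
        (\<forall>i. bounded (S i) \<and> (\<exists>L. L-lipschitz_on (S i) (\<phi> i))) \<and>
        (AE x in mass_measure R. x \<in> (\<Union>i. \<phi> i ` S i))) \<and>
     (\<forall>B\<in>sets borel. hausdorff1 B = 0 \<longrightarrow> emeasure (mass_measure R) B = 0)}"


section \<open>Piecewise quasiconvexity\<close>

definition metric_speed :: "(real \<Rightarrow> 'a::metric_space) \<Rightarrow> real \<Rightarrow> ennreal" where
  "metric_speed \<theta> t = Limsup (at_right 0) (\<lambda>h. ennreal (dist (\<theta> (t + h)) (\<theta> t) / h))"

text \<open>Curves are total functions on \<open>real\<close> of which only the restriction to \<open>{0..1}\<close> matters;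
  at \<open>t = 1\<close> the right speed would see values outside \<open>{0..1}\<close>.\<close>

definition curve_length :: "(real \<Rightarrow> 'a::metric_space) \<Rightarrow> ennreal" where
  "curve_length \<theta> = (\<integral>\<^sup>+t\<in>{0..<1}. metric_speed \<theta> t \<partial>lborel)"

definition piecewise_quasiconvex :: "'a::metric_space itself \<Rightarrow> real \<Rightarrow> bool" where
  "piecewise_quasiconvex _ c \<longleftrightarrow>
     (\<forall>x y :: 'a. \<forall>\<epsilon>>0. \<exists>m\<ge>1. \<exists>(xs :: nat \<Rightarrow> 'a) (ys :: nat \<Rightarrow> 'a) (\<theta> :: nat \<Rightarrow> real \<Rightarrow> 'a).
        dist x (xs 1) + dist (ys m) y + (\<Sum>i\<in>{1..<m}. dist (xs (i + 1)) (ys i)) < \<epsilon> \<and>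
        (\<forall>i\<in>{1..m}. (\<exists>L. L-lipschitz_on {0..1} (\<theta> i)) \<and> \<theta> i 0 = xs i \<and> \<theta> i 1 = ys i) \<and>
        (\<Sum>i\<in>{1..m}. curve_length (\<theta> i)) \<le> ennreal (c * dist x y))"

end

theory Submission
  imports Defs
begin

text \<open>The boundary \<open>\<partial>T\<close> is a functional on \<open>Lip\<close> that is continuous along bounded, pointwise convergent
  sequences; since \<open>X\<close> is separable, it is small on all Lipschitz functions vanishing on a suitable finite
  set, so by a finite-dimensional Hahn--Banach argument it is, up to a small error in the \<open>KR\<close>-norm, a
  combination of differences \<open>\<delta>\<^sub>y - \<delta>\<^sub>x\<close> with \<open>\<Sum> \<bar>a\<bar> d(x, y) \<le> \<parallel>\<partial>T\<parallel>\<close>. Piecewise quasiconvexity replaces every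
  difference by boundaries of curves of total length at most \<open>c d(x, y)\<close>, up to another small error. The
  remainder is again a functional of the same kind, now of small norm; iterating with geometrically
  decreasing errors writes \<open>\<partial>T\<close> as the boundary of a countable sum of curves of total length at most
  \<open>c (1 + \<delta>) \<parallel>\<partial>T\<parallel>\<close>.

  The current of a Lipschitz curve \<open>\<theta>\<close> is the Riemann--Stieltjes integral of \<open>f \<circ> \<theta>\<close> against \<open>\<pi> \<circ> \<theta>\<close>, a limit
  of dyadic sums, so that no almost everywhere differentiability is needed. Absolute continuity with
  respect to Hausdorff measure follows from the chain rule and the continuity axiom.\<close>

section \<open>Lipschitz functions\<close>

text \<open>\<open>mass_measure\<close> is a definite description, so nothing can be said about the
  mass of a current before a least mass bound is known to exist; gluing two bounds along a Borel set
  provides it. Afterwards no mass measure is ever computed: the estimate of the mass, concentration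
  on the curves and vanishing on Hausdorff null sets all follow by exhibiting some measure that
  satisfies \<open>mass_bound\<close>, because the mass measure lies below each of them.

  \<open>X\<close> is not assumed complete and no compactness of \<open>X\<close> is available.
  Separability and continuity along bounded pointwise convergent sequences take its place in the
  reduction to finitely many points, and the construction of \<open>R\<close> takes limits of real
  numbers only, never of points or curves.

  The factor \<open>1 + \<delta>\<close> is the price of exactness. The norm of each remainder is
  also the budget of the next step: the first step has norm \<open>K\<close> and costs
  \<open>c * K\<close>, and the later norms \<open>K * \<delta> * (1/2)^n\<close> add up to
  \<open>K * \<delta>\<close>.\<close>

lemma LipI: "L-lipschitz_on UNIV f \<Longrightarrow> f \<in> Lip"
  by (auto simp: Lip_def)

lemma lip_const_lipschitz:
  assumes "f \<in> Lip"
  shows "(lip_const f)-lipschitz_on UNIV f"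
proof -
  let ?S = "{L. L-lipschitz_on UNIV f}"
  have ne: "?S \<noteq> {}" using assms by (auto simp: Lip_def)
  show ?thesis
  proof (rule lipschitz_onI)
    show "0 \<le> lip_const f"
      unfolding lip_const_def using ne by (intro cInf_greatest) (auto dest: lipschitz_on_nonneg)
    fix x y
    show "dist (f x) (f y) \<le> lip_const f * dist x y"
    proof (cases "x = y")
      case False
      then have "dist (f x) (f y) / dist x y \<le> lip_const f"
        unfolding lip_const_def using ne
        by (intro cInf_greatest) (auto simp: divide_le_eq dest: lipschitz_onD)
      with False show ?thesis by (simp add: divide_le_eq)
    qed simp
  qed
qed

lemma lip_const_le: "L-lipschitz_on UNIV f \<Longrightarrow> lip_const f \<le> L"
  unfolding lip_const_def
  by (intro cInf_lower) (auto intro!: bdd_belowI[of _ 0] dest: lipschitz_on_nonneg)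

lemma lip_const_nonneg: "f \<in> Lip \<Longrightarrow> 0 \<le> lip_const f"
  using lip_const_lipschitz lipschitz_on_nonneg by blast

lemma lip_const_bound: "f \<in> Lip \<Longrightarrow> \<bar>f x - f y\<bar> \<le> lip_const f * dist x y"
  using lipschitz_onD[OF lip_const_lipschitz, of f x y] by (simp add: dist_real_def)

lemma lipschitz_on_realI:
  fixes f :: "'a::metric_space \<Rightarrow> real"
  assumes "0 \<le> L" "\<And>x y. \<bar>f x - f y\<bar> \<le> L * dist x y"
  shows "L-lipschitz_on UNIV f"
  using assms by (intro lipschitz_onI) (auto simp: dist_real_def)

lemma Lip_lin: "f \<in> Lip \<Longrightarrow> g \<in> Lip \<Longrightarrow> (\<lambda>x. a * f x + b * g x) \<in> Lip"
  by (rule LipI[OF lipschitz_on_add[OF lipschitz_on_cmult_real lipschitz_on_cmult_real]])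
    (rule lip_const_lipschitz, assumption)+

lemma lip_const_lin:
  assumes "f \<in> Lip" "g \<in> Lip"
  shows "lip_const (\<lambda>x. a * f x + b * g x) \<le> \<bar>a\<bar> * lip_const f + \<bar>b\<bar> * lip_const g"
  by (intro lip_const_le lipschitz_on_add lipschitz_on_cmult_real lip_const_lipschitz assms)

lemma Lip_const [simp]: "(\<lambda>_. k) \<in> Lip"
  by (rule LipI, rule lipschitz_on_constant)

lemma lip_const_const [simp]: "lip_const (\<lambda>_. k) = 0"
  using lip_const_le[OF lipschitz_on_constant] lip_const_nonneg[OF Lip_const]
  by (metis order_antisym)

lemma Lip_b_Lip: "f \<in> Lip_b \<Longrightarrow> f \<in> Lip"
  by (simp add: Lip_b_def)

lemma Lip_b_bound:
  assumes "f \<in> Lip_b" obtains C where "0 \<le> C" "\<And>x. \<bar>f x\<bar> \<le> C"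
proof -
  obtain C where "\<And>x. \<bar>f x\<bar> \<le> C"
    using assms by (auto simp: Lip_b_def bounded_iff)
  moreover from this have "0 \<le> C" by (meson abs_ge_zero order_trans)
  ultimately show thesis using that by blast
qed

lemma Lip_bI: "f \<in> Lip \<Longrightarrow> (\<And>x. \<bar>f x\<bar> \<le> C) \<Longrightarrow> f \<in> Lip_b"
  by (auto simp: Lip_b_def bounded_iff)

lemma Lip_b_const [simp]: "(\<lambda>_. k) \<in> Lip_b"
  by (rule Lip_bI[of _ "\<bar>k\<bar>"]) auto

lemma lipschitz_on_mult_bounded:
  fixes f g :: "'a::metric_space \<Rightarrow> real"
  assumes f: "L-lipschitz_on S f" "\<And>x. x \<in> S \<Longrightarrow> \<bar>f x\<bar> \<le> C" "0 \<le> C"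
    and g: "M-lipschitz_on S g" "\<And>x. x \<in> S \<Longrightarrow> \<bar>g x\<bar> \<le> D" "0 \<le> D"
  shows "(C * M + D * L)-lipschitz_on S (\<lambda>x. f x * g x)"
proof (rule lipschitz_onI)
  have LM: "0 \<le> L" "0 \<le> M" using f g by (auto dest: lipschitz_on_nonneg)
  then show "0 \<le> C * M + D * L" using assms by auto
  fix x y assume xy: "x \<in> S" "y \<in> S"
  have "\<bar>f x * g x - f y * g y\<bar> = \<bar>f x * (g x - g y) + g y * (f x - f y)\<bar>"
    by (simp add: algebra_simps)
  also have "\<dots> \<le> \<bar>f x\<bar> * \<bar>g x - g y\<bar> + \<bar>g y\<bar> * \<bar>f x - f y\<bar>"
    by (metis abs_mult abs_triangle_ineq)
  also have "\<dots> \<le> C * (M * dist x y) + D * (L * dist x y)"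
    using lipschitz_onD[OF f(1) xy] lipschitz_onD[OF g(1) xy] f(2,3) g(2,3) xy
    by (intro add_mono mult_mono) (auto simp: dist_real_def)
  finally show "dist (f x * g x) (f y * g y) \<le> (C * M + D * L) * dist x y"
    by (simp add: dist_real_def algebra_simps)
qed

lemma Lip_b_mult:
  assumes "f \<in> Lip_b" "g \<in> Lip_b"
  shows "(\<lambda>x. f x * g x) \<in> Lip_b"
proof -
  obtain C where C: "0 \<le> C" "\<And>x. \<bar>f x\<bar> \<le> C" using Lip_b_bound[OF assms(1)] by blast
  obtain D where D: "0 \<le> D" "\<And>x. \<bar>g x\<bar> \<le> D" using Lip_b_bound[OF assms(2)] by blast
  show ?thesis
  proof (rule Lip_bI)
    show "(\<lambda>x. f x * g x) \<in> Lip"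
      using lipschitz_on_mult_bounded[OF lip_const_lipschitz[OF Lip_b_Lip[OF assms(1)]] C(2,1)
          lip_const_lipschitz[OF Lip_b_Lip[OF assms(2)]] D(2,1)]
      by (rule LipI)
    show "\<bar>f x * g x\<bar> \<le> C * D" for x
      unfolding abs_mult using C D by (intro mult_mono) auto
  qed
qed

lemma Lip_b_lin:
  assumes "f \<in> Lip_b" "g \<in> Lip_b"
  shows "(\<lambda>x. a * f x + b * g x) \<in> Lip_b"
proof -
  obtain C where C: "0 \<le> C" "\<And>x. \<bar>f x\<bar> \<le> C" using Lip_b_bound[OF assms(1)] by blast
  obtain D where D: "0 \<le> D" "\<And>x. \<bar>g x\<bar> \<le> D" using Lip_b_bound[OF assms(2)] by blast
  show ?thesis
  proof (rule Lip_bI[OF Lip_lin])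
    show "\<bar>a * f x + b * g x\<bar> \<le> \<bar>a\<bar> * C + \<bar>b\<bar> * D" for x
      using C D by (intro order_trans[OF abs_triangle_ineq] add_mono)
        (auto simp: abs_mult intro: mult_left_mono)
  qed (use assms in \<open>auto intro: Lip_b_Lip\<close>)
qed

section \<open>Lipschitz functions as integrands and as approximations of Borel sets\<close>

lemma Lip_borel: "f \<in> Lip \<Longrightarrow> f \<in> borel_measurable borel"
  using lip_const_lipschitz lipschitz_on_continuous_on borel_measurable_continuous_onI by blast

lemma integrable_bounded_borel:
  assumes "finite_measure M" "sets M = sets borel" "f \<in> borel_measurable borel" "\<And>x. \<bar>f x :: real\<bar> \<le> C"
  shows "integrable M f"
proof -
  interpret finite_measure M by fact
  have "f \<in> borel_measurable M" using assms(2,3) by (simp cong: measurable_cong_sets)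
  then show ?thesis using assms(4) by (intro integrable_const_bound[of _ C]) auto
qed

text \<open>The gluing of two mass bounds needs one cutoff that is good for both measures, hence a
  finite family. The closed sets are stable under intersection and generate the Borel sets, so
  Dynkin's induction applies; finiteness of the measures enters through dominated
  convergence.\<close>

lemma Lip_indicator_approx:
  fixes M :: "'i::finite \<Rightarrow> 'a::metric_space measure"
  assumes fin: "\<And>i. finite_measure (M i)" and sts: "\<And>i. sets (M i) = sets borel"
    and A: "A \<in> sets borel" and e: "0 < e"
  shows "\<exists>\<psi>\<in>Lip. (\<forall>x. 0 \<le> \<psi> x \<and> \<psi> x \<le> 1) \<and> (\<forall>i. (\<integral>x. \<bar>\<psi> x - indicator A x\<bar> \<partial>M i) < e)"
proof -
  define P where "P A \<longleftrightarrow> (\<forall>e>0. \<exists>\<psi>\<in>Lip. (\<forall>x. 0 \<le> \<psi> x \<and> \<psi> x \<le> 1) \<and>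
      (\<forall>i. (\<integral>x. \<bar>\<psi> x - indicator A x\<bar> \<partial>M i) < e))" for A
  have meas: "f \<in> borel_measurable (M i)" if "f \<in> borel_measurable borel" for f :: "'a \<Rightarrow> real" and i
    using that sts by (simp cong: measurable_cong_sets)
  have int: "integrable (M i) (\<lambda>x. \<bar>\<psi> x - indicator A x\<bar>)"
    if "\<psi> \<in> Lip" "\<forall>x. 0 \<le> \<psi> x \<and> \<psi> x \<le> 1" "A \<in> sets borel" for \<psi> A i
  proof (rule integrable_bounded_borel[OF fin sts, where C = 1])
    show "(\<lambda>x. \<bar>\<psi> x - indicator A x\<bar>) \<in> borel_measurable borel"
      using Lip_borel[OF that(1)] that(3) by measurable
    show "\<bar>\<bar>\<psi> x - indicator A x\<bar>\<bar> \<le> 1" for x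
      using that(2)[rule_format, of x] by (auto simp: indicator_def)
  qed
  have int2: "integrable (M i) (\<lambda>x. \<bar>indicator B x - indicator A x :: real\<bar>)"
    if "A \<in> sets borel" "B \<in> sets borel" for A B i
    by (rule integrable_bounded_borel[OF fin sts, where C = 1]) (use that in \<open>auto simp: indicator_def\<close>)
  have un: "P (A \<union> B)" if "P A" "P B" "A \<in> sets borel" "B \<in> sets borel" for A B
    unfolding P_def
  proof (intro allI impI)
    fix e :: real assume "0 < e"
    then have e2: "e / 2 > 0" by simp
    obtain f where f: "f \<in> Lip" "\<forall>x. 0 \<le> f x \<and> f x \<le> 1" "\<And>i. (\<integral>x. \<bar>f x - indicator A x\<bar> \<partial>M i) < e/2"
      using \<open>P A\<close>[unfolded P_def] e2 by metis
    obtain g where g: "g \<in> Lip" "\<forall>x. 0 \<le> g x \<and> g x \<le> 1" "\<And>i. (\<integral>x. \<bar>g x - indicator B x\<bar> \<partial>M i) < e/2"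
      using \<open>P B\<close>[unfolded P_def] e2 by metis
    let ?h = "\<lambda>x. max (f x) (g x)"
    have hL: "?h \<in> Lip"
    proof (rule LipI, rule lipschitz_on_realI)
      show "0 \<le> lip_const f + lip_const g" using f(1) g(1) by (intro add_nonneg_nonneg lip_const_nonneg)
      show "\<bar>max (f x) (g x) - max (f y) (g y)\<bar> \<le> (lip_const f + lip_const g) * dist x y" for x y
        using lip_const_bound[OF f(1), of x y] lip_const_bound[OF g(1), of x y]
        unfolding distrib_right by linarith
    qed
    have h01: "\<forall>x. 0 \<le> ?h x \<and> ?h x \<le> 1" using f g by (auto simp: le_max_iff_disj)
    have "(\<integral>x. \<bar>?h x - indicator (A \<union> B) x\<bar> \<partial>M i) < e" for i
    proof -
      have "(\<integral>x. \<bar>?h x - indicator (A \<union> B) x\<bar> \<partial>M i)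
          \<le> (\<integral>x. \<bar>f x - indicator A x\<bar> + \<bar>g x - indicator B x\<bar> \<partial>M i)"
      proof (rule integral_mono)
        show "integrable (M i) (\<lambda>x. \<bar>?h x - indicator (A \<union> B) x\<bar>)"
          using int[OF hL h01] that by auto
        show "integrable (M i) (\<lambda>x. \<bar>f x - indicator A x\<bar> + \<bar>g x - indicator B x\<bar>)"
          using int f g that by (intro Bochner_Integration.integrable_add) auto
        show "\<bar>?h x - indicator (A \<union> B) x\<bar> \<le> \<bar>f x - indicator A x\<bar> + \<bar>g x - indicator B x\<bar>" for x
          using f(2)[rule_format, of x] g(2)[rule_format, of x]
          by (auto simp: indicator_def max_def)
      qed
      also have "\<dots> = (\<integral>x. \<bar>f x - indicator A x\<bar> \<partial>M i) + (\<integral>x. \<bar>g x - indicator B x\<bar> \<partial>M i)"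
        using int f g that by (intro Bochner_Integration.integral_add) auto
      also have "\<dots> < e" using f(3)[of i] g(3)[of i] by linarith
      finally show ?thesis .
    qed
    then show "\<exists>\<psi>\<in>Lip. (\<forall>x. 0 \<le> \<psi> x \<and> \<psi> x \<le> 1) \<and> (\<forall>i. (\<integral>x. \<bar>\<psi> x - indicator (A \<union> B) x\<bar> \<partial>M i) < e)"
      by (intro bexI[OF _ hL] conjI h01 allI)
  qed
  have Pempty: "P {}" unfolding P_def
    by (intro allI impI bexI[of _ "\<lambda>_. 0"]) auto
  have Pclosed: "P A" if "closed A" for A
  \<comment> \<open>By convention \<open>infdist\<close> to the empty set is 0, which would make the
    ramps below constantly 1.\<close>
  proof (cases "A = {}")
    case True then show ?thesis using Pempty by simp
  next
    case False
    show ?thesis unfolding P_def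
    proof (intro allI impI)
      fix e :: real assume "0 < e"
      \<comment> \<open>Ramps of slope \<open>n\<close> that are 1 on \<open>A\<close> and 0 beyond
        distance \<open>1/n\<close>; they decrease to the indicator because \<open>A\<close> is
        closed.\<close>
      define \<psi> where "\<psi> n x = max 0 (1 - real n * infdist x A)" for n x
      have L: "\<psi> n \<in> Lip" for n
      proof (rule LipI, rule lipschitz_on_realI)
        show "0 \<le> real n" by simp
        fix x y
        have "\<bar>\<psi> n x - \<psi> n y\<bar> \<le> \<bar>real n * infdist x A - real n * infdist y A\<bar>"
          unfolding \<psi>_def by linarith
        also have "\<dots> = real n * \<bar>infdist x A - infdist y A\<bar>"
          by (simp add: abs_mult flip: right_diff_distrib)
        also have "\<dots> \<le> real n * dist x y"
          by (intro mult_left_mono infdist_triangle_abs) auto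
        finally show "\<bar>\<psi> n x - \<psi> n y\<bar> \<le> real n * dist x y" .
      qed
      have r: "\<forall>x. 0 \<le> \<psi> n x \<and> \<psi> n x \<le> 1" for n
        by (auto simp: \<psi>_def infdist_nonneg)
      have lim: "(\<lambda>n. \<psi> n x) \<longlonglongrightarrow> indicator A x" for x
      proof (cases "x \<in> A")
        case True then show ?thesis by (simp add: \<psi>_def)
      next
        case nx: False
        then have "infdist x A > 0"
          using that False by (metis in_closed_iff_infdist_zero infdist_nonneg less_eq_real_def)
        then obtain N :: nat where "1 < real N * infdist x A"
          using reals_Archimedean3 by blast
        have "\<psi> n x = 0" if "N \<le> n" for n
        proof -
          have "real N * infdist x A \<le> real n * infdist x A"
            using that by (intro mult_right_mono) (auto simp: infdist_nonneg)
          then show ?thesis using \<open>1 < real N * infdist x A\<close> by (simp add: \<psi>_def)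
        qed
        then have "\<forall>\<^sub>F n in sequentially. \<psi> n x = 0"
          by (auto simp: eventually_sequentially)
        then show ?thesis using nx by (simp add: tendsto_eventually)
      qed
      have "\<forall>\<^sub>F n in sequentially. \<forall>i. (\<integral>x. \<bar>\<psi> n x - indicator A x\<bar> \<partial>M i) < e"
      proof (rule eventually_all_finite)
        fix i
        interpret finite_measure "M i" by (rule fin)
        have "(\<lambda>n. \<integral>x. \<bar>\<psi> n x - indicator A x\<bar> \<partial>M i) \<longlonglongrightarrow> (\<integral>x. 0 \<partial>M i)"
        proof (rule integral_dominated_convergence[where w = "\<lambda>_. 1"])
          show "(\<lambda>x. \<bar>\<psi> n x - indicator A x\<bar>) \<in> borel_measurable (M i)" for n
            using int[OF L r] that by (auto simp: borel_closed)
          show "AE x in M i. (\<lambda>n. \<bar>\<psi> n x - indicator A x\<bar>) \<longlonglongrightarrow> 0"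
            using tendsto_rabs_zero[OF LIM_zero[OF lim]] by auto
          show "AE x in M i. norm \<bar>\<psi> n x - indicator A x\<bar> \<le> 1" for n
            using r[of n] by (intro AE_I2) (auto simp: indicator_def)
        qed auto
        then show "\<forall>\<^sub>F n in sequentially. (\<integral>x. \<bar>\<psi> n x - indicator A x\<bar> \<partial>M i) < e"
          using \<open>0 < e\<close> by (auto intro: order_tendstoD)
      qed
      from eventually_happens'[OF sequentially_bot this]
      obtain n where "\<forall>i. (\<integral>x. \<bar>\<psi> n x - indicator A x\<bar> \<partial>M i) < e" ..
      then show "\<exists>\<psi>\<in>Lip. (\<forall>x. 0 \<le> \<psi> x \<and> \<psi> x \<le> 1) \<and> (\<forall>i. (\<integral>x. \<bar>\<psi> x - indicator A x\<bar> \<partial>M i) < e)"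
        by (intro bexI[OF _ L] conjI r)
    qed
  qed
  have A': "A \<in> sigma_sets UNIV (Collect closed)" using A by (simp add: borel_eq_closed)
  have Int: "Int_stable (Collect closed :: 'a set set)" by (auto simp: Int_stable_def)
  have sub: "Collect closed \<subseteq> Pow (UNIV :: 'a set)" by simp
  from Int sub A' have "P A"
  proof (induct rule: sigma_sets_induct_disjoint)
    case (basic A) then show ?case using Pclosed by simp
  next
    case empty show ?case by (rule Pempty)
  next
    case (compl A)
    show ?case unfolding P_def
    proof (intro allI impI)
      fix e :: real assume "0 < e"
      then obtain f where f: "f \<in> Lip" "\<forall>x. 0 \<le> f x \<and> f x \<le> 1" "\<And>i. (\<integral>x. \<bar>f x - indicator A x\<bar> \<partial>M i) < e"
        using compl(2)[unfolded P_def] by metis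
      have "\<bar>(1 - f x) - indicator (UNIV - A) x\<bar> = \<bar>f x - indicator A x\<bar>" for x
        by (auto simp: indicator_def)
      moreover have "(\<lambda>x. 1 - f x) \<in> Lip" using Lip_lin[OF Lip_const f(1), of 1 1 "-1"] by simp
      ultimately show "\<exists>\<psi>\<in>Lip. (\<forall>x. 0 \<le> \<psi> x \<and> \<psi> x \<le> 1) \<and> (\<forall>i. (\<integral>x. \<bar>\<psi> x - indicator (UNIV - A) x\<bar> \<partial>M i) < e)"
        using f by (intro bexI[of _ "\<lambda>x. 1 - f x"]) auto
    qed
  next
    case (union A)
    have Ab: "A i \<in> sets borel" for i using union(2) by (auto simp: borel_eq_closed)
    \<comment> \<open>Infinitely many approximants cannot be combined with control of the error, so
      first a partial union close to the whole is fixed, then this finite union is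
      approximated.\<close>
    define U where "U n = (\<Union>i<n. A i)" for n :: nat
    have Ub: "U n \<in> sets borel" for n unfolding U_def using Ab by auto
    have PU: "P (U n)" for n
    proof (induct n)
      case 0 then show ?case using Pempty by (simp add: U_def)
    next
      case (Suc n)
      have "U (Suc n) = U n \<union> A n" by (auto simp: U_def lessThan_Suc)
      then show ?case using un[OF Suc union(3)] Ub Ab by simp
    qed
    let ?V = "\<Union>i. A i"
    have Vb: "?V \<in> sets borel" using Ab by auto
    have Ulim: "(\<lambda>n. indicator (U n) x :: real) \<longlonglongrightarrow> indicator ?V x" for x
    proof -
      have "(\<Union>n. U n) = ?V" unfolding U_def by auto
      moreover have "incseq U" unfolding incseq_def U_def by (intro allI impI UN_mono) auto
      ultimately show ?thesis using LIMSEQ_indicator_incseq[of U x] by simp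
    qed
    show ?case unfolding P_def
    proof (intro allI impI)
      fix e :: real assume "0 < e"
      then have e2: "e / 2 > 0" by simp
      have "\<forall>\<^sub>F n in sequentially. \<forall>i. (\<integral>x. \<bar>indicator (U n) x - indicator ?V x :: real\<bar> \<partial>M i) < e/2"
      proof (rule eventually_all_finite)
        fix i
        interpret finite_measure "M i" by (rule fin)
        have "(\<lambda>n. \<integral>x. \<bar>indicator (U n) x - indicator ?V x :: real\<bar> \<partial>M i) \<longlonglongrightarrow> (\<integral>x. 0 \<partial>M i)"
        proof (rule integral_dominated_convergence[where w = "\<lambda>_. 1"])
          show "(\<lambda>x. \<bar>indicator (U n) x - indicator ?V x :: real\<bar>) \<in> borel_measurable (M i)" for n
            using int2[OF Vb Ub[of n], of i] by auto
          show "AE x in M i. (\<lambda>n. \<bar>indicator (U n) x - indicator ?V x :: real\<bar>) \<longlonglongrightarrow> 0"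
            using tendsto_rabs_zero[OF LIM_zero[OF Ulim]] by auto
          show "AE x in M i. norm \<bar>indicator (U n) x - indicator ?V x :: real\<bar> \<le> 1" for n
            by (intro AE_I2) (auto simp: indicator_def)
        qed auto
        then show "\<forall>\<^sub>F n in sequentially. (\<integral>x. \<bar>indicator (U n) x - indicator ?V x :: real\<bar> \<partial>M i) < e/2"
          by (rule order_tendstoD) (use e2 in simp)
      qed
      from eventually_happens'[OF sequentially_bot this]
      obtain n where n': "\<forall>i. (\<integral>x. \<bar>indicator (U n) x - indicator ?V x :: real\<bar> \<partial>M i) < e/2" ..
      note n = n'[rule_format]
      obtain f where f: "f \<in> Lip" "\<forall>x. 0 \<le> f x \<and> f x \<le> 1" "\<And>i. (\<integral>x. \<bar>f x - indicator (U n) x\<bar> \<partial>M i) < e/2"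
        using PU[of n, unfolded P_def] e2 by metis
      have "(\<integral>x. \<bar>f x - indicator ?V x\<bar> \<partial>M i) < e" for i
      proof -
        have "(\<integral>x. \<bar>f x - indicator ?V x\<bar> \<partial>M i)
            \<le> (\<integral>x. \<bar>f x - indicator (U n) x\<bar> + \<bar>indicator (U n) x - indicator ?V x\<bar> \<partial>M i)"
          using int[OF f(1,2) Vb] int[OF f(1,2) Ub] int2[OF Vb Ub]
          by (intro integral_mono Bochner_Integration.integrable_add) auto
        also have "\<dots> = (\<integral>x. \<bar>f x - indicator (U n) x\<bar> \<partial>M i) + (\<integral>x. \<bar>indicator (U n) x - indicator ?V x\<bar> \<partial>M i)"
          using int[OF f(1,2) Ub] int2[OF Vb Ub] by (intro Bochner_Integration.integral_add) auto
        also have "\<dots> < e" using f(3)[of i] n[of i] by linarith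
        finally show ?thesis .
      qed
      then show "\<exists>\<psi>\<in>Lip. (\<forall>x. 0 \<le> \<psi> x \<and> \<psi> x \<le> 1) \<and> (\<forall>i. (\<integral>x. \<bar>\<psi> x - indicator ?V x\<bar> \<partial>M i) < e)"
        by (intro bexI[OF _ f(1)] conjI f(2) allI)
    qed
  qed
  then show ?thesis using e unfolding P_def by simp
qed

section \<open>The mass measure\<close>

lemma mass_boundD:
  assumes "mass_bound T \<mu>"
  shows "sets \<mu> = sets borel" "finite_measure \<mu>"
    "f \<in> Lip_b \<Longrightarrow> \<pi> \<in> Lip \<Longrightarrow> \<bar>T f \<pi>\<bar> \<le> lip_const \<pi> * (\<integral>x. \<bar>f x\<bar> \<partial>\<mu>)"
  using assms by (auto simp: mass_bound_def)

lemma Lip_b_abs_integrable: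
  assumes "finite_measure M" "sets M = sets borel" "f \<in> Lip_b" "A \<in> sets borel"
  shows "integrable M (\<lambda>x. \<bar>f x\<bar> * indicator A x)"
proof -
  obtain C where C: "\<And>x. \<bar>f x\<bar> \<le> C" using Lip_b_bound[OF assms(3)] by blast
  have [measurable]: "f \<in> borel_measurable borel" using assms(3) by (intro Lip_borel Lip_b_Lip)
  note assms(4)[measurable]
  show ?thesis
    by (rule integrable_bounded_borel[OF assms(1,2), where C = C])
       (use C order_trans[OF abs_ge_zero C] in \<open>auto simp: indicator_def\<close>)
qed

lemma bilinear_fst:
  "bilinear_on_Lip T \<Longrightarrow> f \<in> Lip_b \<Longrightarrow> g \<in> Lip_b \<Longrightarrow> \<pi> \<in> Lip \<Longrightarrow>
    T (\<lambda>x. a * f x + b * g x) \<pi> = a * T f \<pi> + b * T g \<pi>"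
  by (simp add: bilinear_on_Lip_def)

lemma bilinear_snd:
  "bilinear_on_Lip T \<Longrightarrow> f \<in> Lip_b \<Longrightarrow> \<pi> \<in> Lip \<Longrightarrow> \<rho> \<in> Lip \<Longrightarrow>
    T f (\<lambda>x. a * \<pi> x + b * \<rho> x) = a * T f \<pi> + b * T f \<rho>"
  by (simp add: bilinear_on_Lip_def)

text \<open>Write \<open>f\<close> as \<open>f * \<psi> + f * (1 - \<psi>)\<close> with a Lipschitz
  \<open>\<psi>\<close> close to the indicator of \<open>A\<close>, and estimate each summand with
  its own measure. Mass bounds can thus be improved locally, which is the reason why a least one
  exists.\<close>

lemma mass_bound_glue:
  assumes bil: "bilinear_on_Lip T" and \<mu>: "mass_bound T \<mu>" and \<nu>: "mass_bound T \<nu>"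
    and A: "A \<in> sets borel" and f: "f \<in> Lip_b" and \<pi>: "\<pi> \<in> Lip"
  shows "\<bar>T f \<pi>\<bar> \<le> lip_const \<pi> *
    ((\<integral>x. \<bar>f x\<bar> * indicator A x \<partial>\<mu>) + (\<integral>x. \<bar>f x\<bar> * indicator (-A) x \<partial>\<nu>))" (is "_ \<le> _ * (?I + ?J)")
proof -
  obtain C where C: "0 \<le> C" "\<And>x. \<bar>f x\<bar> \<le> C" using Lip_b_bound[OF f] by blast
  \<comment> \<open>Indexing the two measures by \<open>bool\<close> yields a single cutoff for
    both.\<close>
  define M where "M b = (if b then \<mu> else \<nu>)" for b
  have fin: "finite_measure (M b)" and sts: "sets (M b) = sets borel" for b
    using mass_boundD(1,2)[OF \<mu>] mass_boundD(1,2)[OF \<nu>] by (auto simp: M_def)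
  have [measurable]: "f \<in> borel_measurable borel" using f by (intro Lip_borel Lip_b_Lip)
  note A[measurable]
  have nA: "- A \<in> sets borel" using A by (metis Compl_in_sets_lebesgue borel_comp)
  have bd: "\<bar>T f \<pi>\<bar> \<le> lip_const \<pi> * ((?I + ?J) + 2 * C * e)" if e: "0 < e" for e
  proof -
    obtain \<psi> where \<psi>: "\<psi> \<in> Lip" "\<And>x. 0 \<le> \<psi> x \<and> \<psi> x \<le> 1" "\<And>b. (\<integral>x. \<bar>\<psi> x - indicator A x\<bar> \<partial>M b) < e"
      using Lip_indicator_approx[where M = M, OF fin sts A e] by auto
    have [measurable]: "\<psi> \<in> borel_measurable borel" using \<psi> by (intro Lip_borel)
    have \<psi>b: "\<psi> \<in> Lip_b" by (rule Lip_bI[of _ 1]) (use \<psi> in \<open>auto simp: abs_le_iff intro: order_trans[of _ 0]\<close>)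
    have \<psi>c: "(\<lambda>x. 1 - \<psi> x) \<in> Lip_b"
      using Lip_b_lin[OF Lip_b_const \<psi>b, of 1 1 "-1"] by simp
    have i\<psi>: "integrable (M b) (\<lambda>x. C * \<bar>\<psi> x - indicator A x\<bar>)" for b
    proof (intro integrable_mult_right integrable_bounded_borel[OF fin sts, where C = 1])
      show "\<bar>\<bar>\<psi> x - indicator A x\<bar>\<bar> \<le> 1" for x using \<psi>(2)[of x] by (auto simp: indicator_def)
    qed measurable
    let ?f1 = "\<lambda>x. f x * \<psi> x" and ?f2 = "\<lambda>x. f x * (1 - \<psi> x)"
    have f1: "?f1 \<in> Lip_b" and f2: "?f2 \<in> Lip_b" using Lip_b_mult[OF f \<psi>b] Lip_b_mult[OF f \<psi>c] by auto
    have "(\<lambda>x. 1 * ?f1 x + 1 * ?f2 x) = f" by (auto simp: algebra_simps)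
    then have "T f \<pi> = T ?f1 \<pi> + T ?f2 \<pi>"
      using bilinear_fst[OF bil f1 f2 \<pi>, of 1 1] by simp
    then have "\<bar>T f \<pi>\<bar> \<le> \<bar>T ?f1 \<pi>\<bar> + \<bar>T ?f2 \<pi>\<bar>" by simp
    also have "\<dots> \<le> lip_const \<pi> * ((\<integral>x. \<bar>?f1 x\<bar> \<partial>\<mu>) + (\<integral>x. \<bar>?f2 x\<bar> \<partial>\<nu>))"
      using mass_boundD(3)[OF \<mu> f1 \<pi>] mass_boundD(3)[OF \<nu> f2 \<pi>] unfolding distrib_left by linarith
    finally have T: "\<bar>T f \<pi>\<bar> \<le> \<dots>" .
    have 1: "(\<integral>x. \<bar>?f1 x\<bar> \<partial>\<mu>) \<le> ?I + C * e"
    proof -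
      have i1: "integrable \<mu> (\<lambda>x. \<bar>f x\<bar> * indicator A x)"
        using Lip_b_abs_integrable[OF fin sts f A, of True] by (simp add: M_def)
      have i2: "integrable \<mu> (\<lambda>x. C * \<bar>\<psi> x - indicator A x\<bar>)"
        using i\<psi>[of True] by (simp add: M_def)
      have "(\<integral>x. \<bar>?f1 x\<bar> \<partial>\<mu>) \<le> (\<integral>x. \<bar>f x\<bar> * indicator A x + C * \<bar>\<psi> x - indicator A x\<bar> \<partial>\<mu>)"
      proof (rule integral_mono)
        show "integrable \<mu> (\<lambda>x. \<bar>?f1 x\<bar>)"
          using Lip_b_abs_integrable[OF fin sts f1, of UNIV True] by (simp add: M_def)
        fix x
        have "\<bar>f x\<bar> * \<psi> x \<le> \<bar>f x\<bar> * (indicator A x + \<bar>\<psi> x - indicator A x\<bar>)"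
          by (intro mult_left_mono) auto
        also have "\<dots> \<le> \<bar>f x\<bar> * indicator A x + C * \<bar>\<psi> x - indicator A x\<bar>"
          unfolding distrib_left using C by (intro add_left_mono mult_right_mono) auto
        finally show "\<bar>?f1 x\<bar> \<le> \<bar>f x\<bar> * indicator A x + C * \<bar>\<psi> x - indicator A x\<bar>"
          using \<psi>(2)[of x] by (simp add: abs_mult)
      qed (intro Bochner_Integration.integrable_add i1 i2)
      also have "\<dots> = ?I + C * (\<integral>x. \<bar>\<psi> x - indicator A x\<bar> \<partial>\<mu>)"
        using i1 i2 by simp
      also have "\<dots> \<le> ?I + C * e"
        using \<psi>(3)[of True] C(1) by (intro add_left_mono mult_left_mono) (auto simp: M_def)
      finally show ?thesis .
    qed
    have 2: "(\<integral>x. \<bar>?f2 x\<bar> \<partial>\<nu>) \<le> ?J + C * e"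
    proof -
      have i1: "integrable \<nu> (\<lambda>x. \<bar>f x\<bar> * indicator (-A) x)"
        using Lip_b_abs_integrable[OF fin sts f nA, of False] by (simp add: M_def)
      have i2: "integrable \<nu> (\<lambda>x. C * \<bar>\<psi> x - indicator A x\<bar>)"
        using i\<psi>[of False] by (simp add: M_def)
      have "(\<integral>x. \<bar>?f2 x\<bar> \<partial>\<nu>) \<le> (\<integral>x. \<bar>f x\<bar> * indicator (-A) x + C * \<bar>\<psi> x - indicator A x\<bar> \<partial>\<nu>)"
      proof (rule integral_mono)
        show "integrable \<nu> (\<lambda>x. \<bar>?f2 x\<bar>)"
          using Lip_b_abs_integrable[OF fin sts f2, of UNIV False] by (simp add: M_def)
        fix x
        have "\<bar>f x\<bar> * (1 - \<psi> x) \<le> \<bar>f x\<bar> * (indicator (-A) x + \<bar>\<psi> x - indicator A x\<bar>)"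
          by (intro mult_left_mono) (auto simp: indicator_def)
        also have "\<dots> \<le> \<bar>f x\<bar> * indicator (-A) x + C * \<bar>\<psi> x - indicator A x\<bar>"
          unfolding distrib_left using C by (intro add_left_mono mult_right_mono) auto
        finally show "\<bar>?f2 x\<bar> \<le> \<bar>f x\<bar> * indicator (-A) x + C * \<bar>\<psi> x - indicator A x\<bar>"
          using \<psi>(2)[of x] by (simp add: abs_mult)
      qed (intro Bochner_Integration.integrable_add i1 i2)
      also have "\<dots> = ?J + C * (\<integral>x. \<bar>\<psi> x - indicator A x\<bar> \<partial>\<nu>)"
        using i1 i2 by simp
      also have "\<dots> \<le> ?J + C * e"
        using \<psi>(3)[of False] C(1) by (intro add_left_mono mult_left_mono) (auto simp: M_def)
      finally show ?thesis .
    qed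
    have "lip_const \<pi> * ((\<integral>x. \<bar>?f1 x\<bar> \<partial>\<mu>) + (\<integral>x. \<bar>?f2 x\<bar> \<partial>\<nu>)) \<le> lip_const \<pi> * ((?I + ?J) + 2 * C * e)"
      using 1 2 by (intro mult_left_mono lip_const_nonneg[OF \<pi>]) auto
    with T show ?thesis by linarith
  qed
  have "((\<lambda>e. lip_const \<pi> * ((?I + ?J) + 2 * C * e)) \<longlongrightarrow> lip_const \<pi> * ((?I + ?J) + 2 * C * 0)) (at_right 0)"
    by (intro tendsto_intros)
  moreover have "\<forall>\<^sub>F e in at_right 0. \<bar>T f \<pi>\<bar> \<le> lip_const \<pi> * ((?I + ?J) + 2 * C * e)"
    using eventually_at_right_less by (rule eventually_mono) (rule bd)
  ultimately have "\<bar>T f \<pi>\<bar> \<le> lip_const \<pi> * ((?I + ?J) + 2 * C * 0)"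
    by (rule tendsto_lowerbound) simp
  then show ?thesis by simp
qed

lemma (in finite_measure) measure_Diff_Int:
  assumes "A \<in> sets M" "B \<in> sets M"
  shows "measure M A = measure M (A - B) + measure M (A \<inter> B)"
proof -
  have "A = (A - B) \<union> (A \<inter> B)" by blast
  then show ?thesis using assms finite_measure_Union[of "A - B" "A \<inter> B"] by auto
qed

definition least_mass_bound :: "'a::metric_space functional1 \<Rightarrow> 'a measure \<Rightarrow> bool" where
  "least_mass_bound T \<mu> \<longleftrightarrow> mass_bound T \<mu> \<and>
     (\<forall>\<nu>. mass_bound T \<nu> \<longrightarrow> (\<forall>B\<in>sets borel. emeasure \<mu> B \<le> emeasure \<nu> B))"

text \<open>A density \<open>h\<close> of least total mass among all mass bounds absolutely continuous with respect to a
  given one; comparing with an arbitrary mass bound \<open>\<nu>\<close> via the Hahn decomposition of \<open>h \<mu>\<^sub>0 - \<nu>\<close>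
  shows that \<open>h \<mu>\<^sub>0\<close> is the least mass bound.\<close>

lemma least_mass_bound_exists:
  assumes bil: "bilinear_on_Lip T" and M: "mass_bound T M"
  shows "\<exists>\<mu>. least_mass_bound T \<mu>"
proof -
  note [measurable_cong] = mass_boundD(1)[OF M]
  interpret M: finite_measure M using mass_boundD(2)[OF M] .
  have spM: "space M = UNIV" using mass_boundD(1)[OF M] sets_eq_imp_space_eq by fastforce
  \<comment> \<open>Densities relative to the given bound \<open>M\<close> turn minima and
    decreasing limits of measures into pointwise minima and limits of functions.\<close>
  define G where "G = {g :: 'a \<Rightarrow> real. g \<in> borel_measurable borel \<and> (\<forall>x. 0 \<le> g x) \<and> integrable M g \<and>
      mass_bound T (density M g)}"
  have dens_int: "(\<integral>x. f x \<partial>density M g) = (\<integral>x. g x * f x \<partial>M)"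
    if "g \<in> borel_measurable borel" "\<forall>x. 0 \<le> g x" "f \<in> borel_measurable borel" for f g :: "'a \<Rightarrow> real"
    using that by (subst integral_real_density) auto
  have fin_dens: "finite_measure (density M g)"
    if "g \<in> borel_measurable borel" "\<forall>x. 0 \<le> g x" "integrable M g" for g :: "'a \<Rightarrow> real"
  proof (rule finite_measureI)
    have "emeasure (density M g) (space (density M g)) = (\<integral>\<^sup>+x. ennreal (g x) \<partial>M)"
      using that(1) spM by (subst emeasure_density) auto
    also have "\<dots> = ennreal (\<integral>x. g x \<partial>M)" using that by (intro nn_integral_eq_integral) auto
    finally show "emeasure (density M g) (space (density M g)) \<noteq> \<infinity>" by simp
  qed
  have int_prod: "integrable M (\<lambda>x. g x * f x)"
    if "g \<in> borel_measurable borel" "\<forall>x. 0 \<le> g x" "integrable M g" "f \<in> borel_measurable borel"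
      "\<And>x. \<bar>f x\<bar> \<le> C" for f g :: "'a \<Rightarrow> real" and C
  proof (rule Bochner_Integration.integrable_bound[of M "\<lambda>x. C * g x"])
    have "norm (g x * f x) \<le> norm (C * g x)" for x
      using mult_left_mono[OF that(5)[of x], of "g x"] that(2) order_trans[OF abs_ge_zero that(5)[of x]]
      by (simp add: abs_mult mult.commute)
    then show "AE x in M. norm (g x * f x) \<le> norm (C * g x)" by simp
  qed (use that in auto)
  have G_iff: "g \<in> G \<longleftrightarrow> (\<forall>f\<in>Lip_b. \<forall>\<pi>\<in>Lip. \<bar>T f \<pi>\<bar> \<le> lip_const \<pi> * (\<integral>x. g x * \<bar>f x\<bar> \<partial>M))"
    if "g \<in> borel_measurable borel" "\<forall>x. 0 \<le> g x" "integrable M g" for g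
  proof -
    have "(\<integral>x. \<bar>f x\<bar> \<partial>density M g) = (\<integral>x. g x * \<bar>f x\<bar> \<partial>M)" if "f \<in> Lip_b" for f
      using Lip_borel[OF Lip_b_Lip[OF that]] \<open>g \<in> borel_measurable borel\<close> \<open>\<forall>x. 0 \<le> g x\<close>
      by (intro dens_int) auto
    then show ?thesis
      using that fin_dens[OF that] mass_boundD(1)[OF M] by (auto simp: G_def mass_bound_def)
  qed
  have G1: "(\<lambda>_. 1) \<in> G"
    using mass_boundD(3)[OF M] by (subst G_iff) auto
  \<comment> \<open>Gluing along \<open>{g < h}\<close> keeps the smaller density on either
    side.\<close>
  have Gmin: "(\<lambda>x. min (g x) (h x)) \<in> G" if g: "g \<in> G" and h: "h \<in> G" for g h
  proof (subst G_iff)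
    have [measurable]: "g \<in> borel_measurable borel" "h \<in> borel_measurable borel"
      and g0: "\<forall>x. 0 \<le> g x" and h0: "\<forall>x. 0 \<le> h x" and gi: "integrable M g" and hi: "integrable M h"
      and gm: "mass_bound T (density M g)" and hm: "mass_bound T (density M h)"
      using g h by (auto simp: G_def)
    show "(\<lambda>x. min (g x) (h x)) \<in> borel_measurable borel" by measurable
    show "\<forall>x. 0 \<le> min (g x) (h x)" using g0 h0 by simp
    show "integrable M (\<lambda>x. min (g x) (h x))" using gi hi by (rule integrable_min)
    show "\<forall>f\<in>Lip_b. \<forall>\<pi>\<in>Lip. \<bar>T f \<pi>\<bar> \<le> lip_const \<pi> * (\<integral>x. min (g x) (h x) * \<bar>f x\<bar> \<partial>M)"
    proof (intro ballI)
      fix f \<pi> :: "'a \<Rightarrow> real" assume f: "f \<in> Lip_b" and \<pi>: "\<pi> \<in> Lip"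
      have [measurable]: "f \<in> borel_measurable borel" using f by (intro Lip_borel Lip_b_Lip)
      obtain C where C: "0 \<le> C" "\<And>x. \<bar>f x\<bar> \<le> C" using Lip_b_bound[OF f] by blast
      define A where "A = {x. g x < h x}"
      have A: "A \<in> sets borel" unfolding A_def by measurable
      note A[measurable]
      have "\<bar>T f \<pi>\<bar> \<le> lip_const \<pi> * ((\<integral>x. \<bar>f x\<bar> * indicator A x \<partial>density M g) +
          (\<integral>x. \<bar>f x\<bar> * indicator (-A) x \<partial>density M h))"
        by (rule mass_bound_glue[OF bil gm hm A f \<pi>])
      also have "(\<integral>x. \<bar>f x\<bar> * indicator A x \<partial>density M g) = (\<integral>x. g x * (\<bar>f x\<bar> * indicator A x) \<partial>M)"
        by (rule dens_int) (use g0 in auto)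
      also have "(\<integral>x. \<bar>f x\<bar> * indicator (-A) x \<partial>density M h) = (\<integral>x. h x * (\<bar>f x\<bar> * indicator (-A) x) \<partial>M)"
        by (rule dens_int) (use h0 in auto)
      also have "(\<integral>x. g x * (\<bar>f x\<bar> * indicator A x) \<partial>M) + (\<integral>x. h x * (\<bar>f x\<bar> * indicator (-A) x) \<partial>M)
         = (\<integral>x. g x * (\<bar>f x\<bar> * indicator A x) + h x * (\<bar>f x\<bar> * indicator (-A) x) \<partial>M)"
        using C by (intro Bochner_Integration.integral_add[symmetric] int_prod[where C = C] g0 h0 gi hi)
          (auto simp: indicator_def)
      also have "\<dots> = (\<integral>x. min (g x) (h x) * \<bar>f x\<bar> \<partial>M)"
        by (intro Bochner_Integration.integral_cong) (auto simp: A_def indicator_def min_def)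
      finally show "\<bar>T f \<pi>\<bar> \<le> lip_const \<pi> * (\<integral>x. min (g x) (h x) * \<bar>f x\<bar> \<partial>M)" .
    qed
  qed
  define I where "I = (INF g\<in>G. \<integral>x. g x \<partial>M)"
  have bb: "bdd_below ((\<lambda>g. \<integral>x. g x \<partial>M) ` G)"
    by (intro bdd_belowI[of _ 0]) (auto simp: G_def)
  have "\<exists>g\<in>G. (\<integral>x. g x \<partial>M) < I + 1 / Suc n" for n
    using cINF_less_iff[OF _ bb, of "I + 1 / Suc n"] G1 unfolding I_def by auto
  then obtain g where g: "\<And>n. g n \<in> G" "\<And>n. (\<integral>x. g n x \<partial>M) < I + 1 / Suc n"
    by metis
  \<comment> \<open>Running minima make the minimising sequence \<open>g\<close> decreasing without
    leaving \<open>G\<close>, so that it converges everywhere and not merely in the mean.\<close>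
  define h where "h = rec_nat (g 0) (\<lambda>n h x. min (h x) (g (Suc n) x))"
  have h0: "h 0 = g 0" and hS: "h (Suc n) = (\<lambda>x. min (h n x) (g (Suc n) x))" for n
    by (auto simp: h_def)
  have hG: "h n \<in> G" for n
    by (induct n) (auto simp: h0 hS g intro!: Gmin)
  have hg: "h n x \<le> g n x" for n x by (cases n) (auto simp: h0 hS)
  have hdec: "decseq (\<lambda>n. h n x)" for x by (rule decseq_SucI) (simp add: hS)
  have hnn: "0 \<le> h n x" for n x using hG by (auto simp: G_def)
  have hm[measurable]: "h n \<in> borel_measurable borel" for n using hG by (auto simp: G_def)
  have hi: "integrable M (h n)" for n using hG by (auto simp: G_def)
  define k where "k x = lim (\<lambda>n. h n x)" for x
  have hk: "(\<lambda>n. h n x) \<longlonglongrightarrow> k x" for x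
  proof -
    obtain L where "(\<lambda>n. h n x) \<longlonglongrightarrow> L"
      using decseq_convergent[OF hdec[of x], of 0] hnn by blast
    then show ?thesis unfolding k_def by (simp add: limI)
  qed
  have hle: "h n x \<le> h 0 x" for n x using hdec by (simp add: decseq_def)
  have km[measurable]: "k \<in> borel_measurable borel"
    by (rule borel_measurable_LIMSEQ_real[OF hk]) auto
  have knn: "\<forall>x. 0 \<le> k x" using LIMSEQ_le_const[OF hk] hnn by blast
  have kh: "k x \<le> h n x" for n x using decseq_ge[OF hdec hk] .
  have ki: "integrable M k"
    by (rule Bochner_Integration.integrable_bound[OF hi[of 0]]) (use kh hnn knn in \<open>auto\<close>)
  have conv: "(\<lambda>n. \<integral>x. h n x * f x \<partial>M) \<longlonglongrightarrow> (\<integral>x. k x * f x \<partial>M)"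
    if [measurable]: "f \<in> borel_measurable borel" and C: "\<And>x. \<bar>f x\<bar> \<le> C" for f C
  proof (rule integral_dominated_convergence[where w = "\<lambda>x. h 0 x * C"])
    show "AE x in M. norm (h i x * f x) \<le> h 0 x * C" for i
      using hnn hle C by (intro AE_I2) (auto simp: abs_mult intro!: mult_mono)
  qed (use hi in \<open>auto intro!: tendsto_mult hk\<close>)
  have kG: "k \<in> G"
  proof (subst G_iff)
    show "\<forall>f\<in>Lip_b. \<forall>\<pi>\<in>Lip. \<bar>T f \<pi>\<bar> \<le> lip_const \<pi> * (\<integral>x. k x * \<bar>f x\<bar> \<partial>M)"
    proof (intro ballI)
      fix f \<pi> :: "'a \<Rightarrow> real" assume f: "f \<in> Lip_b" and \<pi>: "\<pi> \<in> Lip"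
      have [measurable]: "f \<in> borel_measurable borel" using f by (intro Lip_borel Lip_b_Lip)
      obtain C where C: "0 \<le> C" "\<And>x. \<bar>f x\<bar> \<le> C" using Lip_b_bound[OF f] by blast
      have "(\<lambda>n. lip_const \<pi> * (\<integral>x. h n x * \<bar>f x\<bar> \<partial>M)) \<longlonglongrightarrow> lip_const \<pi> * (\<integral>x. k x * \<bar>f x\<bar> \<partial>M)"
        by (intro tendsto_mult_left conv[where C = C]) (use C in auto)
      moreover have "\<bar>T f \<pi>\<bar> \<le> lip_const \<pi> * (\<integral>x. h n x * \<bar>f x\<bar> \<partial>M)" for n
        using G_iff[of "h n"] hG hnn hi f \<pi> by auto
      ultimately show "\<bar>T f \<pi>\<bar> \<le> lip_const \<pi> * (\<integral>x. k x * \<bar>f x\<bar> \<partial>M)"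
        by (intro LIMSEQ_le_const) auto
    qed
  qed (use knn ki in auto)
  have kI: "(\<integral>x. k x \<partial>M) \<le> I"
  proof (rule LIMSEQ_le_const)
    show "(\<lambda>n. I + 1 / real (Suc n)) \<longlonglongrightarrow> I"
      using tendsto_add[OF tendsto_const LIMSEQ_inverse_real_of_nat] by (simp add: inverse_eq_divide)
    have "(\<integral>x. k x \<partial>M) \<le> (\<integral>x. g n x \<partial>M)" for n
      using g(1) by (intro integral_mono ki order_trans[OF kh hg]) (auto simp: G_def)
    then show "\<exists>N. \<forall>n\<ge>N. (\<integral>x. k x \<partial>M) \<le> I + 1 / real (Suc n)"
      using g(2) by (meson less_imp_le order_trans)
  qed
  define m where "m = density M k"
  have mb: "mass_bound T m" using kG by (simp add: G_def m_def)
  interpret m: finite_measure m using mass_boundD(2)[OF mb] .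
  have [measurable_cong]: "sets m = sets borel" using mass_boundD(1)[OF mb] .
  have "emeasure m B \<le> emeasure \<nu> B" if \<nu>: "mass_bound T \<nu>" and B: "B \<in> sets borel" for \<nu> B
  proof -
    note sn[measurable_cong] = mass_boundD(1)[OF \<nu>]
    interpret N: finite_measure \<nu> using mass_boundD(2)[OF \<nu>] .
    obtain Y where Y: "Y \<in> sets m" "\<And>X. X \<in> sets m \<Longrightarrow> X \<subseteq> Y \<Longrightarrow> emeasure \<nu> X \<le> emeasure m X"
      "\<And>X. X \<in> sets m \<Longrightarrow> X \<inter> Y = {} \<Longrightarrow> emeasure m X \<le> emeasure \<nu> X"
      using finite_unsigned_Hahn_decomposition[OF m.finite_measure_axioms N.finite_measure_axioms] sn
        mass_boundD(1)[OF mb] by auto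
    have Yb[measurable]: "Y \<in> sets borel" using Y(1) mass_boundD(1)[OF mb] by simp
    \<comment> \<open>\<open>\<nu>\<close> itself may be singular with respect to \<open>M\<close>.
      On \<open>Y\<close> it is dominated by \<open>m\<close>, so at least its restriction to
      \<open>Y\<close> has a density.\<close>
    define N' where "N' = density \<nu> (indicator Y)"
    have N'e: "emeasure N' X = emeasure \<nu> (Y \<inter> X)" if "X \<in> sets borel" for X
      using that sn unfolding N'_def by (subst emeasure_density) (auto simp: indicator_inter_arith[symmetric])
    have "finite_measure N'"
      by (rule finite_measureI) (auto simp: N'_def emeasure_density N.emeasure_eq_measure)
    moreover have "absolutely_continuous m N'"
      unfolding absolutely_continuous_def
    proof
      fix X assume X: "X \<in> null_sets m"
      then have Xb: "X \<in> sets borel" using mass_boundD(1)[OF mb] by auto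
      have "emeasure \<nu> (Y \<inter> X) \<le> emeasure m (Y \<inter> X)" using Xb mass_boundD(1)[OF mb] by (intro Y(2)) auto
      also have "\<dots> \<le> emeasure m X" using Xb mass_boundD(1)[OF mb] by (intro emeasure_mono) auto
      finally show "X \<in> null_sets N'" using X Xb N'e[of X] sn by (auto simp: null_sets_def N'_def)
    qed
    moreover have s': "sets N' = sets m" using sn mass_boundD(1)[OF mb] by (simp add: N'_def)
    ultimately obtain D where D: "D \<in> borel_measurable m" "AE x in m. RN_deriv m N' x = ennreal (D x)"
      "\<And>x. 0 \<le> D x"
      using m.real_RN_deriv by metis
    have Dm[measurable]: "D \<in> borel_measurable borel" using D(1) by simp
    have N'D: "N' = density m D"
      using m.density_RN_deriv[OF \<open>absolutely_continuous m N'\<close> s'] D(2)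
      by (subst (asm) density_cong[where f' = "\<lambda>x. ennreal (D x)"]) auto
    \<comment> \<open>The density of the measure that agrees with \<open>\<nu>\<close> on
      \<open>Y\<close> and with \<open>m\<close> off \<open>Y\<close>. Only in this form can
      \<open>\<nu>\<close> be compared with the minimiser \<open>k\<close>.\<close>
    define w where "w x = k x * (if x \<in> Y then D x else 1)" for x
    have wm[measurable]: "w \<in> borel_measurable borel" unfolding w_def by measurable
    have wnn: "\<forall>x. 0 \<le> w x" using knn D(3) by (simp add: w_def)
    have spl: "(\<integral>\<^sup>+x. ennreal (w x) * f x \<partial>M) = (\<integral>\<^sup>+x. f x * indicator Y x \<partial>\<nu>) + (\<integral>\<^sup>+x. f x * indicator (-Y) x \<partial>m)"
      if [measurable]: "f \<in> borel_measurable borel" for f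
    proof -
      have "(\<integral>\<^sup>+x. f x * indicator Y x \<partial>\<nu>) = (\<integral>\<^sup>+x. f x * indicator Y x \<partial>N')"
        unfolding N'_def by (subst nn_integral_density) (auto intro!: nn_integral_cong simp: indicator_def)
      also have "\<dots> = (\<integral>\<^sup>+x. ennreal (D x) * (f x * indicator Y x) \<partial>m)"
        unfolding N'D by (subst nn_integral_density) auto
      also have "\<dots> = (\<integral>\<^sup>+x. ennreal (k x) * (ennreal (D x) * (f x * indicator Y x)) \<partial>M)"
        unfolding m_def by (subst nn_integral_density) auto
      finally have 1: "(\<integral>\<^sup>+x. f x * indicator Y x \<partial>\<nu>) = \<dots>" .
      have 2: "(\<integral>\<^sup>+x. f x * indicator (-Y) x \<partial>m) = (\<integral>\<^sup>+x. ennreal (k x) * (f x * indicator (-Y) x) \<partial>M)"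
        unfolding m_def by (subst nn_integral_density) auto
      show ?thesis unfolding 1 2
        using D(3) knn by (subst nn_integral_add[symmetric])
          (auto intro!: nn_integral_cong simp: w_def indicator_def ennreal_mult mult.assoc)
    qed
    have wN: "(\<integral>\<^sup>+x. ennreal (w x) \<partial>M) = emeasure \<nu> Y + emeasure m (-Y)"
      using spl[of "\<lambda>_. 1"] sn mass_boundD(1)[OF mb] by simp
    have wi: "integrable M w"
      by (rule integrableI_nonneg) (use wnn wN in \<open>auto simp: N.emeasure_eq_measure m.emeasure_eq_measure less_top[symmetric]\<close>)
    have wr: "(\<integral>x. w x * f x \<partial>M) = (\<integral>x. f x * indicator Y x \<partial>\<nu>) + (\<integral>x. f x * indicator (-Y) x \<partial>m)"
      if [measurable]: "f \<in> borel_measurable borel" and f0: "\<And>x. 0 \<le> f x" and fC: "\<And>x. f x \<le> C" for f C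
    proof -
      have i: "integrable M (\<lambda>x. w x * f x)"
        by (rule int_prod[OF wm wnn wi, where C = C]) (use f0 fC in auto)
      have i1: "integrable \<nu> (\<lambda>x. f x * indicator Y x)"
        by (rule integrable_bounded_borel[OF N.finite_measure_axioms sn, where C = C])
          (use f0 fC order_trans[OF f0 fC] in \<open>auto simp: indicator_def\<close>)
      have i2: "integrable m (\<lambda>x. f x * indicator (-Y) x)"
        by (rule integrable_bounded_borel[OF m.finite_measure_axioms mass_boundD(1)[OF mb], where C = C])
          (use f0 fC order_trans[OF f0 fC] in \<open>auto simp: indicator_def\<close>)
      have "ennreal (\<integral>x. w x * f x \<partial>M) = (\<integral>\<^sup>+x. ennreal (w x) * ennreal (f x) \<partial>M)"
        using i wnn f0 by (subst nn_integral_eq_integral[symmetric]) (auto simp: ennreal_mult)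
      also have "\<dots> = (\<integral>\<^sup>+x. ennreal (f x * indicator Y x) \<partial>\<nu>) + (\<integral>\<^sup>+x. ennreal (f x * indicator (-Y) x) \<partial>m)"
        using f0 by (subst spl) (auto simp: ennreal_mult ennreal_indicator)
      also have "\<dots> = ennreal ((\<integral>x. f x * indicator Y x \<partial>\<nu>) + (\<integral>x. f x * indicator (-Y) x \<partial>m))"
        using i1 i2 f0 by (subst (1 2) nn_integral_eq_integral) (auto simp: ennreal_plus)
      finally show ?thesis
        using wnn f0 by (subst (asm) ennreal_inj) (auto intro!: integral_nonneg_AE add_nonneg_nonneg)
    qed
    have wG: "w \<in> G"
    proof (subst G_iff)
      show "\<forall>f\<in>Lip_b. \<forall>\<pi>\<in>Lip. \<bar>T f \<pi>\<bar> \<le> lip_const \<pi> * (\<integral>x. w x * \<bar>f x\<bar> \<partial>M)"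
      proof (intro ballI)
        fix f \<pi> :: "'a \<Rightarrow> real" assume f: "f \<in> Lip_b" and \<pi>: "\<pi> \<in> Lip"
        have [measurable]: "f \<in> borel_measurable borel" using f by (intro Lip_borel Lip_b_Lip)
        obtain C where C: "0 \<le> C" "\<And>x. \<bar>f x\<bar> \<le> C" using Lip_b_bound[OF f] by blast
        have "(\<integral>x. w x * \<bar>f x\<bar> \<partial>M) = (\<integral>x. \<bar>f x\<bar> * indicator Y x \<partial>\<nu>) + (\<integral>x. \<bar>f x\<bar> * indicator (-Y) x \<partial>m)"
          by (rule wr[where C = C]) (use C in auto)
        then show "\<bar>T f \<pi>\<bar> \<le> lip_const \<pi> * (\<integral>x. w x * \<bar>f x\<bar> \<partial>M)"
          using mass_bound_glue[OF bil \<nu> mb Yb f \<pi>] by simp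
      qed
    qed (use wm wnn wi in auto)
    have mU: "measure m UNIV = (\<integral>x. k x \<partial>M)"
      using dens_int[OF km knn, of "\<lambda>_. 1"] mass_boundD(1)[OF mb]
      by (simp add: m_def spM)
    \<comment> \<open>Since \<open>w\<close> lies in \<open>G\<close>, minimality of
      \<open>k\<close> gives \<open>m(Y) \<le> \<nu>(Y)\<close>. The Hahn decomposition gives the
      opposite inequality on \<open>Y - B\<close>; subtracting leaves the desired inequality on
      \<open>B \<inter> Y\<close>. Off \<open>Y\<close> it holds by the choice of
      \<open>Y\<close>.\<close>
    have "measure m UNIV \<le> (\<integral>x. w x \<partial>M)"
      unfolding mU using kI cINF_lower[OF bb wG] unfolding I_def by linarith
    also have "\<dots> = measure \<nu> Y + measure m (-Y)"
      using wr[of "\<lambda>_. 1" 1] sn mass_boundD(1)[OF mb] by simp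
    finally have "measure m Y \<le> measure \<nu> Y"
      using m.finite_measure_compl[of Y] Yb mass_boundD(1)[OF mb] sets_eq_imp_space_eq[OF mass_boundD(1)[OF mb]]
      by (simp add: Compl_eq_Diff_UNIV)
    moreover have "measure \<nu> (Y - B) \<le> measure m (Y - B)"
      using Y(2)[of "Y - B"] B mass_boundD(1)[OF mb]
      by (auto simp: N.emeasure_eq_measure m.emeasure_eq_measure)
    moreover have "measure \<nu> Y = measure \<nu> (Y - B) + measure \<nu> (B \<inter> Y)"
      using N.measure_Diff_Int[of Y B] B Yb sn by (simp add: Int_commute)
    moreover have "measure m Y = measure m (Y - B) + measure m (B \<inter> Y)"
      using m.measure_Diff_Int[of Y B] B Yb mass_boundD(1)[OF mb] by (simp add: Int_commute)
    ultimately have 1: "measure m (B \<inter> Y) \<le> measure \<nu> (B \<inter> Y)" by linarith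
    have 2: "measure m (B - Y) \<le> measure \<nu> (B - Y)"
      using Y(3)[of "B - Y"] B mass_boundD(1)[OF mb]
      by (auto simp: N.emeasure_eq_measure m.emeasure_eq_measure)
    have "measure m B = measure m (B - Y) + measure m (B \<inter> Y)"
      using m.measure_Diff_Int[of B Y] B Yb mass_boundD(1)[OF mb] by simp
    also have "\<dots> \<le> measure \<nu> (B - Y) + measure \<nu> (B \<inter> Y)" using 1 2 by simp
    also have "\<dots> = measure \<nu> B"
      using N.measure_Diff_Int[of B Y] B Yb sn by simp
    finally show ?thesis by (simp add: N.emeasure_eq_measure m.emeasure_eq_measure)
  qed
  with mb show ?thesis unfolding least_mass_bound_def by blast
qed

text \<open>Two least mass bounds agree on all Borel sets, so the definite description
  denotes.\<close>

lemma mass_measure_least: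
  assumes "bilinear_on_Lip T" "mass_bound T \<mu>"
  shows "least_mass_bound T (mass_measure T)"
proof -
  have "\<exists>!\<mu>. least_mass_bound T \<mu>"
  proof (rule ex_ex1I)
    show "\<exists>\<mu>. least_mass_bound T \<mu>" using least_mass_bound_exists assms by blast
    show "\<mu> = \<nu>" if "least_mass_bound T \<mu>" "least_mass_bound T \<nu>" for \<mu> \<nu>
      using that by (intro measure_eqI) (auto simp: least_mass_bound_def mass_bound_def intro: antisym)
  qed
  moreover have "mass_measure T = (THE \<mu>. least_mass_bound T \<mu>)"
    unfolding mass_measure_def least_mass_bound_def ..
  ultimately show ?thesis by (metis theI')
qed

section \<open>Approximation of functionals by molecules\<close>

text \<open>Vectors are functions supported in \<open>I\<close>, so that the dimension grows by one
  coordinate in each induction step. Homogeneity is required only as an inequality for positive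
  factors, the form in which it is obtained when \<open>g\<close> is an infimum.\<close>

lemma finite_dim_hahn_banach:
  fixes g :: "('i \<Rightarrow> real) \<Rightarrow> real"
  assumes fin: "finite I"
    and sub: "\<And>u v. g (\<lambda>i. u i + v i) \<le> g u + g v"
    and hom: "\<And>t u. 0 < t \<Longrightarrow> g (\<lambda>i. t * u i) \<le> t * g u"
    and zero: "0 \<le> g (\<lambda>_. 0)"
  shows "\<exists>a. \<forall>v. (\<forall>i. i \<notin> I \<longrightarrow> v i = 0) \<longrightarrow> (\<Sum>i\<in>I. a i * v i) \<le> g v"
  using fin
proof (induct I)
  case empty
  show ?case
  proof (intro exI[of _ "\<lambda>_. 0"] allI impI)
    fix v :: "'i \<Rightarrow> real" assume "\<forall>i. i \<notin> {} \<longrightarrow> v i = 0"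
    then have "v = (\<lambda>_. 0)" by auto
    then show "(\<Sum>i\<in>{}. 0 * v i) \<le> g v" using zero by simp
  qed
next
  case (insert j I)
  then obtain a where a: "\<And>v. (\<forall>i. i \<notin> I \<longrightarrow> v i = 0) \<Longrightarrow> (\<Sum>i\<in>I. a i * v i) \<le> g v"
    by blast
  define e :: "'i \<Rightarrow> real" where "e i = (if i = j then 1 else 0)" for i
  define V where "V = {v :: 'i \<Rightarrow> real. \<forall>i. i \<notin> I \<longrightarrow> v i = 0}"
  define l where "l v = (\<Sum>i\<in>I. a i * v i)" for v
  have l_add: "l (\<lambda>i. u i + v i) = l u + l v" for u v
    by (simp add: l_def sum.distrib algebra_simps)
  have l_mult: "l (\<lambda>i. t * u i) = t * l u" for t u
    by (simp add: l_def sum_distrib_left algebra_simps)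
  \<comment> \<open>\<open>p u\<close> bounds the new coefficient from below through vectors with
    entry -1 at \<open>j\<close>; the right-hand side of \<open>ineq\<close> bounds it from above
    through entry 1. Subadditivity makes the two families of constraints compatible, and scaling
    reduces every other nonzero entry to these.\<close>
  define p where "p u = l u - g (\<lambda>i. u i - e i)" for u
  have ineq: "p u \<le> g (\<lambda>i. w i + e i) - l w" if "u \<in> V" "w \<in> V" for u w
  proof -
    have "l u + l w \<le> g (\<lambda>i. u i + w i)"
      unfolding l_add[symmetric] unfolding l_def by (rule a) (use that in \<open>auto simp: V_def\<close>)
    also have "\<dots> = g (\<lambda>i. (u i - e i) + (w i + e i))" by simp
    also have "\<dots> \<le> g (\<lambda>i. u i - e i) + g (\<lambda>i. w i + e i)" by (rule sub)
    finally show ?thesis by (simp add: p_def)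
  qed
  have V0: "(\<lambda>_. 0) \<in> V" by (simp add: V_def)
  define \<alpha> where "\<alpha> = (SUP u\<in>V. p u)"
  have bdd: "bdd_above (p ` V)" using ineq[OF _ V0] by (auto intro!: bdd_aboveI)
  have lo: "p u \<le> \<alpha>" if "u \<in> V" for u unfolding \<alpha>_def using bdd that by (rule cSUP_upper2) simp
  have hi: "\<alpha> \<le> g (\<lambda>i. w i + e i) - l w" if "w \<in> V" for w
    unfolding \<alpha>_def using V0 ineq that by (intro cSUP_least) auto
  have "(\<Sum>i\<in>insert j I. (a(j := \<alpha>)) i * v i) \<le> g v" if v: "\<forall>i. i \<notin> insert j I \<longrightarrow> v i = 0" for v
  proof -
    define t where "t = v j"
    define w where "w i = (if i = j then 0 else v i)" for i
    have wV: "w \<in> V" using v by (auto simp: w_def V_def)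
    have sV: "(\<lambda>i. s * w i) \<in> V" for s using wV by (auto simp: V_def)
    have vw: "v = (\<lambda>i. w i + t * e i)" by (auto simp: w_def t_def e_def)
    have "(\<Sum>i\<in>insert j I. (a(j := \<alpha>)) i * v i) = \<alpha> * t + l w"
    proof -
      have "(\<Sum>i\<in>I. (a(j := \<alpha>)) i * v i) = l w"
        unfolding l_def using insert(2) by (intro sum.cong) (auto simp: w_def)
      then show ?thesis using insert(1,2) by (simp add: t_def)
    qed
    also have "\<dots> \<le> g v"
    proof (cases t "0 :: real" rule: linorder_cases)
      case equal
      then have "v = w" using vw by auto
      then show ?thesis using equal a[of w] wV by (simp add: l_def V_def)
    next
      case greater
      have "\<alpha> \<le> g (\<lambda>i. (1/t) * w i + e i) - l (\<lambda>i. (1/t) * w i)" by (rule hi[OF sV])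
      also have "(\<lambda>i. (1/t) * w i + e i) = (\<lambda>i. (1/t) * v i)"
        using greater by (auto simp: vw field_simps)
      finally have "\<alpha> \<le> g (\<lambda>i. (1/t) * v i) - (1/t) * l w" by (simp only: l_mult)
      also have "\<dots> \<le> (1/t) * g v - (1/t) * l w" using hom[of "1/t" v] greater by simp
      finally show ?thesis using greater by (simp add: field_simps)
    next
      case less
      define s where "s = - t"
      have s: "s > 0" using less by (simp add: s_def)
      have "l (\<lambda>i. (1/s) * w i) - g (\<lambda>i. (1/s) * w i - e i) \<le> \<alpha>" using lo[OF sV, of "1/s"] by (simp only: p_def)
      also have "(\<lambda>i. (1/s) * w i - e i) = (\<lambda>i. (1/s) * v i)"
        using s by (auto simp: vw s_def field_simps)
      finally have "(1/s) * l w - g (\<lambda>i. (1/s) * v i) \<le> \<alpha>" by (simp only: l_mult)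
      moreover have "g (\<lambda>i. (1/s) * v i) \<le> (1/s) * g v" using s by (intro hom) auto
      ultimately have "(1/s) * l w - (1/s) * g v \<le> \<alpha>" by linarith
      then have "s * ((1/s) * l w - (1/s) * g v) \<le> s * \<alpha>" using s by (intro mult_left_mono) auto
      then have "l w - g v \<le> s * \<alpha>" using s by (simp add: right_diff_distrib)
      then show ?thesis unfolding s_def by (simp add: mult.commute)
    qed
    finally show ?thesis .
  qed
  then show ?case by blast
qed

text \<open>McShane's extension: the lower envelope of the upward cones of slope \<open>L\<close>
  with vertices on the graph over \<open>F\<close>.\<close>

lemma mcshane_finite:
  fixes f :: "'a::metric_space \<Rightarrow> real"
  assumes "finite F" "F \<noteq> {}" "0 \<le> L" and L: "\<And>x y. x \<in> F \<Longrightarrow> y \<in> F \<Longrightarrow> \<bar>f x - f y\<bar> \<le> L * dist x y"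
  shows "\<exists>h. L-lipschitz_on UNIV h \<and> (\<forall>x\<in>F. h x = f x)"
proof -
  define h where "h x = Min ((\<lambda>z. f z + L * dist x z) ` F)" for x
  have le: "h x \<le> f z + L * dist x z" if "z \<in> F" for x z
    unfolding h_def using assms that by (intro Min_le) auto
  have ge: "\<exists>z\<in>F. h x = f z + L * dist x z" for x
  proof -
    have "h x \<in> (\<lambda>z. f z + L * dist x z) ` F" unfolding h_def using assms by (intro Min_in) auto
    then show ?thesis by blast
  qed
  have one: "h x - h y \<le> L * dist x y" for x y
  proof -
    obtain z where z: "z \<in> F" "h y = f z + L * dist y z" using ge by blast
    have "h x \<le> f z + L * dist x z" using le z by simp
    also have "\<dots> \<le> f z + L * (dist x y + dist y z)"
      using assms(3) by (intro add_left_mono mult_left_mono dist_triangle)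
    finally show ?thesis using z by (simp add: algebra_simps)
  qed
  have "L-lipschitz_on UNIV h"
  proof (rule lipschitz_on_realI[OF assms(3)])
    show "\<bar>h x - h y\<bar> \<le> L * dist x y" for x y
      using one[of x y] one[of y x] by (simp add: abs_le_iff dist_commute)
  qed
  moreover have "h x = f x" if "x \<in> F" for x
  proof (rule antisym)
    show "h x \<le> f x" using le[OF that, of x] by simp
    obtain z where "z \<in> F" "h x = f z + L * dist x z" using ge by blast
    then show "f x \<le> h x" using L[OF that, of z] by linarith
  qed
  ultimately show ?thesis by blast
qed

text \<open>The properties of a boundary \<open>\<partial>T\<close> that are inherited by the remainders of the iteration.\<close>

definition kr_functional :: "(('a::metric_space \<Rightarrow> real) \<Rightarrow> real) \<Rightarrow> real \<Rightarrow> bool" where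
  "kr_functional S K \<longleftrightarrow> 0 \<le> K \<and>
     (\<forall>f\<in>Lip. \<forall>g\<in>Lip. \<forall>a b. S (\<lambda>x. a * f x + b * g x) = a * S f + b * S g) \<and>
     (\<forall>f\<in>Lip. \<bar>S f\<bar> \<le> K * lip_const f) \<and>
     (\<forall>f\<in>Lip. \<forall>fs :: nat \<Rightarrow> 'a \<Rightarrow> real. (\<forall>j. fs j \<in> Lip) \<longrightarrow> bdd_above (range (\<lambda>j. lip_const (fs j))) \<longrightarrow>
        (\<forall>x. (\<lambda>j. fs j x) \<longlonglongrightarrow> f x) \<longrightarrow> (\<lambda>j. S (fs j)) \<longlonglongrightarrow> S f)"

lemma kr_functionalD:
  assumes "kr_functional S K"
  shows "0 \<le> K"
    "f \<in> Lip \<Longrightarrow> g \<in> Lip \<Longrightarrow> S (\<lambda>x. a * f x + b * g x) = a * S f + b * S g"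
    "f \<in> Lip \<Longrightarrow> \<bar>S f\<bar> \<le> K * lip_const f"
    "f \<in> Lip \<Longrightarrow> (\<And>j. fs j \<in> Lip) \<Longrightarrow> bdd_above (range (\<lambda>j. lip_const (fs j))) \<Longrightarrow>
        (\<And>x. (\<lambda>j. fs j x) \<longlonglongrightarrow> f x) \<Longrightarrow> (\<lambda>j. S (fs j)) \<longlonglongrightarrow> S f"
proof -
  note d = assms[unfolded kr_functional_def]
  show "0 \<le> K" using d by (rule conjunct1)
  show "S (\<lambda>x. a * f x + b * g x) = a * S f + b * S g" if "f \<in> Lip" "g \<in> Lip"
    using d[THEN conjunct2, THEN conjunct1] that by simp
  show "\<bar>S f\<bar> \<le> K * lip_const f" if "f \<in> Lip"
    using d[THEN conjunct2, THEN conjunct2, THEN conjunct1] that by simp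
  show "(\<lambda>j. S (fs j)) \<longlonglongrightarrow> S f" if "f \<in> Lip" "\<And>j. fs j \<in> Lip"
    "bdd_above (range (\<lambda>j. lip_const (fs j)))" "\<And>x. (\<lambda>j. fs j x) \<longlonglongrightarrow> f x"
    using d[THEN conjunct2, THEN conjunct2, THEN conjunct2, rule_format, OF that] .
qed

text \<open>Otherwise there are counterexamples that vanish on the first \<open>n\<close> points of
  a dense sequence. Normalised to Lipschitz constant at most 1 they tend to 0 pointwise, so
  continuity forces the values of \<open>S\<close> to 0, although these stay above \<open>e\<close>
  in modulus. Separability enters the whole proof here.\<close>

lemma kr_functional_small_off_finite:
  fixes S :: "('a::metric_space \<Rightarrow> real) \<Rightarrow> real"
  assumes sep: "separable_space (euclidean :: 'a topology)" and S: "kr_functional S K" and e: "0 < e"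
  shows "\<exists>F. finite F \<and> F \<noteq> {} \<and> (\<forall>f\<in>Lip. (\<forall>x\<in>F. f x = 0) \<longrightarrow> \<bar>S f\<bar> \<le> e * lip_const f)"
proof (rule ccontr)
  assume neg: "\<not> ?thesis"
  obtain D :: "'a set" where D: "countable D" "closure D = UNIV"
    using sep by (auto simp: separable_space_def euclidean_closure_of)
  then have "D \<noteq> {}" by auto
  define c where "c = from_nat_into D"
  have cD: "range c = D" unfolding c_def using D(1) \<open>D \<noteq> {}\<close> by (rule range_from_nat_into[rotated])
  have "\<exists>f\<in>Lip. (\<forall>k\<le>n. f (c k) = 0) \<and> \<bar>S f\<bar> > e * lip_const f" for n :: nat
    using neg by (auto dest!: spec[of _ "c ` {..n}"] simp: not_le)
  then obtain f where f: "\<And>n. f n \<in> Lip" "\<And>n k. k \<le> n \<Longrightarrow> f n (c k) = 0" "\<And>n. \<bar>S (f n)\<bar> > e * lip_const (f n)"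
    by metis
  have pos: "lip_const (f n) > 0" for n
  proof (rule ccontr)
    assume "\<not> ?thesis"
    then have "lip_const (f n) = 0" using lip_const_nonneg[OF f(1)[of n]] by simp
    then show False using kr_functionalD(3)[OF S f(1)[of n]] f(3)[of n] by simp
  qed
  \<comment> \<open>The summand with factor 0 brings a mere scaling into the two-term form of the
    linearity rule; the same device recurs below.\<close>
  define g where "g n x = (1 / lip_const (f n)) * f n x + 0 * f n x" for n x
  have gL: "g n \<in> Lip" for n unfolding g_def using f(1) by (rule Lip_lin) (rule f(1))
  have g1: "lip_const (g n) \<le> 1" for n
    using lip_const_lin[OF f(1) f(1), of "1 / lip_const (f n)" n 0 n] pos[of n] by (simp add: g_def[abs_def])
  have gS: "e < \<bar>S (g n)\<bar>" for n
  proof -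
    have "S (g n) = (1 / lip_const (f n)) * S (f n)"
      using kr_functionalD(2)[OF S f(1) f(1), of "1 / lip_const (f n)" n 0 n] by (simp add: g_def[abs_def])
    then have "\<bar>S (f n)\<bar> = lip_const (f n) * \<bar>S (g n)\<bar>" using pos[of n] by (simp add: abs_mult)
    then have "lip_const (f n) * e < lip_const (f n) * \<bar>S (g n)\<bar>" using f(3)[of n] by (simp add: mult.commute)
    then show ?thesis using pos[of n] by simp
  qed
  have glim: "(\<lambda>n. g n x) \<longlonglongrightarrow> 0" for x
  proof (rule LIMSEQ_I)
    fix r :: real assume r: "0 < r"
    have "x \<in> closure D" using D(2) by simp
    then obtain y where y: "y \<in> D" "dist y x < r" using r closure_approachable by blast
    then obtain k where k: "c k = y" using cD by blast
    have "norm (g n x - 0) < r" if "k \<le> n" for n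
    proof -
      have "\<bar>g n x - g n y\<bar> \<le> lip_const (g n) * dist x y" by (rule lip_const_bound[OF gL])
      also have "\<dots> \<le> 1 * dist x y" using g1 by (intro mult_right_mono) auto
      also have "\<dots> < r" using y by (simp add: dist_commute)
      finally show ?thesis using f(2)[OF that] k by (simp add: g_def)
    qed
    then show "\<exists>n0. \<forall>n\<ge>n0. norm (g n x - 0) < r" by blast
  qed
  have bdd: "bdd_above (range (\<lambda>j. lip_const (g j)))" using g1 by (intro bdd_aboveI2[of _ _ 1])
  have "(\<lambda>j. S (g j)) \<longlonglongrightarrow> S (\<lambda>_. 0)" by (rule kr_functionalD(4)[OF S Lip_const gL bdd glim])
  moreover have "S (\<lambda>_. 0) = 0" using kr_functionalD(3)[OF S, of "\<lambda>_. 0"] by simp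
  ultimately have "(\<lambda>j. \<bar>S (g j)\<bar>) \<longlonglongrightarrow> 0" using tendsto_rabs_zero by simp
  from eventually_happens'[OF sequentially_bot order_tendstoD(2)[OF this e]]
  obtain j where "\<bar>S (g j)\<bar> < e" ..
  then show False using gS[of j] by simp
qed

lemma Lip_nonempty: "Lip \<noteq> {}"
  using Lip_const by (metis empty_iff)

text \<open>The Hahn--Banach argument: the difference quotients over \<open>F\<close> map \<open>Lip\<close> into a finite-dimensional
  space, and \<open>S\<close> is dominated by \<open>K\<close> times the maximum norm of the image plus \<open>2 e Lip(f)\<close>, so the
  sandwiched linear functional on the finite-dimensional space provides the molecule.\<close>

lemma kr_functional_molecule:
  fixes S :: "('a::metric_space \<Rightarrow> real) \<Rightarrow> real"
  assumes S: "kr_functional S K" and F: "finite F" "F \<noteq> {}" and e: "0 \<le> e"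
    and small: "\<And>f. f \<in> Lip \<Longrightarrow> (\<forall>x\<in>F. f x = 0) \<Longrightarrow> \<bar>S f\<bar> \<le> e * lip_const f"
  shows "\<exists>a. (\<Sum>(x, y)\<in>F \<times> F. \<bar>a (x, y)\<bar> * dist x y) \<le> K \<and>
    (\<forall>f\<in>Lip. \<bar>S f - (\<Sum>(x, y)\<in>F \<times> F. a (x, y) * (f y - f x))\<bar> \<le> 2 * e * lip_const f)"
proof -
  note K = kr_functionalD(1)[OF S]
  note lin = kr_functionalD(2)[OF S]
  have S0: "S (\<lambda>_. 0) = 0" using kr_functionalD(3)[OF S, of "\<lambda>_. 0"] by simp
  define I where "I = F \<times> F"
  have I: "finite I" "I \<noteq> {}" using F by (auto simp: I_def)
  define N where "N u = Max ((\<lambda>i. \<bar>u i\<bar>) ` I)" for u :: "'a \<times> 'a \<Rightarrow> real"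
  have N_ge: "\<bar>u i\<bar> \<le> N u" if "i \<in> I" for u i unfolding N_def using I that by (intro Max_ge) auto
  have N_le: "N u \<le> M" if "\<And>i. i \<in> I \<Longrightarrow> \<bar>u i\<bar> \<le> M" for u M
    unfolding N_def using I that by (subst Max_le_iff) auto
  have N0: "0 \<le> N u" for u using N_ge I(2) abs_ge_zero order_trans by blast
  \<comment> \<open>On the diagonal the quotient is 0, by the convention for division by
    zero.\<close>
  define D where "D f = (\<lambda>(x, y). (f y - f x) / dist x y)" for f :: "'a \<Rightarrow> real"
  have ND: "N (D f) \<le> lip_const f" if "f \<in> Lip" for f
  proof (rule N_le)
    fix i assume "i \<in> I"
    obtain x y where i: "i = (x, y)" by fastforce
    show "\<bar>D f i\<bar> \<le> lip_const f"
      using lip_const_bound[OF that, of y x] lip_const_nonneg[OF that]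
      by (cases "x = y") (auto simp: i D_def divide_le_eq dist_commute)
  qed
  \<comment> \<open>Compare \<open>f\<close> with an extension \<open>h\<close> of its values on
    \<open>F\<close> whose Lipschitz constant is at most \<open>N (D f)\<close>. The difference
    vanishes on \<open>F\<close>, so it contributes only \<open>e\<close> times its own constant,
    which is at most \<open>2 * lip_const f\<close>.\<close>
  have ext: "S f \<le> K * N (D f) + 2 * e * lip_const f" if f: "f \<in> Lip" for f
  proof -
    have "\<bar>f x - f y\<bar> \<le> N (D f) * dist x y" if "x \<in> F" "y \<in> F" for x y
      using N_ge[of "(y, x)" "D f"] that
      by (cases "x = y") (auto simp: I_def D_def divide_le_eq dist_commute)
    then obtain h where h: "(N (D f))-lipschitz_on UNIV h" "\<forall>x\<in>F. h x = f x"
      using mcshane_finite[OF F N0] by blast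
    have hL: "h \<in> Lip" and hl: "lip_const h \<le> N (D f)" using h LipI lip_const_le by auto
    define d where "d x = 1 * f x + (-1) * h x" for x
    have dL: "d \<in> Lip" unfolding d_def using f hL by (rule Lip_lin)
    have "lip_const d \<le> lip_const f + lip_const h"
      using lip_const_lin[OF f hL, of 1 "-1"] by (simp add: d_def[abs_def])
    also have "\<dots> \<le> 2 * lip_const f" using hl ND[OF f] by simp
    finally have dl: "lip_const d \<le> 2 * lip_const f" .
    have "S d = S f - S h" using lin[OF f hL, of 1 "-1"] by (simp add: d_def[abs_def])
    moreover have "\<bar>S d\<bar> \<le> e * lip_const d" using h(2) by (intro small dL) (auto simp: d_def)
    moreover have "e * lip_const d \<le> e * (2 * lip_const f)" using dl e by (intro mult_left_mono)
    moreover have "\<bar>S h\<bar> \<le> K * lip_const h" using kr_functionalD(3)[OF S hL] .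
    moreover have "K * lip_const h \<le> K * N (D f)" using hl K by (intro mult_left_mono)
    ultimately show ?thesis by linarith
  qed
  \<comment> \<open>\<open>g\<close> is an infimal convolution: \<open>f = 0\<close> bounds it by
    \<open>K * N u\<close>, and \<open>u = - D f\<close> bounds it by
    \<open>2 * e * lip_const f - S f\<close>. A linear functional below \<open>g\<close> satisfies
    both estimates, one for its coefficients and one for its distance to \<open>S\<close>.\<close>
  define q where "q u f = K * N (\<lambda>i. u i + D f i) + 2 * e * lip_const f - S f" for u f
  define g where "g u = (INF f\<in>Lip. q u f)" for u
  \<comment> \<open>This is where \<open>ext\<close> is indispensable: it keeps the infimum
    finite.\<close>
  have q_lo: "- (K * N u) \<le> q u f" if f: "f \<in> Lip" for u f
  proof -
    have "N (D f) \<le> N (\<lambda>i. u i + D f i) + N u"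
    proof (rule N_le)
      fix i assume "i \<in> I"
      then show "\<bar>D f i\<bar> \<le> N (\<lambda>i. u i + D f i) + N u"
        using N_ge[of i "\<lambda>i. u i + D f i"] N_ge[of i u] by linarith
    qed
    then have "K * N (D f) \<le> K * N (\<lambda>i. u i + D f i) + K * N u"
      using K by (simp add: distrib_left[symmetric] mult_left_mono)
    then show ?thesis using ext[OF f] unfolding q_def by linarith
  qed
  have bdd: "bdd_below (q u ` Lip)" for u using q_lo by (auto intro!: bdd_belowI)
  have g_le: "g u \<le> q u f" if "f \<in> Lip" for u f
    unfolding g_def using bdd that by (intro cINF_lower)
  have g_ge: "z \<le> g u" if "\<And>f. f \<in> Lip \<Longrightarrow> z \<le> q u f" for z u
    unfolding g_def by (rule cINF_greatest[OF Lip_nonempty that])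
  have "\<exists>a. \<forall>v. (\<forall>i. i \<notin> I \<longrightarrow> v i = 0) \<longrightarrow> (\<Sum>i\<in>I. a i * v i) \<le> g v"
  proof (rule finite_dim_hahn_banach[OF I(1)])
    show "g (\<lambda>i. u i + v i) \<le> g u + g v" for u v
    proof -
      have *: "g (\<lambda>i. u i + v i) \<le> q u f + q v h" if f: "f \<in> Lip" and h: "h \<in> Lip" for f h
      proof -
        let ?s = "\<lambda>x. 1 * f x + 1 * h x"
        have "g (\<lambda>i. u i + v i) \<le> q (\<lambda>i. u i + v i) ?s" using Lip_lin[OF f h] by (rule g_le)
        moreover have "lip_const ?s \<le> lip_const f + lip_const h" using lip_const_lin[OF f h, of 1 1] by simp
        then have "2 * e * lip_const ?s \<le> 2 * e * lip_const f + 2 * e * lip_const h"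
          using e by (simp add: distrib_left[symmetric] mult_left_mono)
        moreover have "S ?s = S f + S h" using lin[OF f h, of 1 1] by simp
        moreover have "N (\<lambda>i. u i + v i + D ?s i) \<le> N (\<lambda>i. u i + D f i) + N (\<lambda>i. v i + D h i)"
        proof (rule N_le)
          fix i assume i: "i \<in> I"
          have "D ?s i = D f i + D h i" by (auto simp: D_def add_divide_distrib diff_divide_distrib split: prod.split)
          then show "\<bar>u i + v i + D ?s i\<bar> \<le> N (\<lambda>i. u i + D f i) + N (\<lambda>i. v i + D h i)"
            using N_ge[OF i, of "\<lambda>i. u i + D f i"] N_ge[OF i, of "\<lambda>i. v i + D h i"] by linarith
        qed
        then have "K * N (\<lambda>i. u i + v i + D ?s i) \<le> K * N (\<lambda>i. u i + D f i) + K * N (\<lambda>i. v i + D h i)"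
          using K by (simp add: distrib_left[symmetric] mult_left_mono)
        ultimately show ?thesis unfolding q_def by linarith
      qed
      have "g (\<lambda>i. u i + v i) - q u f \<le> g v" if "f \<in> Lip" for f
        using *[OF that] by (intro g_ge) (simp add: algebra_simps)
      then have "g (\<lambda>i. u i + v i) - g v \<le> g u" by (intro g_ge) (simp add: algebra_simps)
      then show ?thesis by simp
    qed
    show "g (\<lambda>i. t * u i) \<le> t * g u" if t: "0 < t" for t u
    proof -
      have "g (\<lambda>i. t * u i) / t \<le> q u f" if f: "f \<in> Lip" for f
      proof -
        let ?s = "\<lambda>x. t * f x + 0 * f x"
        have "g (\<lambda>i. t * u i) \<le> q (\<lambda>i. t * u i) ?s" using Lip_lin[OF f f] by (rule g_le)
        moreover have "lip_const ?s \<le> t * lip_const f" using lip_const_lin[OF f f, of t 0] t by simp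
        then have "2 * e * lip_const ?s \<le> 2 * e * (t * lip_const f)" using e by (intro mult_left_mono) auto
        moreover have "S ?s = t * S f" using lin[OF f f, of t 0] by simp
        moreover have "N (\<lambda>i. t * u i + D ?s i) \<le> t * N (\<lambda>i. u i + D f i)"
        proof (rule N_le)
          fix i assume i: "i \<in> I"
          have "t * u i + D ?s i = t * (u i + D f i)"
            by (auto simp: D_def algebra_simps diff_divide_distrib split: prod.split)
          then show "\<bar>t * u i + D ?s i\<bar> \<le> t * N (\<lambda>i. u i + D f i)"
            using N_ge[OF i, of "\<lambda>i. u i + D f i"] t by (simp add: abs_mult)
        qed
        then have "K * N (\<lambda>i. t * u i + D ?s i) \<le> K * (t * N (\<lambda>i. u i + D f i))"
          using K by (intro mult_left_mono)
        ultimately have "g (\<lambda>i. t * u i) \<le> t * q u f" unfolding q_def by (simp add: algebra_simps)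
        then show ?thesis using t by (simp add: divide_le_eq mult.commute)
      qed
      then have "g (\<lambda>i. t * u i) / t \<le> g u" by (rule g_ge)
      then show ?thesis using t by (simp add: divide_le_eq mult.commute)
    qed
    show "0 \<le> g (\<lambda>_. 0)" using ext by (intro g_ge) (auto simp: q_def)
  qed
  then obtain a where a: "\<And>v. (\<forall>i. i \<notin> I \<longrightarrow> v i = 0) \<Longrightarrow> (\<Sum>i\<in>I. a i * v i) \<le> g v" by blast
  have a': "(\<Sum>i\<in>I. a i * v i) \<le> q v f" if f: "f \<in> Lip" for v f
  proof -
    let ?v = "\<lambda>i. if i \<in> I then v i else 0"
    have "(\<Sum>i\<in>I. a i * v i) = (\<Sum>i\<in>I. a i * ?v i)" by (intro sum.cong) auto
    also have "\<dots> \<le> g ?v" by (rule a) simp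
    also have "\<dots> \<le> q ?v f" by (rule g_le[OF f])
    also have "q ?v f = q v f" unfolding q_def N_def by (simp cong: image_cong)
    finally show ?thesis .
  qed
  \<comment> \<open>Coefficients of difference quotients become weights of plain
    differences.\<close>
  define b where "b = (\<lambda>(x, y). a (x, y) / dist x y)"
  show ?thesis
  proof (intro exI[of _ b] conjI ballI)
    have "(\<Sum>(x, y)\<in>F \<times> F. \<bar>b (x, y)\<bar> * dist x y) \<le> (\<Sum>i\<in>I. \<bar>a i\<bar>)"
      unfolding I_def by (intro sum_mono) (auto simp: b_def)
    \<comment> \<open>Testing at the sign vector, whose maximum norm is at most 1, recovers the sum
      norm of the coefficients, the dual of the maximum norm.\<close>
    also have "\<dots> = (\<Sum>i\<in>I. a i * sgn (a i))" by (simp add: abs_sgn)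
    also have "\<dots> \<le> q (\<lambda>i. sgn (a i)) (\<lambda>_. 0)" by (rule a') simp
    also have "\<dots> = K * N (\<lambda>i. sgn (a i))" unfolding q_def by (simp add: S0 D_def case_prod_beta)
    also have "\<dots> \<le> K * 1" using K by (intro mult_left_mono N_le) (auto simp: abs_sgn_eq)
    finally show "(\<Sum>(x, y)\<in>F \<times> F. \<bar>b (x, y)\<bar> * dist x y) \<le> K" by simp
  next
    have one: "S f - (\<Sum>(x, y)\<in>F \<times> F. b (x, y) * (f y - f x)) \<le> 2 * e * lip_const f" if f: "f \<in> Lip" for f
    proof -
      have "(\<Sum>i\<in>I. a i * (- D f i)) \<le> q (\<lambda>i. - D f i) f" by (rule a'[OF f])
      also have "\<dots> = K * N (\<lambda>_. 0) + 2 * e * lip_const f - S f" by (simp add: q_def)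
      also have "\<dots> \<le> 2 * e * lip_const f - S f" using K N_le[of "\<lambda>_. 0" 0] N0[of "\<lambda>_. 0"] by simp
      finally have "S f - (\<Sum>i\<in>I. a i * D f i) \<le> 2 * e * lip_const f" by (simp add: sum_negf)
      moreover have "(\<Sum>i\<in>I. a i * D f i) = (\<Sum>(x, y)\<in>F \<times> F. b (x, y) * (f y - f x))"
        unfolding I_def by (intro sum.cong) (auto simp: b_def D_def)
      ultimately show ?thesis by simp
    qed
    fix f :: "'a \<Rightarrow> real" assume f: "f \<in> Lip"
    define h where "h x = (-1) * f x + 0 * f x" for x
    have hL: "h \<in> Lip" unfolding h_def by (rule Lip_lin[OF f f])
    have "S h = - S f" using lin[OF f f, of "-1" 0] by (simp add: h_def[abs_def])
    moreover have "lip_const h \<le> lip_const f" using lip_const_lin[OF f f, of "-1" 0] by (simp add: h_def[abs_def])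
    then have "2 * e * lip_const h \<le> 2 * e * lip_const f" using e by (intro mult_left_mono) auto
    moreover have "(\<Sum>(x, y)\<in>F \<times> F. b (x, y) * (h y - h x)) = - (\<Sum>(x, y)\<in>F \<times> F. b (x, y) * (f y - f x))"
      unfolding sum_negf[symmetric] by (intro sum.cong) (auto simp: h_def algebra_simps)
    ultimately show "\<bar>S f - (\<Sum>(x, y)\<in>F \<times> F. b (x, y) * (f y - f x))\<bar> \<le> 2 * e * lip_const f"
      using one[OF f] one[OF hL] by linarith
  qed
qed

section \<open>Riemann--Stieltjes integrals of Lipschitz functions\<close>

definition rs_sum :: "(real \<Rightarrow> real) \<Rightarrow> (real \<Rightarrow> real) \<Rightarrow> nat \<Rightarrow> real" where
  "rs_sum F p n = (\<Sum>k<2^n. F (real k / 2^n) * (p (real (Suc k) / 2^n) - p (real k / 2^n)))"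

definition rs_integral :: "(real \<Rightarrow> real) \<Rightarrow> (real \<Rightarrow> real) \<Rightarrow> real" where
  "rs_integral F p = lim (rs_sum F p)"

lemma lipschitz_on_absD:
  fixes f :: "real \<Rightarrow> real"
  shows "L-lipschitz_on UNIV f \<Longrightarrow> \<bar>f x - f y\<bar> \<le> L * \<bar>x - y\<bar>"
  using lipschitz_onD[of L UNIV f x y] by (simp add: dist_real_def)

text \<open>Refinement changes only the right half of each interval, where \<open>F\<close> is now
  read at the midpoint. Each of the \<open>2^n\<close> corrections is at most
  \<open>A * B * (1/4)^n\<close>.\<close>

lemma rs_sum_Suc_diff:
  assumes F: "A-lipschitz_on UNIV F" and p: "B-lipschitz_on UNIV p"
  shows "\<bar>rs_sum F p (Suc n) - rs_sum F p n\<bar> \<le> A * B * (1/2)^n"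
proof -
  have A: "0 \<le> A" and B: "0 \<le> B" using F p by (auto dest: lipschitz_on_nonneg)
  have split: "(\<Sum>i<2*m. f i) = (\<Sum>k<m. f (2*k) + f (2*k+1))" for f :: "nat \<Rightarrow> real" and m
    by (induct m) auto
  define s where "s k = real k / 2^n" for k
  define c where "c k = (2 * real k + 1) / 2^Suc n" for k
  have "rs_sum F p (Suc n) - rs_sum F p n =
      (\<Sum>k<2^n. F (s k) * (p (c k) - p (s k)) + F (c k) * (p (s (Suc k)) - p (c k))) -
      (\<Sum>k<2^n. F (s k) * (p (s (Suc k)) - p (s k)))"
    unfolding rs_sum_def power_Suc[of "2::nat"] split by (simp add: s_def c_def add_divide_distrib add_ac)
  also have "\<dots> = (\<Sum>k<2^n. (F (c k) - F (s k)) * (p (s (Suc k)) - p (c k)))"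
    unfolding sum_subtractf[symmetric] by (intro sum.cong) (auto simp: algebra_simps)
  finally have "\<bar>rs_sum F p (Suc n) - rs_sum F p n\<bar> \<le> (\<Sum>k<2^n. \<bar>(F (c k) - F (s k)) * (p (s (Suc k)) - p (c k))\<bar>)"
    by (simp add: sum_abs)
  also have "\<dots> \<le> (\<Sum>k<(2::nat)^n. A * B * (1/2)^n * (1/2)^n)"
  proof (rule sum_mono)
    fix k
    have "\<bar>F (c k) - F (s k)\<bar> \<le> A * \<bar>c k - s k\<bar>" by (rule lipschitz_on_absD[OF F])
    also have "\<bar>c k - s k\<bar> = (1/2)^n / 2" by (simp add: c_def s_def field_simps power_divide)
    also have "A * ((1/2)^n / 2) \<le> A * (1/2)^n" using A by (intro mult_left_mono) auto
    finally have 1: "\<bar>F (c k) - F (s k)\<bar> \<le> A * (1/2)^n" .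
    have "\<bar>p (s (Suc k)) - p (c k)\<bar> \<le> B * \<bar>s (Suc k) - c k\<bar>" by (rule lipschitz_on_absD[OF p])
    also have "\<bar>s (Suc k) - c k\<bar> = (1/2)^n / 2" by (simp add: c_def s_def field_simps power_divide)
    also have "B * ((1/2)^n / 2) \<le> B * (1/2)^n" using B by (intro mult_left_mono) auto
    finally have 2: "\<bar>p (s (Suc k)) - p (c k)\<bar> \<le> B * (1/2)^n" .
    have "\<bar>(F (c k) - F (s k)) * (p (s (Suc k)) - p (c k))\<bar> \<le> (A * (1/2)^n) * (B * (1/2)^n)"
      unfolding abs_mult using 1 2 A by (intro mult_mono) auto
    then show "\<bar>(F (c k) - F (s k)) * (p (s (Suc k)) - p (c k))\<bar> \<le> A * B * (1/2)^n * (1/2)^n"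
      by (simp add: algebra_simps)
  qed
  also have "\<dots> = A * B * (1/2)^n" by (simp add: power_divide)
  finally show ?thesis .
qed

lemma rs_sum_estimate:
  assumes F: "A-lipschitz_on UNIV F" and p: "B-lipschitz_on UNIV p" and "n \<le> m"
  shows "\<bar>rs_sum F p m - rs_sum F p n\<bar> \<le> 2 * A * B * (1/2)^n"
proof -
  have "\<bar>rs_sum F p m - rs_sum F p n\<bar> \<le> 2 * A * B * ((1/2)^n - (1/2)^m)"
    using \<open>n \<le> m\<close>
  proof (induct m rule: dec_induct)
    case (step m)
    have "\<bar>rs_sum F p (Suc m) - rs_sum F p n\<bar> \<le> A * B * (1/2)^m + 2 * A * B * ((1/2)^n - (1/2)^m)"
      using rs_sum_Suc_diff[OF F p, of m] step(3) by linarith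
    then show ?case by (simp add: algebra_simps)
  qed simp
  also have "\<dots> \<le> 2 * A * B * (1/2)^n"
    using F p by (intro mult_left_mono) (auto dest!: lipschitz_on_nonneg)
  finally show ?thesis .
qed

lemma rs_sum_tendsto:
  assumes F: "A-lipschitz_on UNIV F" and p: "B-lipschitz_on UNIV p"
  shows "rs_sum F p \<longlonglongrightarrow> rs_integral F p"
proof -
  have "Cauchy (rs_sum F p)"
  proof (rule CauchyI')
    fix e :: real assume "0 < e"
    have "(\<lambda>n. 2 * A * B * (1/2)^n) \<longlonglongrightarrow> 2 * A * B * 0"
      by (intro tendsto_intros LIMSEQ_realpow_zero) auto
    then have "\<forall>\<^sub>F n in sequentially. 2 * A * B * (1/2)^n < e"
      by (rule order_tendstoD(2)) (use \<open>0 < e\<close> in simp)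
    then obtain N where N: "2 * A * B * (1/2)^N < e" by (auto simp: eventually_sequentially)
    have "dist (rs_sum F p m) (rs_sum F p n) < e" if "N \<le> m" "m < n" for m n
    proof -
      have "dist (rs_sum F p m) (rs_sum F p n) \<le> 2 * A * B * (1/2)^m"
        using rs_sum_estimate[OF F p, of m n] that by (simp add: dist_real_def abs_minus_commute)
      also have "\<dots> \<le> 2 * A * B * (1/2)^N"
        using that F p by (intro mult_left_mono power_decreasing) (auto dest!: lipschitz_on_nonneg)
      finally show ?thesis using N by simp
    qed
    then show "\<exists>M. \<forall>m\<ge>M. \<forall>n>m. dist (rs_sum F p m) (rs_sum F p n) < e" by blast
  qed
  then show ?thesis
    unfolding rs_integral_def by (simp add: Cauchy_convergent_iff convergent_LIMSEQ_iff)
qed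

lemma rs_integral_eqI:
  assumes "A-lipschitz_on UNIV F" "B-lipschitz_on UNIV p" "rs_sum F p \<longlonglongrightarrow> l"
  shows "rs_integral F p = l"
  using LIMSEQ_unique[OF rs_sum_tendsto[OF assms(1,2)] assms(3)] .

lemma rs_integral_estimate:
  assumes F: "A-lipschitz_on UNIV F" and p: "B-lipschitz_on UNIV p"
  shows "\<bar>rs_integral F p - rs_sum F p n\<bar> \<le> 2 * A * B * (1/2)^n"
proof (rule LIMSEQ_le_const2)
  show "(\<lambda>m. \<bar>rs_sum F p m - rs_sum F p n\<bar>) \<longlonglongrightarrow> \<bar>rs_integral F p - rs_sum F p n\<bar>"
    by (intro tendsto_intros rs_sum_tendsto[OF F p])
  show "\<exists>N. \<forall>m\<ge>N. \<bar>rs_sum F p m - rs_sum F p n\<bar> \<le> 2 * A * B * (1/2)^n"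
    using rs_sum_estimate[OF F p] by blast
qed

lemma rs_integral_lin_left:
  assumes F: "A-lipschitz_on UNIV F" and H: "C-lipschitz_on UNIV H" and p: "B-lipschitz_on UNIV p"
  shows "rs_integral (\<lambda>t. a * F t + b * H t) p = a * rs_integral F p + b * rs_integral H p"
proof (rule rs_integral_eqI[OF lipschitz_on_add[OF lipschitz_on_cmult_real[OF F] lipschitz_on_cmult_real[OF H]] p])
  have "(\<lambda>n. a * rs_sum F p n + b * rs_sum H p n) \<longlonglongrightarrow> a * rs_integral F p + b * rs_integral H p"
    by (intro tendsto_intros rs_sum_tendsto[OF F p] rs_sum_tendsto[OF H p])
  moreover have "rs_sum (\<lambda>t. a * F t + b * H t) p = (\<lambda>n. a * rs_sum F p n + b * rs_sum H p n)"
    unfolding rs_sum_def by (auto simp: sum_distrib_left sum.distrib[symmetric] algebra_simps intro!: sum.cong)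
  ultimately show "rs_sum (\<lambda>t. a * F t + b * H t) p \<longlonglongrightarrow> a * rs_integral F p + b * rs_integral H p" by simp
qed

lemma rs_integral_lin_right:
  assumes F: "A-lipschitz_on UNIV F" and p: "B-lipschitz_on UNIV p" and q: "C-lipschitz_on UNIV q"
  shows "rs_integral F (\<lambda>t. a * p t + b * q t) = a * rs_integral F p + b * rs_integral F q"
proof (rule rs_integral_eqI[OF F lipschitz_on_add[OF lipschitz_on_cmult_real[OF p] lipschitz_on_cmult_real[OF q]]])
  have "(\<lambda>n. a * rs_sum F p n + b * rs_sum F q n) \<longlonglongrightarrow> a * rs_integral F p + b * rs_integral F q"
    by (intro tendsto_intros rs_sum_tendsto[OF F p] rs_sum_tendsto[OF F q])
  moreover have "rs_sum F (\<lambda>t. a * p t + b * q t) = (\<lambda>n. a * rs_sum F p n + b * rs_sum F q n)"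
    unfolding rs_sum_def by (auto simp: sum_distrib_left sum.distrib[symmetric] algebra_simps intro!: sum.cong)
  ultimately show "rs_sum F (\<lambda>t. a * p t + b * q t) \<longlonglongrightarrow> a * rs_integral F p + b * rs_integral F q" by simp
qed

lemma rs_integral_one: "rs_integral (\<lambda>_. 1) p = p 1 - p 0"
proof -
  have "rs_sum (\<lambda>_. 1) p n = p 1 - p 0" for n
    unfolding rs_sum_def using sum_lessThan_telescope[of "\<lambda>k. p (real k / 2^n)" "2^n"] by simp
  then have "rs_sum (\<lambda>_. 1) p = (\<lambda>_. p 1 - p 0)" by auto
  then show ?thesis unfolding rs_integral_def by simp
qed

text \<open>The error of the dyadic sums depends on the integrator only through \<open>B\<close>, so
  one level \<open>n\<close> serves all \<open>ps j\<close>. At a fixed level finitely many points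
  are involved, and pointwise convergence suffices. This is the source of the continuity
  axiom.\<close>

lemma rs_integral_tendsto:
  assumes F: "A-lipschitz_on UNIV F" and p: "B-lipschitz_on UNIV p"
    and ps: "\<And>j. B-lipschitz_on UNIV (ps j)" and lim: "\<And>t. (\<lambda>j :: nat. ps j t) \<longlonglongrightarrow> p t"
  shows "(\<lambda>j. rs_integral F (ps j)) \<longlonglongrightarrow> rs_integral F p"
proof (rule LIMSEQ_I)
  fix e :: real assume e: "0 < e"
  have "(\<lambda>n. 2 * A * B * (1/2)^n) \<longlonglongrightarrow> 2 * A * B * 0"
    by (intro tendsto_intros LIMSEQ_realpow_zero) auto
  then have "\<forall>\<^sub>F n in sequentially. 2 * A * B * (1/2)^n < e/3"
    by (rule order_tendstoD(2)) (use e in simp)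
  then obtain n where n: "2 * A * B * (1/2)^n < e/3" by (auto simp: eventually_sequentially)
  have "(\<lambda>j. rs_sum F (ps j) n) \<longlonglongrightarrow> rs_sum F p n"
    unfolding rs_sum_def by (intro tendsto_intros lim)
  then obtain N where N: "\<And>j. N \<le> j \<Longrightarrow> \<bar>rs_sum F (ps j) n - rs_sum F p n\<bar> < e/3"
    using LIMSEQ_D[of _ _ "e/3"] e by (metis divide_pos_pos real_norm_def zero_less_numeral)
  have "norm (rs_integral F (ps j) - rs_integral F p) < e" if "N \<le> j" for j
    using rs_integral_estimate[OF F p, of n] rs_integral_estimate[OF F ps, of j n] N[OF that] n
    unfolding real_norm_def by linarith
  then show "\<exists>N. \<forall>j\<ge>N. norm (rs_integral F (ps j) - rs_integral F p) < e" by blast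
qed

text \<open>\<open>G\<close> plays the role of a primitive of \<open>\<psi>\<close>, but only
  through a quadratic remainder estimate. An increment over a dyadic interval then contributes an
  error of order \<open>(1/4)^n\<close>, and there are \<open>2^n\<close> of them.\<close>

lemma rs_integral_chain:
  assumes F: "A-lipschitz_on UNIV F" "\<And>t. \<bar>F t\<bar> \<le> C" and p: "B-lipschitz_on UNIV p"
    and \<psi>: "D-lipschitz_on UNIV \<psi>" "\<And>y. \<bar>\<psi> y\<bar> \<le> 1" and G: "1-lipschitz_on UNIV G"
    and taylor: "\<And>x y. \<bar>G y - G x - \<psi> x * (y - x)\<bar> \<le> D * (y - x)\<^sup>2"
  shows "rs_integral (\<lambda>t. F t * \<psi> (p t)) p = rs_integral F (\<lambda>t. G (p t))"
proof -
  have C: "0 \<le> C" using F(2) abs_ge_zero order_trans by blast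
  have B: "0 \<le> B" and D: "0 \<le> D" using p \<psi> by (auto dest: lipschitz_on_nonneg)
  have "\<bar>rs_sum F (\<lambda>t. G (p t)) n - rs_sum (\<lambda>t. F t * \<psi> (p t)) p n\<bar> \<le> C * D * B\<^sup>2 * (1/2)^n" for n
  proof -
    define s where "s k = real k / 2^n" for k
    have "rs_sum F (\<lambda>t. G (p t)) n - rs_sum (\<lambda>t. F t * \<psi> (p t)) p n =
       (\<Sum>k<2^n. F (s k) * (G (p (s (Suc k))) - G (p (s k)) - \<psi> (p (s k)) * (p (s (Suc k)) - p (s k))))"
      unfolding rs_sum_def s_def sum_subtractf[symmetric] by (intro sum.cong) (auto simp: algebra_simps)
    then have "\<bar>rs_sum F (\<lambda>t. G (p t)) n - rs_sum (\<lambda>t. F t * \<psi> (p t)) p n\<bar> \<le>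
       (\<Sum>k<2^n. \<bar>F (s k) * (G (p (s (Suc k))) - G (p (s k)) - \<psi> (p (s k)) * (p (s (Suc k)) - p (s k)))\<bar>)"
      by (simp add: sum_abs)
    also have "\<dots> \<le> (\<Sum>k<(2::nat)^n. C * (D * (B * (1/2)^n)\<^sup>2))"
    proof (rule sum_mono)
      fix k
      have "\<bar>p (s (Suc k)) - p (s k)\<bar> \<le> B * \<bar>s (Suc k) - s k\<bar>" by (rule lipschitz_on_absD[OF p])
      also have "\<bar>s (Suc k) - s k\<bar> = (1/2)^n" by (simp add: s_def field_simps power_divide)
      finally have "\<bar>p (s (Suc k)) - p (s k)\<bar>\<^sup>2 \<le> (B * (1/2)^n)\<^sup>2" by (intro power_mono) auto
      then have "D * (p (s (Suc k)) - p (s k))\<^sup>2 \<le> D * (B * (1/2)^n)\<^sup>2" using D by (intro mult_left_mono) auto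
      with taylor have "\<bar>G (p (s (Suc k))) - G (p (s k)) - \<psi> (p (s k)) * (p (s (Suc k)) - p (s k))\<bar> \<le> D * (B * (1/2)^n)\<^sup>2"
        using order_trans by blast
      then show "\<bar>F (s k) * (G (p (s (Suc k))) - G (p (s k)) - \<psi> (p (s k)) * (p (s (Suc k)) - p (s k)))\<bar> \<le> C * (D * (B * (1/2)^n)\<^sup>2)"
        unfolding abs_mult using F(2) C by (intro mult_mono) auto
    qed
    also have "\<dots> = C * D * B\<^sup>2 * (1/2)^n" by (simp add: power2_eq_square power_divide field_simps)
    finally show ?thesis .
  qed
  note bd = this
  have "(\<lambda>n. C * D * B\<^sup>2 * (1/2)^n) \<longlonglongrightarrow> C * D * B\<^sup>2 * 0"
    by (intro tendsto_intros LIMSEQ_realpow_zero) auto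
  then have "(\<lambda>n. C * D * B\<^sup>2 * (1/2)^n) \<longlonglongrightarrow> 0" by simp
  then have lim0: "(\<lambda>n. rs_sum F (\<lambda>t. G (p t)) n - rs_sum (\<lambda>t. F t * \<psi> (p t)) p n) \<longlonglongrightarrow> 0"
    by (rule Lim_null_comparison[rotated]) (use bd in auto)
  have GP: "(1 * B)-lipschitz_on UNIV (\<lambda>t. G (p t))"
    by (rule lipschitz_on_compose2[OF p]) (rule lipschitz_on_subset[OF G], simp)
  have \<psi>P: "(D * B)-lipschitz_on UNIV (\<lambda>t. \<psi> (p t))"
    by (rule lipschitz_on_compose2[OF p]) (rule lipschitz_on_subset[OF \<psi>(1)], simp)
  have FP: "(C * (D * B) + 1 * A)-lipschitz_on UNIV (\<lambda>t. F t * \<psi> (p t))"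
    by (rule lipschitz_on_mult_bounded[OF F(1) _ C \<psi>P]) (use F(2) \<psi>(2) in auto)
  have "(\<lambda>n. rs_sum F (\<lambda>t. G (p t)) n - rs_sum (\<lambda>t. F t * \<psi> (p t)) p n) \<longlonglongrightarrow>
      rs_integral F (\<lambda>t. G (p t)) - rs_integral (\<lambda>t. F t * \<psi> (p t)) p"
    by (intro tendsto_diff rs_sum_tendsto[OF F(1) GP] rs_sum_tendsto[OF FP p])
  with lim0 show ?thesis using LIMSEQ_unique by fastforce
qed

lemma nn_integral_dyadic:
  fixes g :: "real \<Rightarrow> ennreal"
  assumes [measurable]: "g \<in> borel_measurable borel" and M: "0 < M"
  shows "(\<Sum>k<N. \<integral>\<^sup>+t. g t * indicator {real k / M..<real (Suc k) / M} t \<partial>lborel)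
    = (\<integral>\<^sup>+t. g t * indicator {0..<real N / M} t \<partial>lborel)"
proof (induct N)
  case (Suc N)
  have le: "0 \<le> real N / M" "real N / M \<le> real (Suc N) / M" using M by (auto simp: divide_right_mono)
  have "(\<integral>\<^sup>+t. g t * indicator {0..<real N / M} t \<partial>lborel) +
        (\<integral>\<^sup>+t. g t * indicator {real N / M..<real (Suc N) / M} t \<partial>lborel) =
     (\<integral>\<^sup>+t. g t * indicator {0..<real N / M} t + g t * indicator {real N / M..<real (Suc N) / M} t \<partial>lborel)"
    by (rule nn_integral_add[symmetric]) auto
  also have "\<dots> = (\<integral>\<^sup>+t. g t * indicator {0..<real (Suc N) / M} t \<partial>lborel)"
    using le by (intro nn_integral_cong) (auto simp: indicator_def)
  finally show ?case using Suc by simp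
qed simp

text \<open>The density \<open>s\<close> dominates the increments of \<open>p\<close>, so each term
  of the sum is at most \<open>P\<close> times the integral of \<open>\<bar>F\<bar> * s\<close> over
  its interval, up to the oscillation of \<open>F\<close> there. Half-open intervals tile
  \<open>{0..<1}\<close> without overlap.\<close>

lemma rs_integral_bound:
  fixes s :: "real \<Rightarrow> ennreal"
  assumes F: "A-lipschitz_on UNIV F" and p: "B-lipschitz_on UNIV p"
    and [measurable]: "s \<in> borel_measurable borel"
    and ps: "\<And>a b. 0 \<le> a \<Longrightarrow> a \<le> b \<Longrightarrow> b \<le> 1 \<Longrightarrow> ennreal \<bar>p b - p a\<bar> \<le> ennreal P * (\<integral>\<^sup>+t. s t * indicator {a..<b} t \<partial>lborel)"
    and fin: "(\<integral>\<^sup>+t. s t * indicator {0..<1} t \<partial>lborel) < \<infinity>"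
  shows "ennreal \<bar>rs_integral F p\<bar> \<le> ennreal P * (\<integral>\<^sup>+t. ennreal \<bar>F t\<bar> * (s t * indicator {0..<1} t) \<partial>lborel)"
proof -
  have A: "0 \<le> A" using F by (auto dest: lipschitz_on_nonneg)
  have [measurable]: "F \<in> borel_measurable borel"
    using lipschitz_on_continuous_on[OF F] by (rule borel_measurable_continuous_onI)
  define S where "S = (\<integral>\<^sup>+t. s t * indicator {0..<1} t \<partial>lborel)"
  define I where "I = (\<integral>\<^sup>+t. ennreal \<bar>F t\<bar> * (s t * indicator {0..<1} t) \<partial>lborel)"
  have bd: "ennreal \<bar>rs_sum F p n\<bar> \<le> ennreal P * (I + ennreal (A * (1/2)^n) * S)" for n
  proof -
    define J where "J k = {real k / 2^n..<real (Suc k) / 2^n}" for k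
    have "ennreal \<bar>rs_sum F p n\<bar> \<le> ennreal (\<Sum>k<2^n. \<bar>F (real k / 2^n)\<bar> * \<bar>p (real (Suc k) / 2^n) - p (real k / 2^n)\<bar>)"
      unfolding rs_sum_def by (intro ennreal_leI order_trans[OF sum_abs]) (simp add: abs_mult)
    also have "\<dots> = (\<Sum>k<2^n. ennreal \<bar>F (real k / 2^n)\<bar> * ennreal \<bar>p (real (Suc k) / 2^n) - p (real k / 2^n)\<bar>)"
      by (simp add: ennreal_mult[symmetric] sum_ennreal)
    also have "\<dots> \<le> (\<Sum>k<2^n. ennreal P * (\<integral>\<^sup>+t. (ennreal \<bar>F t\<bar> + ennreal (A * (1/2)^n)) * s t * indicator (J k) t \<partial>lborel))"
    proof (rule sum_mono)
      fix k :: nat assume "k \<in> {..<2^n}"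
      then have "real (Suc k) \<le> real (2^n)" by (intro of_nat_mono) auto
      then have k: "real (Suc k) / 2^n \<le> 1" by (simp add: divide_le_eq)
      have "ennreal \<bar>F (real k / 2^n)\<bar> * ennreal \<bar>p (real (Suc k) / 2^n) - p (real k / 2^n)\<bar>
        \<le> ennreal \<bar>F (real k / 2^n)\<bar> * (ennreal P * (\<integral>\<^sup>+t. s t * indicator (J k) t \<partial>lborel))"
        unfolding J_def using k by (intro mult_left_mono ps) (auto simp: divide_right_mono)
      also have "\<dots> = ennreal P * (\<integral>\<^sup>+t. ennreal \<bar>F (real k / 2^n)\<bar> * (s t * indicator (J k) t) \<partial>lborel)"
        by (subst nn_integral_cmult) (auto simp: J_def mult_ac)
      also have "\<dots> \<le> ennreal P * (\<integral>\<^sup>+t. (ennreal \<bar>F t\<bar> + ennreal (A * (1/2)^n)) * s t * indicator (J k) t \<partial>lborel)"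
      proof (intro mult_left_mono nn_integral_mono)
        fix t
        show "ennreal \<bar>F (real k / 2^n)\<bar> * (s t * indicator (J k) t)
           \<le> (ennreal \<bar>F t\<bar> + ennreal (A * (1/2)^n)) * s t * indicator (J k) t"
        proof (cases "t \<in> J k")
          case True
          have "\<bar>F (real k / 2^n) - F t\<bar> \<le> A * \<bar>real k / 2^n - t\<bar>" by (rule lipschitz_on_absD[OF F])
          also have "\<dots> \<le> A * (1/2)^n"
            using True A by (intro mult_left_mono) (auto simp: J_def abs_le_iff add_divide_distrib power_divide)
          finally have "\<bar>F (real k / 2^n)\<bar> \<le> \<bar>F t\<bar> + A * (1/2)^n" by linarith
          then have "ennreal \<bar>F (real k / 2^n)\<bar> \<le> ennreal \<bar>F t\<bar> + ennreal (A * (1/2)^n)"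
            using A by (simp add: ennreal_leI flip: ennreal_plus)
          then show ?thesis using True by (simp add: mult_right_mono)
        qed simp
      qed auto
      finally show "ennreal \<bar>F (real k / 2^n)\<bar> * ennreal \<bar>p (real (Suc k) / 2^n) - p (real k / 2^n)\<bar>
         \<le> ennreal P * (\<integral>\<^sup>+t. (ennreal \<bar>F t\<bar> + ennreal (A * (1/2)^n)) * s t * indicator (J k) t \<partial>lborel)" .
    qed
    also have "\<dots> = ennreal P * (\<integral>\<^sup>+t. (ennreal \<bar>F t\<bar> + ennreal (A * (1/2)^n)) * s t * indicator {0..<real (2^n) / 2^n} t \<partial>lborel)"
      unfolding J_def sum_distrib_left[symmetric] by (subst nn_integral_dyadic) auto
    also have "(\<integral>\<^sup>+t. (ennreal \<bar>F t\<bar> + ennreal (A * (1/2)^n)) * s t * indicator {0..<real (2^n) / 2^n} t \<partial>lborel)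
      = (\<integral>\<^sup>+t. ennreal \<bar>F t\<bar> * (s t * indicator {0..<1} t) + ennreal (A * (1/2)^n) * (s t * indicator {0..<1} t) \<partial>lborel)"
      by (intro nn_integral_cong) (simp add: algebra_simps)
    also have "\<dots> = I + ennreal (A * (1/2)^n) * S"
      unfolding I_def S_def by (subst nn_integral_add) (auto simp: nn_integral_cmult)
    finally show ?thesis .
  qed
  \<comment> \<open>Finiteness of \<open>S\<close> matters: a positive null sequence times infinity
    does not tend to 0.\<close>
  have "(\<lambda>n. ennreal P * (I + ennreal (A * (1/2)^n) * S)) \<longlonglongrightarrow> ennreal P * (I + ennreal (A * 0) * S)"
    using fin by (intro ennreal_tendsto_cmult tendsto_add tendsto_const tendsto_mult_ennreal tendsto_ennrealI tendsto_mult_left LIMSEQ_realpow_zero)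
      (auto simp: S_def[symmetric])
  moreover have "(\<lambda>n. ennreal \<bar>rs_sum F p n\<bar>) \<longlonglongrightarrow> ennreal \<bar>rs_integral F p\<bar>"
    by (intro tendsto_ennrealI tendsto_rabs rs_sum_tendsto[OF F p])
  ultimately have "ennreal \<bar>rs_integral F p\<bar> \<le> ennreal P * (I + ennreal (A * 0) * S)"
    by (rule tendsto_le[OF sequentially_bot]) (intro always_eventually allI bd)
  then show ?thesis by (simp add: I_def)
qed

section \<open>The speed of a Lipschitz curve\<close>

text \<open>A countable version of \<^const>\<open>metric_speed\<close>: measurability is immediate, it is at most the metric speed,
  and it still controls the increments of the curve.\<close>

definition seq_speed :: "(real \<Rightarrow> 'a::metric_space) \<Rightarrow> real \<Rightarrow> ennreal" where
  "seq_speed \<theta> t = limsup (\<lambda>n. ennreal (dist (\<theta> (t + 1 / real (Suc n))) (\<theta> t) / (1 / real (Suc n))))"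

lemma seq_speed_measurable:
  assumes "L-lipschitz_on UNIV \<theta>"
  shows "seq_speed \<theta> \<in> borel_measurable borel"
proof -
  have c: "continuous_on UNIV \<theta>" using assms by (rule lipschitz_on_continuous_on)
  have [measurable]: "(\<lambda>t. dist (\<theta> (t + 1 / real (Suc n))) (\<theta> t)) \<in> borel_measurable borel" for n
    by (intro borel_measurable_continuous_onI continuous_on_dist c continuous_on_compose2[OF c] continuous_intros) auto
  show ?thesis unfolding seq_speed_def[abs_def] by measurable
qed

lemma seq_speed_le_metric_speed: "seq_speed \<theta> t \<le> metric_speed \<theta> t"
  unfolding seq_speed_def metric_speed_def Limsup_def
proof (intro INF_greatest)
  fix P assume "P \<in> {P. eventually P (at_right (0::real))}"
  moreover have "filterlim (\<lambda>n. 1 / real (Suc n)) (at_right 0) sequentially"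
    unfolding filterlim_at using LIMSEQ_inverse_real_of_nat by (auto simp: inverse_eq_divide)
  ultimately have "eventually (\<lambda>n. P (1 / real (Suc n))) sequentially"
    by (auto simp: filterlim_iff)
  then show "(INF P\<in>{P. eventually P sequentially}. SUP n\<in>Collect P. ennreal (dist (\<theta> (t + 1 / real (Suc n))) (\<theta> t) / (1 / real (Suc n))))
     \<le> (SUP h\<in>Collect P. ennreal (dist (\<theta> (t + h)) (\<theta> t) / h))"
    by (intro INF_lower2[where i = "\<lambda>n. P (1 / real (Suc n))"] SUP_least) (auto intro: SUP_upper2)
qed

text \<open>For \<open>u(t) = d(\<theta>(a), \<theta>(t))\<close> the means of the difference quotients of \<open>u\<close> over \<open>[a,b]\<close> tend to
  \<open>u(b) - u(a)\<close>, and the reverse Fatou lemma moves the upper limit inside the integral.\<close>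

lemma dist_le_integral_seq_speed:
  fixes \<theta> :: "real \<Rightarrow> 'a::metric_space"
  assumes \<theta>: "L-lipschitz_on UNIV \<theta>" and ab: "a \<le> b"
  shows "ennreal (dist (\<theta> a) (\<theta> b)) \<le> (\<integral>\<^sup>+t. seq_speed \<theta> t * indicator {a..<b} t \<partial>lborel)"
proof -
  have c: "continuous_on UNIV \<theta>" using \<theta> by (rule lipschitz_on_continuous_on)
  have L: "0 \<le> L" using \<theta> by (rule lipschitz_on_nonneg)
  define u where "u t = dist (\<theta> a) (\<theta> t)" for t
  define h where "h n = 1 / real (Suc n)" for n
  have h: "0 < h n" "h n \<le> 1" for n by (auto simp: h_def)
  have h0: "h \<longlonglongrightarrow> 0" unfolding h_def using LIMSEQ_inverse_real_of_nat by (simp add: inverse_eq_divide)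
  define w where "w n t = dist (\<theta> (t + h n)) (\<theta> t) / h n" for n t
  have cu: "continuous_on S u" for S
    unfolding u_def by (intro continuous_on_dist continuous_intros continuous_on_subset[OF c]) auto
  have cw: "continuous_on S (w n)" for S n
    unfolding w_def using h(1)[of n]
    by (intro continuous_on_divide continuous_on_dist continuous_intros continuous_on_compose2[OF c] continuous_on_subset[OF c]) auto
  have [measurable]: "w n \<in> borel_measurable borel" for n using cw by (rule borel_measurable_continuous_onI)
  \<comment> \<open>Integrating from \<open>a - 1\<close> and up to \<open>b + 2\<close> makes all
    points of \<open>{a..b+1}\<close> interior, so that \<open>U\<close> has a two-sided derivative
    there; shifts by \<open>h n \<le> 1\<close> stay in this range.\<close>
  define U where "U x = integral {a-1..x} u" for x
  have dU: "(U has_real_derivative u x) (at x)" if "x \<in> {a..b+1}" for x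
  proof -
    have "(U has_real_derivative u x) (at x within {a-1..b+2})"
      unfolding U_def using that by (intro integral_has_real_derivative cu) auto
    moreover have "at x within {a-1..b+2} = at x"
      by (rule at_within_interior) (use that in auto)
    ultimately show ?thesis by simp
  qed
  \<comment> \<open>The integral of the quotient equals the difference of the means of
    \<open>u\<close> over intervals of length \<open>h n\<close> starting at \<open>b\<close> and at
    \<open>a\<close>. Continuity of \<open>u\<close> suffices both for this and for the
    limit.\<close>
  have int: "(\<integral>t. indicator {a..b} t *\<^sub>R ((u (t + h n) - u t) / h n) \<partial>lborel)
     = (U (b + h n) - U b) / h n - (U (a + h n) - U a) / h n" for n
  proof (rule integral_FTC_atLeastAtMost[OF ab])
    fix x assume x: "a \<le> x" "x \<le> b"
    have "((\<lambda>x. U (x + h n)) has_real_derivative u (x + h n)) (at x)"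
      using dU[of "x + h n"] x h[of n] by (simp add: DERIV_shift)
    then have "((\<lambda>x. (U (x + h n) - U x) / h n) has_real_derivative (u (x + h n) - u x) / h n) (at x)"
      using dU[of x] x by (intro DERIV_cdivide DERIV_diff) auto
    then show "((\<lambda>x. (U (x + h n) - U x) / h n) has_vector_derivative (u (x + h n) - u x) / h n) (at x within {a..b})"
      by (simp add: has_real_derivative_iff_has_vector_derivative has_vector_derivative_at_within)
  next
    show "continuous_on {a..b} (\<lambda>x. (u (x + h n) - u x) / h n)"
      using h(1)[of n] by (intro continuous_on_divide continuous_on_diff continuous_on_compose2[OF cu] continuous_intros cu) auto
  qed
  have fl: "filterlim h (at 0) sequentially"
    unfolding filterlim_at using h0 h(1) by (auto simp: less_le)
  have "(\<lambda>n. (U (x + h n) - U x) / h n) \<longlonglongrightarrow> u x" if "x \<in> {a..b+1}" for x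
    using filterlim_compose[OF DERIV_D[OF dU[OF that]] fl] .
  then have lim: "(\<lambda>n. (U (b + h n) - U b) / h n - (U (a + h n) - U a) / h n) \<longlonglongrightarrow> u b - u a"
    using ab by (intro tendsto_diff) auto
  have le: "ennreal ((U (b + h n) - U b) / h n - (U (a + h n) - U a) / h n) \<le> (\<integral>\<^sup>+t. ennreal (w n t) * indicator {a..b} t \<partial>lborel)" for n
  proof -
    have i1: "integrable lborel (\<lambda>t. indicator {a..b} t *\<^sub>R ((u (t + h n) - u t) / h n))"
    proof -
      have "continuous_on {a..b} (\<lambda>t. (u (t + h n) - u t) / h n)"
        using h(1)[of n] by (intro continuous_on_divide continuous_on_diff continuous_on_compose2[OF cu] continuous_intros cu) auto
      from borel_integrable_atLeastAtMost'[OF this] show ?thesis by (simp only: set_integrable_def)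
    qed
    have i2: "integrable lborel (\<lambda>t. indicator {a..b} t *\<^sub>R w n t)"
      using borel_integrable_atLeastAtMost'[of a b "w n"] cw by (auto simp: set_integrable_def)
    have wnn: "0 \<le> w n t" for t unfolding w_def using h(1)[of n] by auto
    have "(\<integral>t. indicator {a..b} t *\<^sub>R ((u (t + h n) - u t) / h n) \<partial>lborel) \<le> (\<integral>t. indicator {a..b} t *\<^sub>R w n t \<partial>lborel)"
    proof (rule integral_mono[OF i1 i2])
      fix t
      have "u (t + h n) - u t \<le> dist (\<theta> (t + h n)) (\<theta> t)"
        unfolding u_def using dist_triangle[of "\<theta> a" "\<theta> (t + h n)" "\<theta> t"] by (simp add: dist_commute)
      then show "indicator {a..b} t *\<^sub>R ((u (t + h n) - u t) / h n) \<le> indicator {a..b} t *\<^sub>R w n t"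
        unfolding w_def using h(1)[of n] by (auto simp: indicator_def divide_right_mono)
    qed
    then have "ennreal ((U (b + h n) - U b) / h n - (U (a + h n) - U a) / h n) \<le> ennreal (\<integral>t. indicator {a..b} t *\<^sub>R w n t \<partial>lborel)"
      unfolding int by (rule ennreal_leI)
    also have "\<dots> = (\<integral>\<^sup>+t. ennreal (indicator {a..b} t *\<^sub>R w n t) \<partial>lborel)"
      using i2 wnn by (intro nn_integral_eq_integral[symmetric]) auto
    also have "\<dots> = (\<integral>\<^sup>+t. ennreal (w n t) * indicator {a..b} t \<partial>lborel)"
      by (intro nn_integral_cong) (auto simp: indicator_def)
    finally show ?thesis .
  qed
  have "(\<lambda>n. ennreal ((U (b + h n) - U b) / h n - (U (a + h n) - U a) / h n)) \<longlonglongrightarrow> ennreal (u b - u a)"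
    by (intro tendsto_ennrealI lim)
  then have "ennreal (u b - u a) = limsup (\<lambda>n. ennreal ((U (b + h n) - U b) / h n - (U (a + h n) - U a) / h n))"
    by (intro lim_imp_Limsup[symmetric]) auto
  also have "\<dots> \<le> limsup (\<lambda>n. \<integral>\<^sup>+t. ennreal (w n t) * indicator {a..b} t \<partial>lborel)"
    by (intro Limsup_mono always_eventually allI le)
  also have "\<dots> \<le> (\<integral>\<^sup>+t. limsup (\<lambda>n. ennreal (w n t) * indicator {a..b} t) \<partial>lborel)"
  proof (rule nn_integral_limsup[where w = "\<lambda>t. ennreal L * indicator {a..b} t"])
    have "w n t \<le> L" for n t
      using lipschitz_onD[OF \<theta>, of "t + h n" t] h(1)[of n] by (simp add: w_def divide_le_eq dist_real_def)
    then show "AE t in lborel. ennreal (w n t) * indicator {a..b} t \<le> ennreal L * indicator {a..b} t" for n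
      by (intro AE_I2 mult_right_mono ennreal_leI) auto
    show "(\<integral>\<^sup>+t. ennreal L * indicator {a..b} t \<partial>lborel) < \<infinity>"
      using ab by (subst nn_integral_cmult) (auto simp: ennreal_mult_less_top)
  qed measurable
  also have "\<dots> = (\<integral>\<^sup>+t. seq_speed \<theta> t * indicator {a..<b} t \<partial>lborel)"
  proof (rule nn_integral_cong_AE)
    show "AE t in lborel. limsup (\<lambda>n. ennreal (w n t) * indicator {a..b} t) = seq_speed \<theta> t * indicator {a..<b} t"
      using AE_lborel_singleton[of b]
    proof eventually_elim
      case (elim t)
      show ?case
      proof (cases "t \<in> {a..b}")
        case True
        then show ?thesis using elim by (simp add: seq_speed_def w_def h_def)
      qed (auto simp: indicator_def Limsup_const)
    qed
  qed
  finally show ?thesis by (simp add: u_def)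
qed

text \<open>Curves are given on \<open>{0..1}\<close>, whereas sums and speeds are handled for
  functions that are Lipschitz on the whole line; extension by the end values keeps the Lipschitz
  constant.\<close>

definition clamp01 :: "(real \<Rightarrow> 'a) \<Rightarrow> real \<Rightarrow> 'a" where
  "clamp01 \<theta> t = \<theta> (max 0 (min 1 t))"

lemma clamp01_lipschitz:
  assumes "L-lipschitz_on {0..1} \<theta>"
  shows "L-lipschitz_on UNIV (clamp01 \<theta>)"
proof -
  have "1-lipschitz_on UNIV (\<lambda>t::real. max 0 (min 1 t))"
    by (rule lipschitz_on_realI) (auto simp: dist_real_def)
  then have "(L * 1)-lipschitz_on UNIV (\<lambda>t. \<theta> (max 0 (min 1 t)))"
    by (rule lipschitz_on_compose2) (rule lipschitz_on_subset[OF assms], auto)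
  then show ?thesis by (simp add: clamp01_def[abs_def])
qed

lemma clamp01_simps [simp]: "clamp01 \<theta> 0 = \<theta> 0" "clamp01 \<theta> 1 = \<theta> 1"
  by (auto simp: clamp01_def)

text \<open>For \<open>t < 1\<close> the points \<open>t + 1 / real (Suc n)\<close> eventually lie
  in \<open>{0..1}\<close>, where clamping changes nothing. The point \<open>t = 1\<close> is
  excluded on both sides.\<close>

lemma integral_seq_speed_clamp01:
  "(\<integral>\<^sup>+t. seq_speed (clamp01 \<theta>) t * indicator {0..<1} t \<partial>lborel) \<le> curve_length \<theta>"
  unfolding curve_length_def
proof (rule nn_integral_mono)
  fix t :: real
  show "seq_speed (clamp01 \<theta>) t * indicator {0..<1} t \<le> metric_speed \<theta> t * indicator {0..<1} t"
  proof (cases "t \<in> {0..<1}")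
    case True
    have "(\<lambda>n. t + 1 / real (Suc n)) \<longlonglongrightarrow> t + 0"
      using LIMSEQ_inverse_real_of_nat by (intro tendsto_add tendsto_const) (simp add: inverse_eq_divide)
    then have "\<forall>\<^sub>F n in sequentially. t + 1 / real (Suc n) < 1"
      by (rule order_tendstoD(2)) (use True in simp)
    then have "\<forall>\<^sub>F n in sequentially. ennreal (dist (clamp01 \<theta> (t + 1 / real (Suc n))) (clamp01 \<theta> t) / (1 / real (Suc n)))
        = ennreal (dist (\<theta> (t + 1 / real (Suc n))) (\<theta> t) / (1 / real (Suc n)))"
    proof eventually_elim
      case (elim n)
      have "0 \<le> t + 1 / real (Suc n)" using True by (intro add_nonneg_nonneg) auto
      with elim True show ?case by (simp add: clamp01_def)
    qed
    then have "seq_speed (clamp01 \<theta>) t = seq_speed \<theta> t"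
      unfolding seq_speed_def by (rule Limsup_eq)
    then show ?thesis by (simp only: mult_right_mono seq_speed_le_metric_speed zero_le)
  qed simp
qed

section \<open>Countable sums of curves as currents\<close>

lemma lip_curve:
  fixes \<theta> :: "'b::metric_space \<Rightarrow> 'a::metric_space" and f :: "'a \<Rightarrow> real"
  assumes "L-lipschitz_on UNIV \<theta>" "C-lipschitz_on UNIV f"
  shows "(C * L)-lipschitz_on UNIV (\<lambda>t. f (\<theta> t))"
  by (rule lipschitz_on_compose2[OF assms(1)]) (rule lipschitz_on_subset[OF assms(2)], simp)

text \<open>The parameters in \<open>{0..1}\<close> that are mapped into \<open>spt f\<close> form a
  compact subset of the open preimage of \<open>U\<close>, so some margin \<open>e\<close> is
  uniform. Once the mesh is below \<open>e\<close>, in every term either \<open>f\<close> vanishes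
  or both endpoints are mapped into \<open>U\<close>, where \<open>\<pi>\<close> is
  constant.\<close>

lemma rs_integral_local:
  fixes \<theta> :: "real \<Rightarrow> 'a::metric_space"
  assumes \<theta>: "L-lipschitz_on UNIV \<theta>" and f: "f \<in> Lip" and \<pi>: "\<pi> \<in> Lip"
    and U: "open U" "spt f \<subseteq> U" "\<forall>x\<in>U. \<pi> x = k"
  shows "rs_integral (\<lambda>t. f (\<theta> t)) (\<lambda>t. \<pi> (\<theta> t)) = 0"
proof -
  have c: "continuous_on UNIV \<theta>" using \<theta> by (rule lipschitz_on_continuous_on)
  define K where "K = {0..1} \<inter> \<theta> -` spt f"
  have "closed (\<theta> -` spt f)"
    using continuous_closed_vimage[of "spt f" \<theta>] c by (simp add: spt_def continuous_on_eq_continuous_at)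
  then have K: "compact K" unfolding K_def by (intro compact_Int_closed) auto
  have V: "open (\<theta> -` U)"
    using continuous_open_vimage[OF U(1), of \<theta>] c by (simp add: continuous_on_eq_continuous_at)
  have "K \<subseteq> \<theta> -` U" using U(2) by (auto simp: K_def)
  then obtain e where e: "e > 0" "(\<Union>x\<in>K. ball x e) \<subseteq> \<theta> -` U"
    by (rule compact_subset_open_imp_ball_epsilon_subset[OF K V])
  obtain N where N: "(1/2::real)^N < e" using e(1) real_arch_pow_inv[of e "1/2"] by auto
  have zero: "rs_sum (\<lambda>t. f (\<theta> t)) (\<lambda>t. \<pi> (\<theta> t)) n = 0" if n: "N \<le> n" for n
    unfolding rs_sum_def
  proof (rule sum.neutral, rule ballI)
    fix j :: nat assume "j \<in> {..<2^n}"
    then have "real j \<le> real (2^n)" by (intro of_nat_mono) auto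
    then have j: "real j / 2^n \<in> {0..1}" by (simp add: divide_le_eq)
    show "f (\<theta> (real j / 2^n)) * (\<pi> (\<theta> (real (Suc j) / 2^n)) - \<pi> (\<theta> (real j / 2^n))) = 0"
    proof (cases "f (\<theta> (real j / 2^n)) = 0")
      case False
      then have "\<theta> (real j / 2^n) \<in> spt f" 
        using closure_subset[of "{x. f x \<noteq> 0}"] by (auto simp: spt_def)
      then have jK: "real j / 2^n \<in> K" using j by (simp add: K_def)
      have "(1/2::real)^n \<le> (1/2)^N" using n by (intro power_decreasing) auto
      then have "dist (real j / 2^n) (real (Suc j) / 2^n) < e"
        using N by (simp add: dist_real_def power_divide add_divide_distrib)
      then have "\<theta> (real (Suc j) / 2^n) \<in> U" "\<theta> (real j / 2^n) \<in> U"
        using e jK by (auto simp: subset_eq)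
      then show ?thesis using U(3) by simp
    qed simp
  qed
  show ?thesis
  proof (rule rs_integral_eqI[OF lip_curve[OF \<theta> lip_const_lipschitz[OF f]] lip_curve[OF \<theta> lip_const_lipschitz[OF \<pi>]]])
    show "rs_sum (\<lambda>t. f (\<theta> t)) (\<lambda>t. \<pi> (\<theta> t)) \<longlonglongrightarrow> 0"
      using zero by (intro tendsto_eventually) (auto simp: eventually_sequentially)
  qed
qed

text \<open>The \<open>l i\<close> are upper bounds for the lengths, so they are real numbers; a
  negative weight reverses the orientation of its curve.\<close>

locale curve_family =
  fixes a l L :: "nat \<Rightarrow> real" and \<theta> :: "nat \<Rightarrow> real \<Rightarrow> 'a::metric_space"
  assumes lip: "\<And>i. (L i)-lipschitz_on UNIV (\<theta> i)"
    and len: "\<And>i. (\<integral>\<^sup>+t. seq_speed (\<theta> i) t * indicator {0..<1} t \<partial>lborel) \<le> ennreal (l i)"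
    and l0: "\<And>i. 0 \<le> l i"
    and sum: "summable (\<lambda>i. \<bar>a i\<bar> * l i)"
begin

definition piece :: "nat \<Rightarrow> 'a functional1" where
  "piece i f \<pi> = rs_integral (\<lambda>t. f (\<theta> i t)) (\<lambda>t. \<pi> (\<theta> i t))"

definition current :: "'a functional1" where
  "current f \<pi> = (\<Sum>i. a i * piece i f \<pi>)"

definition speed :: "nat \<Rightarrow> real \<Rightarrow> ennreal" where
  "speed i t = seq_speed (\<theta> i) t * indicator {0..<1} t"

text \<open>The sum of the weighted arc-length measures of the curves, obtained as one push-forward
  from a disjoint union of parameter lines.\<close>

definition bound :: "'a measure" where
  "bound = distr (density (count_space UNIV \<Otimes>\<^sub>M lborel) (\<lambda>(i, t). ennreal \<bar>a i\<bar> * speed i t)) borel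
     (\<lambda>(i, t). \<theta> i t)"

section \<open>Mass estimates for the sum of curves\<close>

lemma cont: "continuous_on UNIV (\<theta> i)"
  using lip by (rule lipschitz_on_continuous_on)

lemma speed_measurable [measurable]: "speed i \<in> borel_measurable borel"
  unfolding speed_def[abs_def] using seq_speed_measurable[OF lip[of i]] by measurable

lemma \<theta>_measurable [measurable]: "\<theta> i \<in> borel_measurable borel"
  using cont by (rule borel_measurable_continuous_onI)

lemma sets_bound: "sets bound = sets borel"
  by (simp add: bound_def)

lemma nn_integral_bound:
  assumes [measurable]: "g \<in> borel_measurable borel"
  shows "(\<integral>\<^sup>+x. g x \<partial>bound) = (\<Sum>i. ennreal \<bar>a i\<bar> * (\<integral>\<^sup>+t. g (\<theta> i t) * speed i t \<partial>lborel))"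
proof -
  have m1: "(\<lambda>(i, t). \<theta> i t) \<in> (count_space UNIV \<Otimes>\<^sub>M lborel) \<rightarrow>\<^sub>M borel"
    by (rule measurable_pair_measure_countable1) auto
  have m2: "(\<lambda>(i, t). ennreal \<bar>a i\<bar> * speed i t) \<in> borel_measurable (count_space UNIV \<Otimes>\<^sub>M lborel)"
    by (rule measurable_pair_measure_countable1) auto
  note m1[measurable] m2[measurable]
  have "(\<integral>\<^sup>+x. g x \<partial>bound) = (\<integral>\<^sup>+z. (case z of (i, t) \<Rightarrow> ennreal \<bar>a i\<bar> * speed i t) * g (case z of (i, t) \<Rightarrow> \<theta> i t)
      \<partial>(count_space UNIV \<Otimes>\<^sub>M lborel))"
    unfolding bound_def by (subst nn_integral_distr, simp, simp, subst nn_integral_density) auto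
  also have "\<dots> = (\<integral>\<^sup>+i. \<integral>\<^sup>+t. ennreal \<bar>a i\<bar> * speed i t * g (\<theta> i t) \<partial>lborel \<partial>count_space UNIV)"
    by (subst lborel.nn_integral_fst[symmetric]) auto
  also have "\<dots> = (\<Sum>i. \<integral>\<^sup>+t. ennreal \<bar>a i\<bar> * speed i t * g (\<theta> i t) \<partial>lborel)"
    by (rule nn_integral_count_space_nat)
  also have "\<dots> = (\<Sum>i. ennreal \<bar>a i\<bar> * (\<integral>\<^sup>+t. g (\<theta> i t) * speed i t \<partial>lborel))"
    by (intro suminf_cong) (subst nn_integral_cmult[symmetric], auto simp: mult_ac)
  finally show ?thesis .
qed

lemma emeasure_bound: "emeasure bound UNIV \<le> ennreal (\<Sum>i. \<bar>a i\<bar> * l i)"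
proof -
  have "emeasure bound UNIV = (\<integral>\<^sup>+x. 1 \<partial>bound)"
    using sets_eq_imp_space_eq[OF sets_bound] by simp
  also have "\<dots> = (\<Sum>i. ennreal \<bar>a i\<bar> * (\<integral>\<^sup>+t. speed i t \<partial>lborel))"
    by (subst nn_integral_bound) auto
  also have "\<dots> \<le> (\<Sum>i. ennreal (\<bar>a i\<bar> * l i))"
    using len l0 by (intro suminf_le) (auto simp: speed_def ennreal_mult intro!: mult_left_mono)
  also have "\<dots> = ennreal (\<Sum>i. \<bar>a i\<bar> * l i)"
    using l0 sum by (intro suminf_ennreal2) auto
  finally show ?thesis .
qed

lemma finite_bound: "finite_measure bound"
  using emeasure_bound sets_eq_imp_space_eq[OF sets_bound]
  by (intro finite_measureI) (auto simp: top_unique)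

text \<open>Along the curve the increments of \<open>\<pi>\<close> are controlled by
  \<open>lip_const \<pi>\<close> times the integrated sequential speed, so
  \<open>rs_integral_bound\<close> applies with this density.\<close>

lemma piece_bound:
  assumes f: "f \<in> Lip" and \<pi>: "\<pi> \<in> Lip"
  shows "ennreal \<bar>piece i f \<pi>\<bar> \<le> ennreal (lip_const \<pi>) * (\<integral>\<^sup>+t. ennreal \<bar>f (\<theta> i t)\<bar> * speed i t \<partial>lborel)"
  unfolding piece_def speed_def
proof (rule rs_integral_bound[OF lip_curve[OF lip lip_const_lipschitz[OF f]] lip_curve[OF lip lip_const_lipschitz[OF \<pi>]]])
  show "seq_speed (\<theta> i) \<in> borel_measurable borel" by (rule seq_speed_measurable[OF lip])
  show "(\<integral>\<^sup>+t. seq_speed (\<theta> i) t * indicator {0..<1} t \<partial>lborel) < \<infinity>"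
    using len[of i] by (auto simp: less_top[symmetric] top_unique)
  fix x y :: real assume "0 \<le> x" "x \<le> y" "y \<le> 1"
  have "ennreal \<bar>\<pi> (\<theta> i y) - \<pi> (\<theta> i x)\<bar> \<le> ennreal (lip_const \<pi> * dist (\<theta> i x) (\<theta> i y))"
    using lip_const_bound[OF \<pi>, of "\<theta> i y" "\<theta> i x"] by (intro ennreal_leI) (simp add: dist_commute)
  also have "\<dots> = ennreal (lip_const \<pi>) * ennreal (dist (\<theta> i x) (\<theta> i y))"
    by (intro ennreal_mult lip_const_nonneg[OF \<pi>]) auto
  also have "\<dots> \<le> ennreal (lip_const \<pi>) * (\<integral>\<^sup>+t. seq_speed (\<theta> i) t * indicator {x..<y} t \<partial>lborel)"
    by (intro mult_left_mono dist_le_integral_seq_speed[OF lip] \<open>x \<le> y\<close>) auto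
  finally show "ennreal \<bar>\<pi> (\<theta> i y) - \<pi> (\<theta> i x)\<bar> \<le> ennreal (lip_const \<pi>) * (\<integral>\<^sup>+t. seq_speed (\<theta> i) t * indicator {x..<y} t \<partial>lborel)" .
qed

lemma piece_le:
  assumes f: "f \<in> Lip" "\<And>x. \<bar>f x\<bar> \<le> C" and \<pi>: "\<pi> \<in> Lip"
  shows "\<bar>piece i f \<pi>\<bar> \<le> lip_const \<pi> * (C * l i)"
proof -
  have C: "0 \<le> C" using f(2) abs_ge_zero order_trans by blast
  have "ennreal \<bar>piece i f \<pi>\<bar> \<le> ennreal (lip_const \<pi>) * (\<integral>\<^sup>+t. ennreal \<bar>f (\<theta> i t)\<bar> * speed i t \<partial>lborel)"
    by (rule piece_bound[OF f(1) \<pi>])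
  also have "\<dots> \<le> ennreal (lip_const \<pi>) * (\<integral>\<^sup>+t. ennreal C * speed i t \<partial>lborel)"
    using f(2) by (intro mult_left_mono nn_integral_mono mult_right_mono ennreal_leI) auto
  also have "\<dots> = ennreal (lip_const \<pi>) * (ennreal C * (\<integral>\<^sup>+t. speed i t \<partial>lborel))"
    by (subst nn_integral_cmult) auto
  also have "\<dots> \<le> ennreal (lip_const \<pi>) * (ennreal C * ennreal (l i))"
    using len[of i] by (intro mult_left_mono) (auto simp: speed_def)
  also have "\<dots> = ennreal (lip_const \<pi> * (C * l i))"
    using lip_const_nonneg[OF \<pi>] C l0[of i] by (simp add: ennreal_mult)
  finally show ?thesis
    using lip_const_nonneg[OF \<pi>] C l0[of i] by (subst (asm) ennreal_le_iff) auto
qed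

lemma summable_pieces:
  assumes f: "f \<in> Lip_b" and \<pi>: "\<pi> \<in> Lip"
  shows "summable (\<lambda>i. \<bar>a i * piece i f \<pi>\<bar>)" "summable (\<lambda>i. a i * piece i f \<pi>)"
proof -
  obtain C where C: "0 \<le> C" "\<And>x. \<bar>f x\<bar> \<le> C" using Lip_b_bound[OF f] by blast
  show "summable (\<lambda>i. \<bar>a i * piece i f \<pi>\<bar>)"
  proof (rule summable_comparison_test')
    show "summable (\<lambda>i. (\<bar>a i\<bar> * l i) * (lip_const \<pi> * C))" using sum by (rule summable_mult2)
    show "norm \<bar>a i * piece i f \<pi>\<bar> \<le> (\<bar>a i\<bar> * l i) * (lip_const \<pi> * C)" for i
      using mult_left_mono[OF piece_le[OF Lip_b_Lip[OF f] C(2) \<pi>, of i], of "\<bar>a i\<bar>"]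
      by (simp add: abs_mult mult_ac)
  qed
  then show "summable (\<lambda>i. a i * piece i f \<pi>)" by (rule summable_rabs_cancel)
qed

lemma mass_bound_current: "mass_bound current bound"
  unfolding mass_bound_def
proof (intro conjI ballI sets_bound finite_bound)
  fix f \<pi> :: "'a \<Rightarrow> real" assume f: "f \<in> Lip_b" and \<pi>: "\<pi> \<in> Lip"
  have [measurable]: "f \<in> borel_measurable borel" using f by (intro Lip_borel Lip_b_Lip)
  obtain C where C: "0 \<le> C" "\<And>x. \<bar>f x\<bar> \<le> C" using Lip_b_bound[OF f] by blast
  have int: "integrable bound (\<lambda>x. \<bar>f x\<bar>)"
    by (rule integrable_bounded_borel[OF finite_bound sets_bound, where C = C]) (use C in auto)
  have "ennreal \<bar>current f \<pi>\<bar> \<le> ennreal (\<Sum>i. \<bar>a i * piece i f \<pi>\<bar>)"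
    unfolding current_def by (intro ennreal_leI summable_rabs summable_pieces[OF f \<pi>])
  also have "\<dots> = (\<Sum>i. ennreal \<bar>a i * piece i f \<pi>\<bar>)"
    using summable_pieces(1)[OF f \<pi>] by (intro suminf_ennreal2[symmetric]) auto
  also have "\<dots> \<le> (\<Sum>i. ennreal (lip_const \<pi>) * (ennreal \<bar>a i\<bar> * (\<integral>\<^sup>+t. ennreal \<bar>f (\<theta> i t)\<bar> * speed i t \<partial>lborel)))"
  proof (intro suminf_le allI)
    fix i
    have "ennreal \<bar>a i * piece i f \<pi>\<bar> = ennreal \<bar>a i\<bar> * ennreal \<bar>piece i f \<pi>\<bar>"
      by (simp add: abs_mult ennreal_mult)
    also have "\<dots> \<le> ennreal \<bar>a i\<bar> * (ennreal (lip_const \<pi>) * (\<integral>\<^sup>+t. ennreal \<bar>f (\<theta> i t)\<bar> * speed i t \<partial>lborel))"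
      by (intro mult_left_mono piece_bound Lip_b_Lip[OF f] \<pi>) auto
    finally show "ennreal \<bar>a i * piece i f \<pi>\<bar> \<le> ennreal (lip_const \<pi>) * (ennreal \<bar>a i\<bar> * (\<integral>\<^sup>+t. ennreal \<bar>f (\<theta> i t)\<bar> * speed i t \<partial>lborel))"
      by (simp add: mult_ac)
  qed auto
  also have "\<dots> = ennreal (lip_const \<pi>) * (\<integral>\<^sup>+x. ennreal \<bar>f x\<bar> \<partial>bound)"
    by (subst nn_integral_bound) auto
  also have "\<dots> = ennreal (lip_const \<pi> * (\<integral>x. \<bar>f x\<bar> \<partial>bound))"
    using int lip_const_nonneg[OF \<pi>] by (subst nn_integral_eq_integral) (auto simp: ennreal_mult)
  finally show "\<bar>current f \<pi>\<bar> \<le> lip_const \<pi> * (\<integral>x. \<bar>f x\<bar> \<partial>bound)"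
    using lip_const_nonneg[OF \<pi>] by (subst (asm) ennreal_le_iff) auto
qed

section \<open>The remaining axioms of a current\<close>

lemma bilinear_current: "bilinear_on_Lip current"
  unfolding bilinear_on_Lip_def
proof (intro conjI ballI allI)
  fix f g \<pi> :: "'a \<Rightarrow> real" and b c :: real
  assume f: "f \<in> Lip_b" and g: "g \<in> Lip_b" and \<pi>: "\<pi> \<in> Lip"
  have "a i * piece i (\<lambda>x. b * f x + c * g x) \<pi> = b * (a i * piece i f \<pi>) + c * (a i * piece i g \<pi>)" for i
    unfolding piece_def
    using rs_integral_lin_left[OF lip_curve[OF lip[of i] lip_const_lipschitz[OF Lip_b_Lip[OF f]]]
        lip_curve[OF lip[of i] lip_const_lipschitz[OF Lip_b_Lip[OF g]]] lip_curve[OF lip[of i] lip_const_lipschitz[OF \<pi>]], where a = b and b = c]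
    by (simp add: algebra_simps)
  then have "current (\<lambda>x. b * f x + c * g x) \<pi> = (\<Sum>i. b * (a i * piece i f \<pi>) + c * (a i * piece i g \<pi>))"
    by (simp add: current_def)
  also have "\<dots> = b * current f \<pi> + c * current g \<pi>"
    unfolding current_def using summable_pieces(2)[OF f \<pi>] summable_pieces(2)[OF g \<pi>]
    by (simp add: suminf_add[symmetric] suminf_mult summable_mult)
  finally show "current (\<lambda>x. b * f x + c * g x) \<pi> = b * current f \<pi> + c * current g \<pi>" .
next
  fix f \<pi> \<rho> :: "'a \<Rightarrow> real" and b c :: real
  assume f: "f \<in> Lip_b" and \<pi>: "\<pi> \<in> Lip" and \<rho>: "\<rho> \<in> Lip"
  have "a i * piece i f (\<lambda>x. b * \<pi> x + c * \<rho> x) = b * (a i * piece i f \<pi>) + c * (a i * piece i f \<rho>)" for i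
    unfolding piece_def
    using rs_integral_lin_right[OF lip_curve[OF lip[of i] lip_const_lipschitz[OF Lip_b_Lip[OF f]]]
        lip_curve[OF lip[of i] lip_const_lipschitz[OF \<pi>]] lip_curve[OF lip[of i] lip_const_lipschitz[OF \<rho>]], where a = b and b = c]
    by (simp add: algebra_simps)
  then have "current f (\<lambda>x. b * \<pi> x + c * \<rho> x) = (\<Sum>i. b * (a i * piece i f \<pi>) + c * (a i * piece i f \<rho>))"
    by (simp add: current_def)
  also have "\<dots> = b * current f \<pi> + c * current f \<rho>"
    unfolding current_def using summable_pieces(2)[OF f \<pi>] summable_pieces(2)[OF f \<rho>]
    by (simp add: suminf_add[symmetric] suminf_mult summable_mult)
  finally show "current f (\<lambda>x. b * \<pi> x + c * \<rho> x) = b * current f \<pi> + c * current f \<rho>" .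
qed

text \<open>Every piece converges by \<open>rs_integral_tendsto\<close>. Tannery's theorem exchanges
  limit and sum, with a multiple of the summable costs as majorant.\<close>

lemma current_continuous_current: "current_continuous current"
  unfolding current_continuous_def
proof (intro ballI allI impI)
  fix f \<pi> :: "'a \<Rightarrow> real" and \<pi>s :: "nat \<Rightarrow> 'a \<Rightarrow> real"
  assume f: "f \<in> Lip_b" and \<pi>: "\<pi> \<in> Lip" and \<pi>s: "\<forall>j. \<pi>s j \<in> Lip"
    and bd: "bdd_above (range (\<lambda>j. lip_const (\<pi>s j)))" and lim: "\<forall>x. (\<lambda>j. \<pi>s j x) \<longlonglongrightarrow> \<pi> x"
  obtain C where C: "0 \<le> C" "\<And>x. \<bar>f x\<bar> \<le> C" using Lip_b_bound[OF f] by blast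
  obtain K' where K': "\<And>j. lip_const (\<pi>s j) \<le> K'" using bd by (auto simp: bdd_above_def)
  define K where "K = max K' (lip_const \<pi>)"
  have K: "K-lipschitz_on UNIV (\<pi>s j)" "K-lipschitz_on UNIV \<pi>" for j
    using K'[of j] \<pi>s \<pi> by (auto simp: K_def intro!: lipschitz_on_mono[OF lip_const_lipschitz])
  have "(\<lambda>j. \<Sum>i. a i * piece i f (\<pi>s j)) \<longlonglongrightarrow> (\<Sum>i. a i * piece i f \<pi>)"
  proof (rule tannerys_theorem[THEN conjunct2, THEN conjunct2])
    show "(\<lambda>j. a i * piece i f (\<pi>s j)) \<longlonglongrightarrow> a i * piece i f \<pi>" for i
      unfolding piece_def using lim
      by (intro tendsto_mult_left rs_integral_tendsto[OF lip_curve[OF lip lip_const_lipschitz[OF Lip_b_Lip[OF f]]]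
          lip_curve[OF lip K(2)] lip_curve[OF lip K(1)]]) auto
    have "norm (a i * piece i f (\<pi>s j)) \<le> \<bar>a i\<bar> * l i * (K * C)" for i j
    proof -
      have "\<bar>piece i f (\<pi>s j)\<bar> \<le> lip_const (\<pi>s j) * (C * l i)"
        using \<pi>s by (intro piece_le[OF Lip_b_Lip[OF f] C(2)]) auto
      also have "\<dots> \<le> K * (C * l i)" using lip_const_le[OF K(1)] C(1) l0[of i] by (intro mult_right_mono) auto
      finally have "\<bar>a i\<bar> * \<bar>piece i f (\<pi>s j)\<bar> \<le> \<bar>a i\<bar> * (K * (C * l i))" by (intro mult_left_mono) auto
      then show ?thesis by (simp add: abs_mult mult_ac)
    qed
    then show "\<forall>\<^sub>F (i, j) in sequentially \<times>\<^sub>F sequentially. norm (a i * piece i f (\<pi>s j)) \<le> \<bar>a i\<bar> * l i * (K * C)"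
      by (intro always_eventually) auto
    show "summable (\<lambda>i. \<bar>a i\<bar> * l i * (K * C))" using sum by (rule summable_mult2)
  qed simp
  then show "(\<lambda>j. current f (\<pi>s j)) \<longlonglongrightarrow> current f \<pi>" by (simp add: current_def)
qed

lemma current_local_current: "current_local current"
  unfolding current_local_def
proof (intro ballI impI)
  fix f \<pi> :: "'a \<Rightarrow> real" assume f: "f \<in> Lip_b" and \<pi>: "\<pi> \<in> Lip"
    and "\<exists>U k. open U \<and> spt f \<subseteq> U \<and> (\<forall>x\<in>U. \<pi> x = k)"
  then obtain U k where "open U" "spt f \<subseteq> U" "\<forall>x\<in>U. \<pi> x = k" by blast
  then have "piece i f \<pi> = 0" for i
    unfolding piece_def by (rule rs_integral_local[OF lip Lip_b_Lip[OF f] \<pi>])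
  then show "current f \<pi> = 0" by (simp add: current_def)
qed

lemma current_in_currents1: "current \<in> currents1"
  unfolding currents1_def
  using bilinear_current mass_bound_current current_continuous_current current_local_current by blast

lemma current_chain:
  assumes f: "f \<in> Lip_b" and \<pi>: "\<pi> \<in> Lip"
    and \<psi>: "D-lipschitz_on UNIV \<psi>" "\<And>y. \<bar>\<psi> y\<bar> \<le> 1" and G: "1-lipschitz_on UNIV G"
    and taylor: "\<And>x y. \<bar>G y - G x - \<psi> x * (y - x)\<bar> \<le> D * (y - x)\<^sup>2"
  shows "current (\<lambda>x. f x * \<psi> (\<pi> x)) \<pi> = current f (\<lambda>x. G (\<pi> x))"
proof -
  obtain C where C: "0 \<le> C" "\<And>x. \<bar>f x\<bar> \<le> C" using Lip_b_bound[OF f] by blast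
  have "piece i (\<lambda>x. f x * \<psi> (\<pi> x)) \<pi> = piece i f (\<lambda>x. G (\<pi> x))" for i
    unfolding piece_def
    by (rule rs_integral_chain[OF lip_curve[OF lip lip_const_lipschitz[OF Lip_b_Lip[OF f]]] C(2)
          lip_curve[OF lip lip_const_lipschitz[OF \<pi>]] \<psi> G taylor])
  then show ?thesis by (simp add: current_def)
qed

section \<open>Boundary, mass and concentration of the sum of curves\<close>

lemma boundary_current: "boundary current f = (\<Sum>i. a i * (f (\<theta> i 1) - f (\<theta> i 0)))"
  by (simp add: boundary_def current_def piece_def rs_integral_one)

lemma mass_measure_le:
  assumes "mass_bound current \<nu>" "B \<in> sets borel"
  shows "emeasure (mass_measure current) B \<le> emeasure \<nu> B"
  using mass_measure_least[OF bilinear_current mass_bound_current] assms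
  by (auto simp: least_mass_bound_def)

lemma sets_mass_measure: "sets (mass_measure current) = sets borel"
  using mass_measure_least[OF bilinear_current mass_bound_current]
  by (auto simp: least_mass_bound_def mass_bound_def)

lemma mass_current: "mass current \<le> (\<Sum>i. \<bar>a i\<bar> * l i)"
proof -
  have "emeasure (mass_measure current) UNIV \<le> ennreal (\<Sum>i. \<bar>a i\<bar> * l i)"
    using mass_measure_le[OF mass_bound_current, of UNIV] emeasure_bound by (auto intro: order_trans)
  then show ?thesis
    unfolding mass_def measure_def using sum l0
    by (intro enn2real_leI) (auto intro!: suminf_nonneg)
qed

text \<open>The traces form a countable union of compact sets, hence a Borel set, and
  \<open>bound\<close> does not charge the complement because the speed is cut off outside
  \<open>{0..<1}\<close>.\<close>

lemma current_concentrated: "AE x in mass_measure current. x \<in> (\<Union>i. \<theta> i ` {0..1})"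
proof -
  define E where "E = (\<Union>i. \<theta> i ` {0..1})"
  have E: "E \<in> sets borel"
    unfolding E_def by (intro sets.countable_UN) (auto intro!: borel_closed compact_imp_closed compact_continuous_image continuous_on_subset[OF cont])
  then have nE: "- E \<in> sets borel" using borel_comp by blast
  have "emeasure (mass_measure current) (- E) \<le> emeasure bound (- E)"
    by (rule mass_measure_le[OF mass_bound_current nE])
  also have "\<dots> = (\<integral>\<^sup>+x. indicator (- E) x \<partial>bound)" using nE sets_bound by simp
  also have "\<dots> = (\<Sum>i. ennreal \<bar>a i\<bar> * (\<integral>\<^sup>+t. indicator (- E) (\<theta> i t) * speed i t \<partial>lborel))"
    by (rule nn_integral_bound) (use nE in measurable)
  finally have "emeasure (mass_measure current) (- E)
      \<le> (\<Sum>i. ennreal \<bar>a i\<bar> * (\<integral>\<^sup>+t. indicator (- E) (\<theta> i t) * speed i t \<partial>lborel))" .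
  moreover have "indicator (- E) (\<theta> i t) * speed i t = 0" for i t
  proof (cases "t \<in> {0..<1}")
    case True
    then have "\<theta> i t \<in> E" unfolding E_def by (intro UN_I[of i] imageI) auto
    then show ?thesis by simp
  qed (simp add: speed_def)
  ultimately have "emeasure (mass_measure current) (- E) = 0" by simp
  then have "- E \<in> null_sets (mass_measure current)" using nE sets_mass_measure by (auto simp: null_sets_def)
  then show ?thesis by (rule AE_I') (auto simp: E_def)
qed

end

section \<open>Absolute continuity with respect to Hausdorff measure\<close>

text \<open>A Lipschitz map sends each covering set into an interval of comparable length. Widening
  by a summable amount makes the intervals open and keeps them nondegenerate for sets of diameter
  0.\<close>

lemma hausdorff1_null_image_cover:
  fixes \<pi> :: "'a::metric_space \<Rightarrow> real"
  assumes \<pi>: "\<Lambda>-lipschitz_on UNIV \<pi>" and B: "hausdorff1 B = 0" and e: "0 < e"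
  shows "\<exists>W. open W \<and> \<pi> ` B \<subseteq> W \<and> emeasure lborel W \<le> ennreal e"
proof -
  have \<Lambda>: "0 \<le> \<Lambda>" using \<pi> by (rule lipschitz_on_nonneg)
  \<comment> \<open>Half of \<open>e\<close> is spent on diameters, since
    \<open>2 * \<Lambda> * e' \<le> e/2\<close>, and half on the widening, whose contributions
    \<open>(e/4) * (1/2)^i\<close> sum to \<open>e/2\<close>. The added 1 covers the case where
    \<open>\<Lambda>\<close> is 0.\<close>
  define e' where "e' = e / (4 * (\<Lambda> + 1))"
  have e': "0 < e'" using e \<Lambda> by (simp add: e'_def)
  \<comment> \<open>One scale, here 1, is enough: the supremum over all scales is 0, hence so is the
    infimum at each of them.\<close>
  have "(INF C\<in>{C :: nat \<Rightarrow> 'a set. B \<subseteq> (\<Union>i. C i) \<and> (\<forall>i. bounded (C i) \<and> diameter (C i) \<le> 1)}.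
          (\<Sum>i. ennreal (diameter (C i)))) \<le> hausdorff1 B"
    unfolding hausdorff1_def by (rule SUP_upper2[of 1]) auto
  also have "\<dots> < ennreal e'" using B e' by simp
  finally obtain C :: "nat \<Rightarrow> 'a set" where C: "B \<subseteq> (\<Union>i. C i)" "\<And>i. bounded (C i)"
    and S: "(\<Sum>i. ennreal (diameter (C i))) < ennreal e'"
    unfolding INF_less_iff by auto
  have d: "0 \<le> diameter (C i)" for i using C(2) by (rule diameter_ge_0)
  define c where "c i = (SOME x. x \<in> C i)" for i
  define r where "r i = \<Lambda> * diameter (C i) + (e/8) * (1/2)^i" for i
  have r: "0 < r i" for i using \<Lambda> d[of i] e by (auto simp: r_def intro!: add_nonneg_pos)
  define W where "W = (\<Union>i. {\<pi> (c i) - r i<..<\<pi> (c i) + r i})"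
  have "\<pi> x \<in> W" if x: "x \<in> B" for x
  proof -
    obtain i where i: "x \<in> C i" using C(1) x by blast
    then have "c i \<in> C i" unfolding c_def by (rule someI)
    have "\<bar>\<pi> x - \<pi> (c i)\<bar> \<le> \<Lambda> * dist x (c i)" using lipschitz_onD[OF \<pi>, of x "c i"] by (simp add: dist_real_def)
    also have "\<dots> \<le> \<Lambda> * diameter (C i)"
      using diameter_bounded_bound[OF C(2) i \<open>c i \<in> C i\<close>] \<Lambda> by (intro mult_left_mono)
    also have "\<dots> < r i" using e by (simp add: r_def)
    finally have "\<pi> x \<in> {\<pi> (c i) - r i<..<\<pi> (c i) + r i}" by auto
    then show ?thesis unfolding W_def by blast
  qed
  moreover have "emeasure lborel W \<le> ennreal e"
  proof -
    have "emeasure lborel W \<le> (\<Sum>i. emeasure lborel {\<pi> (c i) - r i<..<\<pi> (c i) + r i})"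
      unfolding W_def by (rule emeasure_subadditive_countably) auto
    also have "\<dots> = (\<Sum>i. ennreal (2 * \<Lambda>) * ennreal (diameter (C i)) + ennreal ((e/4) * (1/2)^i))"
    proof (rule suminf_cong)
      fix i
      have "emeasure lborel {\<pi> (c i) - r i<..<\<pi> (c i) + r i} = ennreal (2 * r i)"
        using r[of i] by simp
      also have "2 * r i = 2 * \<Lambda> * diameter (C i) + (e/4) * (1/2)^i" by (simp add: r_def)
      also have "ennreal \<dots> = ennreal (2 * \<Lambda>) * ennreal (diameter (C i)) + ennreal ((e/4) * (1/2)^i)"
        using \<Lambda> d[of i] e by (subst ennreal_plus) (auto simp: ennreal_mult)
      finally show "emeasure lborel {\<pi> (c i) - r i<..<\<pi> (c i) + r i} =
         ennreal (2 * \<Lambda>) * ennreal (diameter (C i)) + ennreal ((e/4) * (1/2)^i)" .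
    qed
    also have "\<dots> = ennreal (2 * \<Lambda>) * (\<Sum>i. ennreal (diameter (C i))) + (\<Sum>i. ennreal ((e/4) * (1/2)^i))"
      by (subst suminf_add[symmetric]) auto
    also have "(\<Sum>i. ennreal ((e/4) * (1/2)^i)) = ennreal (\<Sum>i. (e/4) * (1/2)^i)"
      using e by (intro suminf_ennreal2 summable_mult summable_geometric) auto
    also have "(\<Sum>i. (e/4) * (1/2::real)^i) = e / 2"
      by (subst suminf_mult) (auto simp: suminf_geometric intro: summable_geometric)
    also have "ennreal (2 * \<Lambda>) * (\<Sum>i. ennreal (diameter (C i))) + ennreal (e/2) \<le> ennreal (2 * \<Lambda>) * ennreal e' + ennreal (e/2)"
      using S by (intro add_right_mono mult_left_mono) auto
    also have "\<dots> = ennreal (2 * \<Lambda> * e' + e/2)"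
      using \<Lambda> e e' by (simp add: ennreal_mult ennreal_plus)
    also have "\<dots> \<le> ennreal e"
    proof (rule ennreal_leI)
      have "2 * \<Lambda> * e' \<le> 2 * (\<Lambda> + 1) * e'" using e' by (intro mult_right_mono) auto
      also have "\<dots> = e / 2" using \<Lambda> by (simp add: e'_def field_simps)
      finally show "2 * \<Lambda> * e' + e/2 \<le> e" by simp
    qed
    finally show ?thesis .
  qed
  ultimately show ?thesis by (intro exI[of _ W]) (auto simp: W_def)
qed

text \<open>The primitive vanishing at minus infinity has slope \<open>\<psi>\<close>, hence
  increments of at most \<open>y - x\<close> and values between 0 and the integral of
  \<open>\<psi>\<close>. Freezing \<open>\<psi>\<close> at an endpoint of an interval changes it
  there by at most \<open>D\<close> times the length, which gives the quadratic remainder.\<close>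

lemma lipschitz_primitive:
  fixes \<psi> :: "real \<Rightarrow> real"
  assumes \<psi>: "D-lipschitz_on UNIV \<psi>" "\<And>y. 0 \<le> \<psi> y" "\<And>y. \<psi> y \<le> 1" and int: "integrable lborel \<psi>"
  shows "\<exists>G. 1-lipschitz_on UNIV G \<and> (\<forall>x y. \<bar>G y - G x - \<psi> x * (y - x)\<bar> \<le> D * (y - x)\<^sup>2) \<and>
    (\<forall>y. \<bar>G y\<bar> \<le> (\<integral>t. \<psi> t \<partial>lborel))"
proof -
  have D: "0 \<le> D" using \<psi>(1) by (rule lipschitz_on_nonneg)
  have ii: "integrable lborel (\<lambda>t. indicator A t * \<psi> t)" if "A \<in> sets borel" for A
    using integrable_mult_indicator[OF _ int, of A] that by simp
  have ic: "integrable lborel (\<lambda>t. indicator {x<..y} t * k)" for x y k :: real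
  proof -
    have "emeasure lborel {x<..y} < \<infinity>" by (cases "x \<le> y") auto
    then show ?thesis by (intro integrable_mult_left integrable_real_indicator) auto
  qed
  define G where "G y = (\<integral>t. indicator {..y} t * \<psi> t \<partial>lborel)" for y
  have diff: "G y - G x = (\<integral>t. indicator {x<..y} t * \<psi> t \<partial>lborel)" if "x \<le> y" for x y
  proof -
    have "G y - G x = (\<integral>t. indicator {..y} t * \<psi> t - indicator {..x} t * \<psi> t \<partial>lborel)"
      unfolding G_def by (intro Bochner_Integration.integral_diff[symmetric] ii) auto
    also have "\<dots> = (\<integral>t. indicator {x<..y} t * \<psi> t \<partial>lborel)"
      using that by (intro Bochner_Integration.integral_cong) (auto simp: indicator_def)
    finally show ?thesis .
  qed
  \<comment> \<open>The base point \<open>z\<close> may be either end of the interval, so this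
    covers both orders of \<open>x\<close> and \<open>y\<close> in the remainder estimate.\<close>
  have step: "\<bar>G y - G x - \<psi> z * (y - x)\<bar> \<le> D * (y - x)\<^sup>2" if "x \<le> y" "z \<in> {x..y}" for x y z
  proof -
    have "\<psi> z * (y - x) = (\<integral>t. indicator {x<..y} t * \<psi> z \<partial>lborel)"
      using that by simp
    then have "G y - G x - \<psi> z * (y - x) = (\<integral>t. indicator {x<..y} t * \<psi> t - indicator {x<..y} t * \<psi> z \<partial>lborel)"
      unfolding diff[OF that(1)] using ii ic by (subst Bochner_Integration.integral_diff) auto
    then have "\<bar>G y - G x - \<psi> z * (y - x)\<bar> \<le> (\<integral>t. \<bar>indicator {x<..y} t * \<psi> t - indicator {x<..y} t * \<psi> z\<bar> \<partial>lborel)"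
      by simp
    also have "\<dots> \<le> (\<integral>t. indicator {x<..y} t * (D * (y - x)) \<partial>lborel)"
    proof (rule integral_mono)
      show "integrable lborel (\<lambda>t. \<bar>indicator {x<..y} t * \<psi> t - indicator {x<..y} t * \<psi> z\<bar>)"
        using ii ic by (intro integrable_abs Bochner_Integration.integrable_diff) auto
      show "\<bar>indicator {x<..y} t * \<psi> t - indicator {x<..y} t * \<psi> z\<bar> \<le> indicator {x<..y} t * (D * (y - x))" for t
      proof (cases "t \<in> {x<..y}")
        case True
        have "\<bar>\<psi> t - \<psi> z\<bar> \<le> D * \<bar>t - z\<bar>" by (rule lipschitz_on_absD[OF \<psi>(1)])
        also have "\<dots> \<le> D * (y - x)" using True that D by (intro mult_left_mono) auto
        finally show ?thesis using True by simp
      qed simp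
    qed (rule ic)
    also have "\<dots> = D * (y - x)\<^sup>2" using that by (simp add: power2_eq_square)
    finally show ?thesis .
  qed
  have mono: "0 \<le> G y - G x \<and> G y - G x \<le> y - x" if "x \<le> y" for x y
  proof
    show "0 \<le> G y - G x" unfolding diff[OF that] using \<psi>(2) by (intro integral_nonneg_AE) auto
    have "G y - G x \<le> (\<integral>t. indicator {x<..y} t * 1 \<partial>lborel)"
      unfolding diff[OF that] using \<psi>(3) by (intro integral_mono ii ic mult_left_mono) auto
    then show "G y - G x \<le> y - x" using that by simp
  qed
  have "1-lipschitz_on UNIV G"
  proof (rule lipschitz_on_realI)
    fix x y show "\<bar>G x - G y\<bar> \<le> 1 * dist x y"
      using mono[of x y] mono[of y x] by (cases "x \<le> y") (auto simp: dist_real_def)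
  qed simp
  moreover have "\<bar>G y - G x - \<psi> x * (y - x)\<bar> \<le> D * (y - x)\<^sup>2" for x y
  proof (cases "x \<le> y")
    case False
    then have "\<bar>G x - G y - \<psi> x * (x - y)\<bar> \<le> D * (x - y)\<^sup>2" by (intro step) auto
    then show ?thesis by (simp add: algebra_simps abs_minus_commute power2_commute[of x y])
  qed (auto intro: step)
  moreover have "\<bar>G y\<bar> \<le> (\<integral>t. \<psi> t \<partial>lborel)" for y
  proof -
    have "0 \<le> G y" unfolding G_def using \<psi>(2) by (intro integral_nonneg_AE) auto
    moreover have "G y \<le> (\<integral>t. \<psi> t \<partial>lborel)"
      unfolding G_def using \<psi>(2) by (intro integral_mono ii int) (auto simp: indicator_def)
    ultimately show ?thesis by simp
  qed
  ultimately show ?thesis by blast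
qed

text \<open>Cover the image of \<open>B\<close> by an open \<open>W\<close> of length at most
  \<open>e\<close> and let \<open>\<psi>\<close> increase to its indicator. The primitive is then at
  most \<open>e\<close>, while \<open>1 - \<psi> \<circ> \<pi>\<close> tends to the indicator of a
  set disjoint from \<open>B\<close>.\<close>

lemma null_cutoff:
  fixes f \<pi> :: "'a::metric_space \<Rightarrow> real"
  assumes \<mu>: "finite_measure \<mu>" "sets \<mu> = sets borel" and f: "f \<in> Lip_b" and \<pi>: "\<pi> \<in> Lip"
    and B: "B \<in> sets borel" "hausdorff1 B = 0" and e: "0 < e"
  shows "\<exists>\<psi> D G. D-lipschitz_on UNIV \<psi> \<and> (\<forall>y. 0 \<le> \<psi> y \<and> \<psi> y \<le> 1) \<and> 1-lipschitz_on UNIV G \<and>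
    (\<forall>x y. \<bar>G y - G x - \<psi> x * (y - x)\<bar> \<le> D * (y - x)\<^sup>2) \<and> (\<forall>y. \<bar>G y\<bar> \<le> e) \<and>
    (\<integral>x. \<bar>f x\<bar> * (1 - \<psi> (\<pi> x)) \<partial>\<mu>) \<le> (\<integral>x. \<bar>f x\<bar> * indicator (- B) x \<partial>\<mu>) + e"
proof -
  interpret finite_measure \<mu> by (rule \<mu>(1))
  note [measurable_cong] = \<mu>(2)
  have [measurable]: "f \<in> borel_measurable borel" "\<pi> \<in> borel_measurable borel"
    using Lip_borel[OF Lip_b_Lip[OF f]] Lip_borel[OF \<pi>] by auto
  obtain C where C: "0 \<le> C" "\<And>x. \<bar>f x\<bar> \<le> C" using Lip_b_bound[OF f] by blast
  obtain W where W: "open W" "\<pi> ` B \<subseteq> W" "emeasure lborel W \<le> ennreal e"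
    using hausdorff1_null_image_cover[OF lip_const_lipschitz[OF \<pi>] B(2) e] by blast
  have [measurable]: "W \<in> sets borel" using W(1) by (rule borel_open)
  have Wfin: "emeasure lborel W < \<infinity>" using W(3) by (auto intro: le_less_trans)
  \<comment> \<open>Distances to the complement of \<open>W\<close> are meaningful only if it is
    nonempty; finite length ensures this.\<close>
  have ne: "- W \<noteq> {}"
  proof
    assume "- W = {}" then have "W = UNIV" by auto
    then show False using Wfin by simp
  qed
  have cl: "closed (- W)" using W(1) by auto
  define \<psi> where "\<psi> m y = min 1 (real m * infdist y (- W))" for m y
  have L: "(real m)-lipschitz_on UNIV (\<psi> m)" for m
  proof (rule lipschitz_on_realI)
    fix x y :: real
    have "\<bar>\<psi> m x - \<psi> m y\<bar> \<le> \<bar>real m * infdist x (- W) - real m * infdist y (- W)\<bar>"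
      unfolding \<psi>_def by linarith
    also have "\<dots> = real m * \<bar>infdist x (- W) - infdist y (- W)\<bar>"
      by (simp add: abs_mult flip: right_diff_distrib)
    also have "\<dots> \<le> real m * dist x y"
      by (intro mult_left_mono infdist_triangle_abs) auto
    finally show "\<bar>\<psi> m x - \<psi> m y\<bar> \<le> real m * dist x y" .
  qed simp
  have r: "0 \<le> \<psi> m y" "\<psi> m y \<le> 1" for m y by (auto simp: \<psi>_def infdist_nonneg)
  have [measurable]: "\<psi> m \<in> borel_measurable borel" for m
    using lipschitz_on_continuous_on[OF L] by (rule borel_measurable_continuous_onI)
  have ind: "\<psi> m y \<le> indicator W y" for m y
    using r[of m y] by (auto simp: indicator_def \<psi>_def)
  have lim: "(\<lambda>m. \<psi> m y) \<longlonglongrightarrow> indicator W y" for y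
  proof (cases "y \<in> W")
    case True
    then have "infdist y (- W) > 0"
      using in_closed_iff_infdist_zero[OF cl ne, of y] infdist_nonneg[of y "- W"] by auto
    then obtain N :: nat where N: "1 < real N * infdist y (- W)" using reals_Archimedean3 by blast
    have "\<psi> m y = 1" if "N \<le> m" for m
    proof -
      have "real N * infdist y (- W) \<le> real m * infdist y (- W)"
        using that by (intro mult_right_mono) (auto simp: infdist_nonneg)
      then show ?thesis using N by (simp add: \<psi>_def)
    qed
    then show ?thesis using True by (intro tendsto_eventually) (auto simp: eventually_sequentially)
  next
    case False
    then show ?thesis using r ind[of _ y] by (intro tendsto_eventually always_eventually) (auto intro: antisym)
  qed
  have iW: "integrable lborel (indicator W :: real \<Rightarrow> real)"
    using Wfin by (intro integrable_real_indicator) auto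
  have i\<psi>: "integrable lborel (\<psi> m)" for m
    by (rule Bochner_Integration.integrable_bound[OF iW]) (use r ind in auto)
  have m\<psi>: "(\<integral>t. \<psi> m t \<partial>lborel) \<le> e" for m
  proof -
    have "(\<integral>t. \<psi> m t \<partial>lborel) \<le> (\<integral>t. indicator W t \<partial>lborel)" by (intro integral_mono i\<psi> iW ind)
    also have "\<dots> = measure lborel W" by simp
    also have "\<dots> \<le> e" unfolding measure_def using W(3) e by (intro enn2real_leI) auto
    finally show ?thesis .
  qed
  have "(\<lambda>m. \<integral>x. \<bar>f x\<bar> * (1 - \<psi> m (\<pi> x)) \<partial>\<mu>) \<longlonglongrightarrow> (\<integral>x. \<bar>f x\<bar> * (1 - indicator W (\<pi> x)) \<partial>\<mu>)"
  proof (rule integral_dominated_convergence[where w = "\<lambda>_. C"])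
    show "AE x in \<mu>. norm (\<bar>f x\<bar> * (1 - \<psi> m (\<pi> x))) \<le> C" for m
    proof (rule AE_I2)
      fix x
      have "\<bar>f x\<bar> * (1 - \<psi> m (\<pi> x)) \<le> C * 1" using C r by (intro mult_mono) auto
      then show "norm (\<bar>f x\<bar> * (1 - \<psi> m (\<pi> x))) \<le> C" using r[of m "\<pi> x"] by (simp add: abs_mult)
    qed
    show "AE x in \<mu>. (\<lambda>m. \<bar>f x\<bar> * (1 - \<psi> m (\<pi> x))) \<longlonglongrightarrow> \<bar>f x\<bar> * (1 - indicator W (\<pi> x))"
      by (intro AE_I2 tendsto_intros lim)
  qed auto
  moreover have "(\<integral>x. \<bar>f x\<bar> * (1 - indicator W (\<pi> x)) \<partial>\<mu>) \<le> (\<integral>x. \<bar>f x\<bar> * indicator (- B) x \<partial>\<mu>)"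
  proof (rule integral_mono)
    show "integrable \<mu> (\<lambda>x. \<bar>f x\<bar> * (1 - indicator W (\<pi> x)))"
      by (rule integrable_const_bound[of _ C]) (use C in \<open>auto simp: indicator_def\<close>)
    show "integrable \<mu> (\<lambda>x. \<bar>f x\<bar> * indicator (- B) x)"
      using B(1) borel_comp by (intro Lip_b_abs_integrable \<mu> f) blast
    show "\<bar>f x\<bar> * (1 - indicator W (\<pi> x)) \<le> \<bar>f x\<bar> * indicator (- B) x" for x
      using W(2) by (intro mult_left_mono) (auto simp: indicator_def)
  qed
  ultimately have "\<forall>\<^sub>F m in sequentially. (\<integral>x. \<bar>f x\<bar> * (1 - \<psi> m (\<pi> x)) \<partial>\<mu>) < (\<integral>x. \<bar>f x\<bar> * indicator (- B) x \<partial>\<mu>) + e"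
    using e by (elim order_tendstoD(2)) simp
  from eventually_happens'[OF sequentially_bot this]
  obtain m where m: "(\<integral>x. \<bar>f x\<bar> * (1 - \<psi> m (\<pi> x)) \<partial>\<mu>) < (\<integral>x. \<bar>f x\<bar> * indicator (- B) x \<partial>\<mu>) + e" ..
  obtain G where G: "1-lipschitz_on UNIV G" "\<forall>x y. \<bar>G y - G x - \<psi> m x * (y - x)\<bar> \<le> real m * (y - x)\<^sup>2"
    "\<forall>y. \<bar>G y\<bar> \<le> (\<integral>t. \<psi> m t \<partial>lborel)"
    using lipschitz_primitive[OF L r i\<psi>] by blast
  have Ge: "\<forall>y. \<bar>G y\<bar> \<le> e" using G(3) m\<psi>[of m] order_trans by blast
  show ?thesis
    by (intro exI[of _ "\<psi> m"] exI[of _ "real m"] exI[of _ G] conjI allI L r G(1) G(2)[rule_format] Ge[rule_format]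
        less_imp_le[OF m])
qed

context curve_family
begin

text \<open>By the chain rule \<open>current (f \<cdot> \<psi> \<circ> \<pi>) \<pi> = current f (G \<circ> \<pi>)\<close> with \<open>G' = \<psi>\<close>. For cutoffs \<open>\<psi>\<close> of
  shrinking neighbourhoods of \<open>\<pi> ` B\<close> the primitives \<open>G\<close> tend to \<open>0\<close>, so by continuity only the part of \<open>f\<close>
  outside \<open>B\<close> contributes.\<close>

lemma mass_bound_off_null:
  assumes B: "B \<in> sets borel" "hausdorff1 B = 0"
  shows "mass_bound current (density bound (indicator (- B)))"
proof -
  note [measurable_cong] = sets_bound
  have nB: "- B \<in> sets borel" using B(1) borel_comp by blast
  have "finite_measure (density bound (\<lambda>x. ennreal (indicator (- B) x)))"
  proof (rule finite_measureI)
    have "emeasure (density bound (\<lambda>x. ennreal (indicator (- B) x))) UNIV \<le> emeasure bound UNIV"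
      using nB by (subst emeasure_density) (auto simp: ennreal_indicator sets_eq_imp_space_eq[OF sets_bound] sets_bound intro: emeasure_mono)
    then show "emeasure (density bound (\<lambda>x. ennreal (indicator (- B) x))) (space (density bound (\<lambda>x. ennreal (indicator (- B) x)))) \<noteq> \<infinity>"
      using emeasure_bound by (auto simp: sets_eq_imp_space_eq[OF sets_bound] top_unique)
  qed
  then have fin: "finite_measure (density bound (indicator (- B)))" by (simp add: ennreal_indicator)
  show ?thesis
    unfolding mass_bound_def
  proof (intro conjI ballI fin)
    show "sets (density bound (indicator (- B))) = sets borel" using sets_bound by simp
    fix f \<pi> :: "'a \<Rightarrow> real" assume f: "f \<in> Lip_b" and \<pi>: "\<pi> \<in> Lip"
    have [measurable]: "f \<in> borel_measurable borel" using Lip_borel[OF Lip_b_Lip[OF f]] .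
    define I where "I = (\<integral>x. \<bar>f x\<bar> * indicator (- B) x \<partial>bound)"
    define P where "P j \<psi> D G \<longleftrightarrow> D-lipschitz_on UNIV \<psi> \<and> (\<forall>y. 0 \<le> \<psi> y \<and> \<psi> y \<le> 1) \<and> 1-lipschitz_on UNIV G \<and>
        (\<forall>x y. \<bar>G y - G x - \<psi> x * (y - x)\<bar> \<le> D * (y - x)\<^sup>2) \<and> (\<forall>y. \<bar>G y\<bar> \<le> 1 / real (Suc j)) \<and>
        (\<integral>x. \<bar>f x\<bar> * (1 - \<psi> (\<pi> x)) \<partial>bound) \<le> I + 1 / real (Suc j)"
      for j :: nat and \<psi> G :: "real \<Rightarrow> real" and D :: real
    have "\<exists>\<psi> D G. P j \<psi> D G" for j
      unfolding I_def P_def by (rule null_cutoff[OF finite_bound sets_bound f \<pi> B]) simp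
    then obtain \<psi> D G where "\<And>j. P j (\<psi> j) (D j) (G j)" by metis
    then have \<psi>: "\<And>j. (D j)-lipschitz_on UNIV (\<psi> j)" "\<And>j y. 0 \<le> \<psi> j y \<and> \<psi> j y \<le> 1"
      and G: "\<And>j. 1-lipschitz_on UNIV (G j)" "\<And>j x y. \<bar>G j y - G j x - \<psi> j x * (y - x)\<bar> \<le> D j * (y - x)\<^sup>2"
        "\<And>j y. \<bar>G j y\<bar> \<le> 1 / real (Suc j)"
      and int: "\<And>j. (\<integral>x. \<bar>f x\<bar> * (1 - \<psi> j (\<pi> x)) \<partial>bound) \<le> I + 1 / real (Suc j)"
      by (simp_all only: P_def)
    have GL: "(lip_const \<pi>)-lipschitz_on UNIV (\<lambda>x. G j (\<pi> x))" for j
      using lip_curve[OF lip_const_lipschitz[OF \<pi>] G(1)] by simp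
    have inv0: "(\<lambda>j. 1 / real (Suc j)) \<longlonglongrightarrow> 0"
      using LIMSEQ_inverse_real_of_nat by (simp add: inverse_eq_divide)
    have "(\<lambda>j. current f (\<lambda>x. G j (\<pi> x))) \<longlonglongrightarrow> current f (\<lambda>_. 0)"
    proof (rule current_continuous_current[unfolded current_continuous_def, rule_format, OF f Lip_const])
      show "(\<lambda>x. G j (\<pi> x)) \<in> Lip" for j using GL by (rule LipI)
      show "bdd_above (range (\<lambda>j. lip_const (\<lambda>x. G j (\<pi> x))))"
        using lip_const_le[OF GL] by (rule bdd_aboveI2)
      show "(\<lambda>j. G j (\<pi> x)) \<longlonglongrightarrow> 0" for x
        by (rule Lim_null_comparison[OF _ inv0]) (use G(3) in auto)
    qed
    moreover have "current f (\<lambda>_. 0) = 0"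
      using mass_boundD(3)[OF mass_bound_current f Lip_const, of 0] by simp
    ultimately have lim: "(\<lambda>j. \<bar>current f (\<lambda>x. G j (\<pi> x))\<bar> + lip_const \<pi> * (I + 1 / real (Suc j))) \<longlonglongrightarrow> 0 + lip_const \<pi> * (I + 0)"
      by (intro tendsto_add tendsto_mult_left tendsto_const inv0 tendsto_rabs_zero) simp
    have "\<bar>current f \<pi>\<bar> \<le> \<bar>current f (\<lambda>x. G j (\<pi> x))\<bar> + lip_const \<pi> * (I + 1 / real (Suc j))" for j
    proof -
      have \<psi>L: "(\<lambda>x. \<psi> j (\<pi> x)) \<in> Lip_b"
        by (rule Lip_bI[OF LipI[OF lip_curve[OF lip_const_lipschitz[OF \<pi>] \<psi>(1)]], of _ 1]) (use \<psi>(2) in auto)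
      have \<psi>L': "(\<lambda>x. 1 - \<psi> j (\<pi> x)) \<in> Lip_b"
        using Lip_b_lin[OF Lip_b_const \<psi>L, of 1 1 "-1"] by simp
      let ?f1 = "\<lambda>x. f x * \<psi> j (\<pi> x)" and ?f2 = "\<lambda>x. f x * (1 - \<psi> j (\<pi> x))"
      have f1: "?f1 \<in> Lip_b" and f2: "?f2 \<in> Lip_b" using Lip_b_mult[OF f \<psi>L] Lip_b_mult[OF f \<psi>L'] by auto
      have "(\<lambda>x. 1 * ?f1 x + 1 * ?f2 x) = f" by (auto simp: algebra_simps)
      then have "current f \<pi> = current ?f1 \<pi> + current ?f2 \<pi>"
        using bilinear_fst[OF bilinear_current f1 f2 \<pi>, of 1 1] by simp
      also have "current ?f1 \<pi> = current f (\<lambda>x. G j (\<pi> x))"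
        by (rule current_chain[OF f \<pi> \<psi>(1) _ G(1,2)]) (use \<psi>(2) in auto)
      finally have "\<bar>current f \<pi>\<bar> \<le> \<bar>current f (\<lambda>x. G j (\<pi> x))\<bar> + \<bar>current ?f2 \<pi>\<bar>" by simp
      moreover have "(\<integral>x. \<bar>?f2 x\<bar> \<partial>bound) = (\<integral>x. \<bar>f x\<bar> * (1 - \<psi> j (\<pi> x)) \<partial>bound)"
        using \<psi>(2) by (intro Bochner_Integration.integral_cong) (auto simp: abs_mult)
      then have "\<bar>current ?f2 \<pi>\<bar> \<le> lip_const \<pi> * (\<integral>x. \<bar>f x\<bar> * (1 - \<psi> j (\<pi> x)) \<partial>bound)"
        using mass_boundD(3)[OF mass_bound_current f2 \<pi>] by (simp only:)
      moreover have "lip_const \<pi> * (\<integral>x. \<bar>f x\<bar> * (1 - \<psi> j (\<pi> x)) \<partial>bound) \<le> lip_const \<pi> * (I + 1 / real (Suc j))"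
        by (intro mult_left_mono int lip_const_nonneg[OF \<pi>])
      ultimately show ?thesis by linarith
    qed
    then have "\<bar>current f \<pi>\<bar> \<le> 0 + lip_const \<pi> * (I + 0)"
      by (intro LIMSEQ_le_const[OF lim]) blast
    moreover have "(\<integral>x. \<bar>f x\<bar> \<partial>density bound (indicator (- B))) = I"
    proof -
      have "(\<integral>x. \<bar>f x\<bar> \<partial>density bound (\<lambda>x. ennreal (indicator (- B) x))) = (\<integral>x. indicator (- B) x * \<bar>f x\<bar> \<partial>bound)"
        using nB by (intro integral_real_density) auto
      then show ?thesis by (simp add: I_def ennreal_indicator mult.commute)
    qed
    ultimately show "\<bar>current f \<pi>\<bar> \<le> lip_const \<pi> * (\<integral>x. \<bar>f x\<bar> \<partial>density bound (indicator (- B)))" by simp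
  qed
qed

text \<open>For a Hausdorff null set \<open>B\<close>, removing \<open>B\<close> from
  \<open>bound\<close> leaves a mass bound that does not charge \<open>B\<close>; the mass measure
  lies below it.\<close>

lemma current_rectifiable: "current \<in> rectifiable1"
  unfolding rectifiable1_def
proof (intro CollectI conjI ballI impI current_in_currents1)
  show "\<exists>(S :: nat \<Rightarrow> real set) (\<phi> :: nat \<Rightarrow> real \<Rightarrow> 'a).
        (\<forall>i. bounded (S i) \<and> (\<exists>L. L-lipschitz_on (S i) (\<phi> i))) \<and>
        (AE x in mass_measure current. x \<in> (\<Union>i. \<phi> i ` S i))"
  proof (intro exI[of _ "\<lambda>_. {0..1}"] exI[of _ \<theta>] conjI allI current_concentrated)
    show "\<exists>L. L-lipschitz_on {0..1} (\<theta> i)" for i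
      using lipschitz_on_subset[OF lip[of i], of "{0..1}"] by auto
  qed simp
  fix B :: "'a set" assume B: "B \<in> sets borel" "hausdorff1 B = 0"
  have nB: "- B \<in> sets borel" using B(1) borel_comp by blast
  have "emeasure (mass_measure current) B \<le> emeasure (density bound (indicator (- B))) B"
    by (rule mass_measure_le[OF mass_bound_off_null[OF B] B(1)])
  also have "\<dots> = (\<integral>\<^sup>+x. indicator (- B) x * indicator B x \<partial>bound)"
    using B(1) nB sets_bound by (intro emeasure_density) auto
  also have "\<dots> = (\<integral>\<^sup>+x. 0 \<partial>bound)" by (intro nn_integral_cong) (auto simp: indicator_def)
  finally show "emeasure (mass_measure current) B = 0" by simp
qed

end

section \<open>Representing boundaries by curves\<close>

text \<open>A weighted curve is a triple of a weight, a curve and an upper bound for the length of the curve.\<close>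

type_synonym 'a wcurve = "real \<times> (real \<Rightarrow> 'a) \<times> real"

definition admissible :: "'a::metric_space wcurve \<Rightarrow> bool" where
  "admissible = (\<lambda>(b, \<theta>, l). (\<exists>L. L-lipschitz_on UNIV \<theta>) \<and> 0 \<le> l \<and>
     (\<integral>\<^sup>+t. seq_speed \<theta> t * indicator {0..<1} t \<partial>lborel) \<le> ennreal l)"

definition curve_boundary :: "'a wcurve list \<Rightarrow> ('a \<Rightarrow> real) \<Rightarrow> real" where
  "curve_boundary ps f = (\<Sum>(b, \<theta>, l)\<leftarrow>ps. b * (f (\<theta> 1) - f (\<theta> 0)))"

definition curve_cost :: "'a wcurve list \<Rightarrow> real" where
  "curve_cost ps = (\<Sum>(b, \<theta>, l)\<leftarrow>ps. \<bar>b\<bar> * l)"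

lemma curve_boundary_simps [simp]:
  "curve_boundary [] f = 0"
  "curve_boundary ((b, \<theta>, l) # ps) f = b * (f (\<theta> 1) - f (\<theta> 0)) + curve_boundary ps f"
  "curve_boundary (ps @ qs) f = curve_boundary ps f + curve_boundary qs f"
  by (simp_all add: curve_boundary_def)

lemma curve_cost_simps [simp]:
  "curve_cost [] = 0"
  "curve_cost ((b, \<theta>, l) # ps) = \<bar>b\<bar> * l + curve_cost ps"
  "curve_cost (ps @ qs) = curve_cost ps + curve_cost qs"
  by (simp_all add: curve_cost_def)

lemma admissible_constant: "admissible (b, \<lambda>_. x, 0)"
proof -
  have "seq_speed (\<lambda>_. x) t = 0" for t by (simp add: seq_speed_def Limsup_const)
  moreover have "\<exists>L. L-lipschitz_on UNIV (\<lambda>_ :: real. x)" using lipschitz_on_constant by blast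
  ultimately show ?thesis by (simp add: admissible_def)
qed

text \<open>The index set \<open>\<nat> \<times> \<nat>\<close> of the curves in a sequence of lists is enumerated by \<^const>\<open>prod_decode\<close>;
  indices beyond the end of a list get a constant curve.\<close>

lemma rectifiable_current_of_curves:
  fixes ps :: "nat \<Rightarrow> 'a::metric_space wcurve list" and S :: "('a \<Rightarrow> real) \<Rightarrow> real"
  assumes ad: "\<And>n p. p \<in> set (ps n) \<Longrightarrow> admissible p"
    and cost: "\<And>n. curve_cost (ps n) \<le> E n" and E: "summable E"
    and S: "\<And>f. f \<in> Lip \<Longrightarrow> (\<lambda>n. curve_boundary (ps n) f) sums S f"
  shows "\<exists>R\<in>rectifiable1. (\<forall>f\<in>Lip. boundary R f = S f) \<and> mass R \<le> (\<Sum>n. E n)"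
proof -
  define w :: "nat \<times> nat \<Rightarrow> 'a wcurve" where
    "w = (\<lambda>(n, i). if i < length (ps n) then ps n ! i else (0, \<lambda>_. undefined, 0))"
  have wad: "admissible (w z)" for z
  proof (cases z)
    case (Pair n i)
    then show ?thesis
      using ad[OF nth_mem, of i n] by (simp add: w_def admissible_constant)
  qed
  define a where "a z = fst (w z)" for z
  define \<theta> where "\<theta> z = fst (snd (w z))" for z
  define l where "l z = snd (snd (w z))" for z
  have w_eq: "w z = (a z, \<theta> z, l z)" for z by (simp add: a_def \<theta>_def l_def)
  have adz: "\<exists>L. L-lipschitz_on UNIV (\<theta> z)" "0 \<le> l z"
    "(\<integral>\<^sup>+t. seq_speed (\<theta> z) t * indicator {0..<1} t \<partial>lborel) \<le> ennreal (l z)" for z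
    using wad[of z] by (auto simp: admissible_def w_eq)
  obtain L where L: "\<And>z. (L z)-lipschitz_on UNIV (\<theta> z)" using adz(1) by metis
  have a0: "a (n, i) = 0" if "\<not> i < length (ps n)" for n i using that by (simp add: a_def w_def)
  have row: "(\<Sum>i<length (ps n). h (w (n, i))) = (\<Sum>p\<leftarrow>ps n. h p)" for n and h :: "'a wcurve \<Rightarrow> real"
  proof -
    have "(\<Sum>i<length (ps n). h (w (n, i))) = (\<Sum>i<length (ps n). h (ps n ! i))"
      by (intro sum.cong) (auto simp: w_def)
    then show ?thesis by (simp add: sum_list_sum_nth atLeast0LessThan)
  qed
  have En: "0 \<le> E n" for n
  proof -
    have "0 \<le> (\<Sum>i<length (ps n). \<bar>a (n, i)\<bar> * l (n, i))" using adz(2) by (intro sum_nonneg) auto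
    also have "\<dots> = curve_cost (ps n)"
      using row[of "\<lambda>(b, \<theta>, l). \<bar>b\<bar> * l" n] by (simp add: curve_cost_def w_eq)
    finally show ?thesis using cost[of n] by simp
  qed
  \<comment> \<open>Rearranging in \<open>ennreal\<close> needs nonnegativity only, and finiteness
    of the total then yields summability of the enumerated family of costs.\<close>
  have tot: "(\<Sum>k. ennreal (\<bar>a (prod_decode k)\<bar> * l (prod_decode k))) \<le> ennreal (\<Sum>n. E n)"
  proof -
    have "(\<Sum>k. ennreal (\<bar>a (prod_decode k)\<bar> * l (prod_decode k))) = (\<Sum>n. \<Sum>i. ennreal (\<bar>a (n, i)\<bar> * l (n, i)))"
      by (rule suminf_ennreal_2dimen) simp
    also have "\<dots> \<le> (\<Sum>n. ennreal (E n))"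
    proof (intro suminf_le allI)
      fix n
      have "(\<Sum>i. ennreal (\<bar>a (n, i)\<bar> * l (n, i))) = (\<Sum>i<length (ps n). ennreal (\<bar>a (n, i)\<bar> * l (n, i)))"
        using a0 by (intro suminf_finite) auto
      also have "\<dots> = ennreal (\<Sum>i<length (ps n). \<bar>a (n, i)\<bar> * l (n, i))"
        using adz(2) by (intro sum_ennreal) auto
      also have "(\<Sum>i<length (ps n). \<bar>a (n, i)\<bar> * l (n, i)) = curve_cost (ps n)"
        using row[of "\<lambda>(b, \<theta>, l). \<bar>b\<bar> * l" n] by (simp add: curve_cost_def w_eq)
      finally show "(\<Sum>i. ennreal (\<bar>a (n, i)\<bar> * l (n, i))) \<le> ennreal (E n)"
        using cost[of n] by (simp add: ennreal_leI)
    qed auto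
    also have "\<dots> = ennreal (\<Sum>n. E n)" using En E by (intro suminf_ennreal2) auto
    finally show ?thesis .
  qed
  have sm: "summable (\<lambda>k. \<bar>a (prod_decode k)\<bar> * l (prod_decode k))"
    using tot adz(2) by (intro summable_suminf_not_top) (auto simp: top_unique)
  interpret curve_family "\<lambda>k. a (prod_decode k)" "\<lambda>k. l (prod_decode k)" "\<lambda>k. L (prod_decode k)" "\<lambda>k. \<theta> (prod_decode k)"
    using L adz sm by unfold_locales auto
  have "boundary current f = S f" if f: "f \<in> Lip" for f
  proof -
    define g where "g z = a z * (f (\<theta> z 1) - f (\<theta> z 0))" for z
    have "a (prod_decode k) * piece k (\<lambda>_. 1) f = g (prod_decode k)" for k
      by (simp add: piece_def rs_integral_one g_def)
    then have "summable (\<lambda>k. norm (g (prod_decode k)))"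
      using summable_pieces(1)[OF Lip_b_const f, of 1] by simp
    moreover have "(\<lambda>k. g (prod_decode k)) sums boundary current f"
      using summable_rabs_cancel[of "\<lambda>k. g (prod_decode k)"] calculation
      by (simp add: boundary_current g_def summable_sums)
    \<comment> \<open>Absolute convergence turns the enumerated series into an unconditional sum,
      which may be regrouped list by list.\<close>
    ultimately have "((\<lambda>k. g (prod_decode k)) has_sum boundary current f) UNIV"
      by (rule norm_summable_imp_has_sum)
    then have "(g has_sum boundary current f) (UNIV \<times> UNIV)"
      using has_sum_reindex_bij_betw[OF bij_prod_decode, of g] by simp
    then have "((\<lambda>n. curve_boundary (ps n) f) has_sum boundary current f) UNIV"
    proof (rule has_sum_SigmaD)
      fix n
      show "((\<lambda>i. g (n, i)) has_sum curve_boundary (ps n) f) UNIV"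
      proof (rule has_sum_finite_neutralI[of "{..<length (ps n)}"])
        show "curve_boundary (ps n) f = (\<Sum>i<length (ps n). g (n, i))"
          using row[of "\<lambda>(b, \<theta>, l). b * (f (\<theta> 1) - f (\<theta> 0))" n]
          by (simp add: curve_boundary_def w_eq g_def)
      qed (auto simp: g_def a0)
    qed
    then show ?thesis using S[OF f] has_sum_imp_sums sums_unique2 by blast
  qed
  moreover have "mass current \<le> (\<Sum>n. E n)"
  proof -
    have "ennreal (\<Sum>k. \<bar>a (prod_decode k)\<bar> * l (prod_decode k)) \<le> ennreal (\<Sum>n. E n)"
      using tot adz(2) sm by (subst (asm) suminf_ennreal2) auto
    then have "(\<Sum>k. \<bar>a (prod_decode k)\<bar> * l (prod_decode k)) \<le> (\<Sum>n. E n)"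
      using suminf_nonneg[OF E En] by (simp add: ennreal_le_iff)
    then show ?thesis using mass_current by linarith
  qed
  ultimately show ?thesis using current_rectifiable by blast
qed

text \<open>Along the chain \<open>f y - f x\<close> splits into increments over curves, which are
  boundaries, and increments over jumps, whose distances total less than \<open>e\<close>.\<close>

lemma piecewise_quasiconvex_chain:
  fixes x y :: "'a::metric_space"
  assumes pq: "piecewise_quasiconvex TYPE('a) c" and c: "0 \<le> c" and e: "0 < e"
  shows "\<exists>qs :: ((real \<Rightarrow> 'a) \<times> real) list. (\<forall>(\<theta>, l)\<in>set qs. \<forall>b. admissible (b, \<theta>, l)) \<and>
    (\<Sum>(\<theta>, l)\<leftarrow>qs. l) \<le> c * dist x y \<and>
    (\<forall>f\<in>Lip. \<bar>f y - f x - (\<Sum>(\<theta>, l)\<leftarrow>qs. f (\<theta> 1) - f (\<theta> 0))\<bar> \<le> lip_const f * e)"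
proof -
  obtain m and xs ys :: "nat \<Rightarrow> 'a" and \<theta> where m: "1 \<le> m"
    and gap: "dist x (xs 1) + dist (ys m) y + (\<Sum>i\<in>{1..<m}. dist (xs (i + 1)) (ys i)) < e"
    and \<theta>: "\<forall>i\<in>{1..m}. (\<exists>L. L-lipschitz_on {0..1} (\<theta> i)) \<and> \<theta> i 0 = xs i \<and> \<theta> i 1 = ys i"
    and len: "(\<Sum>i\<in>{1..m}. curve_length (\<theta> i)) \<le> ennreal (c * dist x y)"
    using pq[unfolded piecewise_quasiconvex_def, THEN spec, THEN spec, THEN spec, THEN mp, OF e, of x y]
    by (elim exE conjE)
  \<comment> \<open>The total length is finite by \<open>len\<close>, so for the relevant indices
    the real number represents the length exactly.\<close>
  define l where "l i = enn2real (curve_length (\<theta> i))" for i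
  have fin: "curve_length (\<theta> i) < \<infinity>" if "i \<in> {1..m}" for i
  proof -
    have "curve_length (\<theta> i) \<le> (\<Sum>i\<in>{1..m}. curve_length (\<theta> i))"
      using that by (intro member_le_sum) auto
    then show ?thesis using len by (metis ennreal_less_top infinity_ennreal_def le_less_trans)
  qed
  then have l: "curve_length (\<theta> i) = ennreal (l i)" if "i \<in> {1..m}" for i
    using that by (simp add: l_def less_top)
  have l0: "0 \<le> l i" for i by (simp add: l_def)
  define qs where "qs = map (\<lambda>i. (clamp01 (\<theta> i), l i)) [1..<Suc m]"
  have sumqs: "(\<Sum>(\<theta>, l)\<leftarrow>qs. h \<theta> l) = (\<Sum>i\<in>{1..m}. h (clamp01 (\<theta> i)) (l i))"
    for h :: "(real \<Rightarrow> 'a) \<Rightarrow> real \<Rightarrow> real"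
    by (simp add: qs_def o_def interv_sum_list_conv_sum_set_nat atLeastLessThanSuc_atLeastAtMost del: upt_Suc)
  show ?thesis
  proof (intro exI[of _ qs] conjI ballI)
    fix q assume "q \<in> set qs"
    then obtain i where "i \<in> set [1..<Suc m]" and q: "q = (clamp01 (\<theta> i), l i)"
      unfolding qs_def set_map by blast
    then have i: "i \<in> {1..m}" by (simp only: set_upt atLeastLessThanSuc_atLeastAtMost)
    then obtain L where "L-lipschitz_on {0..1} (\<theta> i)" using \<theta> by blast
    then have "\<exists>L. L-lipschitz_on UNIV (clamp01 (\<theta> i))" using clamp01_lipschitz by blast
    then show "case q of (\<theta>, l) \<Rightarrow> \<forall>b. admissible (b, \<theta>, l)"
      using integral_seq_speed_clamp01[of "\<theta> i"] l[OF i] l0[of i] by (simp add: q admissible_def)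
  next
    have "ennreal (\<Sum>i\<in>{1..m}. l i) = (\<Sum>i\<in>{1..m}. curve_length (\<theta> i))"
      using l0 l by (subst sum_ennreal[symmetric]) (auto intro!: sum.cong)
    with len have "ennreal (\<Sum>i\<in>{1..m}. l i) \<le> ennreal (c * dist x y)" by simp
    then have "(\<Sum>i\<in>{1..m}. l i) \<le> c * dist x y" using c by (subst (asm) ennreal_le_iff) auto
    then show "(\<Sum>(\<theta>, l)\<leftarrow>qs. l) \<le> c * dist x y" by (simp add: sumqs)
  next
    fix f :: "'a \<Rightarrow> real" assume f: "f \<in> Lip"
    have tel: "f (ys m) - f (xs 1) - (\<Sum>i\<in>{1..m}. f (ys i) - f (xs i)) = (\<Sum>i\<in>{1..<m}. f (xs (i + 1)) - f (ys i))"
      using m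
    proof (induct m rule: dec_induct)
      case (step k)
      have "{1..Suc k} = insert (Suc k) {1..k}" "{1..<Suc k} = insert k {1..<k}" using step(1) by auto
      then show ?case using step(3) by simp
    qed simp
    have "(\<Sum>(\<theta>, l)\<leftarrow>qs. f (\<theta> 1) - f (\<theta> 0)) = (\<Sum>i\<in>{1..m}. f (ys i) - f (xs i))"
      using \<theta> by (simp add: sumqs)
    then have "f y - f x - (\<Sum>(\<theta>, l)\<leftarrow>qs. f (\<theta> 1) - f (\<theta> 0)) =
       (f y - f (ys m)) + (f (xs 1) - f x) + (\<Sum>i\<in>{1..<m}. f (xs (i + 1)) - f (ys i))"
      using tel by simp
    then have "\<bar>f y - f x - (\<Sum>(\<theta>, l)\<leftarrow>qs. f (\<theta> 1) - f (\<theta> 0))\<bar> \<le>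
       \<bar>f y - f (ys m)\<bar> + \<bar>f (xs 1) - f x\<bar> + \<bar>\<Sum>i\<in>{1..<m}. f (xs (i + 1)) - f (ys i)\<bar>"
      by linarith
    also have "\<dots> \<le> lip_const f * dist y (ys m) + lip_const f * dist (xs 1) x + (\<Sum>i\<in>{1..<m}. lip_const f * dist (xs (i + 1)) (ys i))"
      by (intro add_mono lip_const_bound[OF f] order_trans[OF sum_abs] sum_mono)
    also have "\<dots> = lip_const f * (dist x (xs 1) + dist (ys m) y + (\<Sum>i\<in>{1..<m}. dist (xs (i + 1)) (ys i)))"
      by (simp add: sum_distrib_left algebra_simps dist_commute)
    also have "\<dots> \<le> lip_const f * e" using gap lip_const_nonneg[OF f] by (intro mult_left_mono) auto
    finally show "\<bar>f y - f x - (\<Sum>(\<theta>, l)\<leftarrow>qs. f (\<theta> 1) - f (\<theta> 0))\<bar> \<le> lip_const f * e" .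
  qed
qed

section \<open>One step of the iteration\<close>

lemma curve_boundary_lin:
  "curve_boundary ps (\<lambda>x. a * f x + b * g x) = a * curve_boundary ps f + b * curve_boundary ps g"
  by (induct ps) (auto simp: algebra_simps)

lemma curve_boundary_tendsto:
  assumes "\<And>x. (\<lambda>j. fs j x) \<longlonglongrightarrow> f x"
  shows "(\<lambda>j. curve_boundary ps (fs j)) \<longlonglongrightarrow> curve_boundary ps f"
proof (induct ps)
  case (Cons p ps)
  obtain b \<theta> l where p: "p = (b, \<theta>, l)" by (cases p) auto
  show ?case unfolding p curve_boundary_simps by (intro tendsto_intros assms Cons)
qed simp

text \<open>Finite combinations of point evaluations are linear and continuous under pointwise
  convergence. The remainder carries the new bound \<open>e\<close> instead of \<open>K\<close>,
  which makes the next step cheap.\<close>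

lemma kr_functional_diff:
  assumes S: "kr_functional S K" and e: "0 \<le> e"
    and le: "\<And>f. f \<in> Lip \<Longrightarrow> \<bar>S f - curve_boundary ps f\<bar> \<le> e * lip_const f"
  shows "kr_functional (\<lambda>f. S f - curve_boundary ps f) e"
  unfolding kr_functional_def
proof (intro conjI ballI allI impI)
  show "S (\<lambda>x. a * f x + b * g x) - curve_boundary ps (\<lambda>x. a * f x + b * g x) =
     a * (S f - curve_boundary ps f) + b * (S g - curve_boundary ps g)" if "f \<in> Lip" "g \<in> Lip" for f g a b
    using kr_functionalD(2)[OF S that] by (simp add: curve_boundary_lin algebra_simps)
  fix f and fs :: "nat \<Rightarrow> 'a \<Rightarrow> real"
  assume f: "f \<in> Lip" "\<forall>j. fs j \<in> Lip" "bdd_above (range (\<lambda>j. lip_const (fs j)))" "\<forall>x. (\<lambda>j. fs j x) \<longlonglongrightarrow> f x"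
  show "(\<lambda>j. S (fs j) - curve_boundary ps (fs j)) \<longlonglongrightarrow> S f - curve_boundary ps f"
    using f by (intro tendsto_diff kr_functionalD(4)[OF S] curve_boundary_tendsto) auto
qed (use e le in auto)

text \<open>The curves cost as much as the norm \<open>K\<close> of the current functional allows,
  while \<open>e\<close> can be prescribed freely. Half of \<open>e\<close> goes into the molecule
  and half into the jumps between curves.\<close>

lemma kr_functional_curves:
  fixes S :: "('a::metric_space \<Rightarrow> real) \<Rightarrow> real"
  assumes sep: "separable_space (euclidean :: 'a topology)" and c: "0 \<le> c"
    and pq: "piecewise_quasiconvex TYPE('a) c" and S: "kr_functional S K" and e: "0 < e"
  shows "\<exists>ps. (\<forall>p\<in>set ps. admissible p) \<and> curve_cost ps \<le> c * K \<and>
    kr_functional (\<lambda>f. S f - curve_boundary ps f) e"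
proof -
  obtain F where F: "finite F" "F \<noteq> {}"
    \<comment> \<open>A quarter, because the molecule doubles this error:
      \<open>2 * (e/4) = e/2\<close>.\<close>
    and small: "\<And>f. f \<in> Lip \<Longrightarrow> \<forall>x\<in>F. f x = 0 \<Longrightarrow> \<bar>S f\<bar> \<le> (e/4) * lip_const f"
    using kr_functional_small_off_finite[OF sep S, of "e/4"] e by auto
  obtain a where a: "(\<Sum>(x, y)\<in>F \<times> F. \<bar>a (x, y)\<bar> * dist x y) \<le> K"
    "\<And>f. f \<in> Lip \<Longrightarrow> \<bar>S f - (\<Sum>(x, y)\<in>F \<times> F. a (x, y) * (f y - f x))\<bar> \<le> 2 * (e/4) * lip_const f"
    using kr_functional_molecule[OF S F _ small] e by auto
  define A where "A = (\<Sum>z\<in>F \<times> F. \<bar>a z\<bar>)"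
  have A: "0 \<le> A" by (simp add: A_def sum_nonneg)
  \<comment> \<open>The jumps of all pairs together cost \<open>A * \<eta> \<le> e/2\<close>; adding
    1 avoids division by zero when all weights vanish.\<close>
  define \<eta> where "\<eta> = e / (2 * (A + 1))"
  have \<eta>: "0 < \<eta>" using e A by (simp add: \<eta>_def)
  have "\<forall>z. \<exists>qs :: ((real \<Rightarrow> 'a) \<times> real) list. (\<forall>(\<theta>, l)\<in>set qs. \<forall>b. admissible (b, \<theta>, l)) \<and>
    (\<Sum>(\<theta>, l)\<leftarrow>qs. l) \<le> c * dist (fst z) (snd z) \<and>
    (\<forall>f\<in>Lip. \<bar>f (snd z) - f (fst z) - (\<Sum>(\<theta>, l)\<leftarrow>qs. f (\<theta> 1) - f (\<theta> 0))\<bar> \<le> lip_const f * \<eta>)"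
    using piecewise_quasiconvex_chain[OF pq c \<eta>] by blast
  from choice[OF this] obtain Q :: "'a \<times> 'a \<Rightarrow> ((real \<Rightarrow> 'a) \<times> real) list" where
    Q: "\<forall>z. (\<forall>(\<theta>, l)\<in>set (Q z). \<forall>b. admissible (b, \<theta>, l)) \<and>
    (\<Sum>(\<theta>, l)\<leftarrow>Q z. l) \<le> c * dist (fst z) (snd z) \<and>
    (\<forall>f\<in>Lip. \<bar>f (snd z) - f (fst z) - (\<Sum>(\<theta>, l)\<leftarrow>Q z. f (\<theta> 1) - f (\<theta> 0))\<bar> \<le> lip_const f * \<eta>)" ..
  note Q1 = Q[THEN spec, THEN conjunct1] and Q2 = Q[THEN spec, THEN conjunct2, THEN conjunct1]
    and Q3 = Q[THEN spec, THEN conjunct2, THEN conjunct2, rule_format]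
  define scale where "scale b qs = map (\<lambda>(\<theta>, l). (b, \<theta>, l)) qs" for b :: real and qs :: "((real \<Rightarrow> 'a) \<times> real) list"
  have sc: "curve_cost (scale b qs) = \<bar>b\<bar> * (\<Sum>(\<theta>, l)\<leftarrow>qs. l)"
    "curve_boundary (scale b qs) f = b * (\<Sum>(\<theta>, l)\<leftarrow>qs. f (\<theta> 1) - f (\<theta> 0))" for b qs f
    by (induct qs) (auto simp: scale_def algebra_simps)
  obtain zs where zs: "set zs = F \<times> F" "distinct zs"
    using finite_distinct_list[of "F \<times> F"] F by auto
  define ps where "ps = concat (map (\<lambda>z. scale (a z) (Q z)) zs)"
  have cc: "curve_cost (concat (map h us)) = (\<Sum>z\<leftarrow>us. curve_cost (h z))"
    "curve_boundary (concat (map h us)) f = (\<Sum>z\<leftarrow>us. curve_boundary (h z) f)"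
    for h :: "'a \<times> 'a \<Rightarrow> 'a wcurve list" and us f by (induct us) auto
  have cost: "curve_cost ps = (\<Sum>z\<in>F \<times> F. \<bar>a z\<bar> * (\<Sum>(\<theta>, l)\<leftarrow>Q z. l))"
    unfolding ps_def cc sc zs(1)[symmetric] by (rule sum_list_distinct_conv_sum_set[OF zs(2)])
  have bdry: "curve_boundary ps f = (\<Sum>z\<in>F \<times> F. a z * (\<Sum>(\<theta>, l)\<leftarrow>Q z. f (\<theta> 1) - f (\<theta> 0)))" for f
    unfolding ps_def cc sc zs(1)[symmetric] by (rule sum_list_distinct_conv_sum_set[OF zs(2)])
  show ?thesis
  proof (intro exI[of _ ps] conjI)
    show "\<forall>p\<in>set ps. admissible p" using Q1 by (auto simp: ps_def scale_def split: prod.splits)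
    have "curve_cost ps \<le> (\<Sum>z\<in>F \<times> F. c * (\<bar>a z\<bar> * dist (fst z) (snd z)))"
      unfolding cost
    proof (rule sum_mono)
      fix z
      have "\<bar>a z\<bar> * (\<Sum>(\<theta>, l)\<leftarrow>Q z. l) \<le> \<bar>a z\<bar> * (c * dist (fst z) (snd z))"
        by (intro mult_left_mono Q2) auto
      then show "\<bar>a z\<bar> * (\<Sum>(\<theta>, l)\<leftarrow>Q z. l) \<le> c * (\<bar>a z\<bar> * dist (fst z) (snd z))" by (simp add: mult_ac)
    qed
    also have "\<dots> = c * (\<Sum>(x, y)\<in>F \<times> F. \<bar>a (x, y)\<bar> * dist x y)"
      unfolding sum_distrib_left by (intro sum.cong) auto
    also have "\<dots> \<le> c * K" using a(1) c by (rule mult_left_mono)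
    finally show "curve_cost ps \<le> c * K" .
    show "kr_functional (\<lambda>f. S f - curve_boundary ps f) e"
    proof (rule kr_functional_diff[OF S])
      show "0 \<le> e" using e by simp
      fix f :: "'a \<Rightarrow> real" assume f: "f \<in> Lip"
      have "\<bar>(\<Sum>(x, y)\<in>F \<times> F. a (x, y) * (f y - f x)) - curve_boundary ps f\<bar>
         = \<bar>\<Sum>z\<in>F \<times> F. a z * (f (snd z) - f (fst z) - (\<Sum>(\<theta>, l)\<leftarrow>Q z. f (\<theta> 1) - f (\<theta> 0)))\<bar>"
        unfolding bdry sum_subtractf[symmetric] by (intro arg_cong[where f = abs] sum.cong) (auto simp: algebra_simps)
      also have "\<dots> \<le> (\<Sum>z\<in>F \<times> F. \<bar>a z\<bar> * (lip_const f * \<eta>))"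
        unfolding abs_mult[symmetric]
        by (intro order_trans[OF sum_abs] sum_mono) (simp add: abs_mult mult_left_mono Q3[OF f])
      also have "\<dots> = A * \<eta> * lip_const f" unfolding A_def sum_distrib_right[symmetric] by (simp add: mult_ac)
      also have "\<dots> \<le> e / 2 * lip_const f"
      proof (rule mult_right_mono[OF _ lip_const_nonneg[OF f]])
        have "A * \<eta> \<le> (A + 1) * \<eta>" using \<eta> by (intro mult_right_mono) auto
        also have "\<dots> = e / 2" using A by (simp add: \<eta>_def field_simps)
        finally show "A * \<eta> \<le> e / 2" .
      qed
      finally show "\<bar>S f - curve_boundary ps f\<bar> \<le> e * lip_const f"
        using a(2)[OF f] by linarith
    qed
  qed
qed

text \<open>Any mass bound makes the supremum in \<open>KR_norm\<close> finite, and rescaling to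
  Lipschitz constant 1 turns it into an estimate for all \<open>f\<close>. If
  \<open>lip_const f\<close> is 0, rescaling is impossible, but the mass bound already gives
  boundary value 0.\<close>

lemma boundary_kr_functional:
  assumes T: "T \<in> currents1"
  shows "kr_functional (boundary T) (KR_norm (boundary T))"
proof -
  obtain \<mu> where \<mu>: "mass_bound T \<mu>" using T by (auto simp: currents1_def)
  have bil: "bilinear_on_Lip T" and cont: "current_continuous T" using T by (auto simp: currents1_def)
  have bd: "\<bar>boundary T f\<bar> \<le> lip_const f * measure \<mu> UNIV" if "f \<in> Lip" for f
    using mass_boundD(3)[OF \<mu> Lip_b_const[of 1] that] sets_eq_imp_space_eq[OF mass_boundD(1)[OF \<mu>]]
    by (simp add: boundary_def)
  have lin: "boundary T (\<lambda>x. a * f x + b * g x) = a * boundary T f + b * boundary T g"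
    if "f \<in> Lip" "g \<in> Lip" for f g a b
    unfolding boundary_def by (rule bilinear_snd[OF bil Lip_b_const that])
  have le: "boundary T f \<le> measure \<mu> UNIV" if "f \<in> Lip_1" for f
  proof -
    have "lip_const f * measure \<mu> UNIV \<le> 1 * measure \<mu> UNIV"
      using that by (intro mult_right_mono) (auto simp: Lip_1_def)
    then show ?thesis using bd[of f] that by (auto simp: Lip_1_def)
  qed
  then have bdd: "bdd_above (boundary T ` Lip_1)" by (intro bdd_aboveI2)
  have up: "boundary T f \<le> KR_norm (boundary T)" if "f \<in> Lip_1" for f
    unfolding KR_norm_def using bdd that by (intro cSUP_upper)
  have K0: "0 \<le> KR_norm (boundary T)"
    using up[of "\<lambda>_. 0"] bd[of "\<lambda>_. 0"] by (simp add: Lip_1_def)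
  have one: "boundary T f \<le> KR_norm (boundary T) * lip_const f" if f: "f \<in> Lip" for f
  proof (cases "lip_const f = 0")
    case True
    then show ?thesis using bd[OF f] by simp
  next
    case False
    then have pos: "0 < lip_const f" using lip_const_nonneg[OF f] by simp
    let ?g = "\<lambda>x. (1 / lip_const f) * f x + 0 * f x"
    have "?g \<in> Lip_1"
      using Lip_lin[OF f f, of "1 / lip_const f" 0] lip_const_lin[OF f f, of "1 / lip_const f" 0] pos
      by (simp add: Lip_1_def)
    then have "(1 / lip_const f) * boundary T f \<le> KR_norm (boundary T)"
      using up lin[OF f f, of "1 / lip_const f" 0] by fastforce
    then show ?thesis using pos by (simp add: divide_le_eq)
  qed
  have abs: "\<bar>boundary T f\<bar> \<le> KR_norm (boundary T) * lip_const f" if f: "f \<in> Lip" for f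
  proof -
    let ?g = "\<lambda>x. (-1) * f x + 0 * f x"
    have g: "?g \<in> Lip" by (rule Lip_lin[OF f f])
    have "lip_const ?g \<le> lip_const f" using lip_const_lin[OF f f, of "-1" 0] by simp
    then have "KR_norm (boundary T) * lip_const ?g \<le> KR_norm (boundary T) * lip_const f"
      using K0 by (rule mult_left_mono)
    then show ?thesis using one[OF f] one[OF g] lin[OF f f, of "-1" 0] by linarith
  qed
  show ?thesis
    unfolding kr_functional_def
  proof (intro conjI ballI allI impI K0 lin abs)
    fix f and fs :: "nat \<Rightarrow> 'a \<Rightarrow> real"
    assume "f \<in> Lip" "\<forall>j. fs j \<in> Lip" "bdd_above (range (\<lambda>j. lip_const (fs j)))" "\<forall>x. (\<lambda>j. fs j x) \<longlonglongrightarrow> f x"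
    then show "(\<lambda>j. boundary T (fs j)) \<longlonglongrightarrow> boundary T f"
      unfolding boundary_def
      using cont[unfolded current_continuous_def, rule_format, OF Lip_b_const[of 1], of f fs] by simp
  qed
qed

theorem lemma2p12:
  fixes T :: "('a::metric_space \<Rightarrow> real) \<Rightarrow> ('a \<Rightarrow> real) \<Rightarrow> real"
    and c \<delta> :: real
  assumes "separable_space (euclidean :: 'a topology)"
    and "c \<ge> 1"
    and "piecewise_quasiconvex TYPE('a) c"
    and "T \<in> currents1"
    and "0 < \<delta>" and "\<delta> < 1"
  shows "\<exists>R \<in> rectifiable1. (\<forall>f\<in>Lip. boundary R f = boundary T f) \<and>
           mass R \<le> c * (1 + \<delta>) * KR_norm (boundary T)"
proof -
  define K where "K = KR_norm (boundary T)"
  have T: "kr_functional (boundary T) K" unfolding K_def by (rule boundary_kr_functional[OF assms(4)])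
  have K: "0 \<le> K" using kr_functionalD(1)[OF T] .
  show ?thesis
  \<comment> \<open>For \<open>K = 0\<close> the prescribed errors would not be positive; then the
    boundary vanishes and the empty family of curves represents it.\<close>
  proof (cases "K = 0")
    case True
    have "\<exists>R\<in>rectifiable1. (\<forall>f\<in>Lip. boundary R f = boundary T f) \<and> mass R \<le> (\<Sum>n. 0 :: real)"
    proof (rule rectifiable_current_of_curves[where ps = "\<lambda>_. []"])
      show "(\<lambda>n. curve_boundary [] f) sums boundary T f" if "f \<in> Lip" for f
        using kr_functionalD(3)[OF T that] True by simp
    qed auto
    then show ?thesis using True by (simp add: K_def)
  next
    case False
    then have Kpos: "0 < K" using K by simp
    \<comment> \<open>\<open>E n\<close> bounds the norm of the remainder before step
      \<open>n\<close> and, multiplied by \<open>c\<close>, the cost of that step. From index 1 on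
      the geometric weights sum to 1.\<close>
    define E where "E n = (if n = 0 then K else K * \<delta> * (1/2)^n)" for n :: nat
    have Epos: "0 < E n" for n using Kpos assms(5) by (simp add: E_def)
    define good where "good S k e ps \<longleftrightarrow> (\<forall>p\<in>set ps. admissible p) \<and> curve_cost ps \<le> c * k \<and>
      kr_functional (\<lambda>f. S f - curve_boundary ps f) e" for S :: "('a \<Rightarrow> real) \<Rightarrow> real" and k e ps
    have "\<exists>ps. good S k e ps" if "kr_functional S k" "0 < e" for S k e
      unfolding good_def using assms(2) by (intro kr_functional_curves[OF assms(1) _ assms(3) that]) auto
    then obtain P where P: "\<And>S k e. kr_functional S k \<Longrightarrow> 0 < e \<Longrightarrow> good S k e (P S k e)" by metis
    define S where "S = rec_nat (boundary T) (\<lambda>n S f. S f - curve_boundary (P S (E n) (E (Suc n))) f)"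
    define ps where "ps n = P (S n) (E n) (E (Suc n))" for n
    have S0: "S 0 = boundary T" and SS: "S (Suc n) = (\<lambda>f. S n f - curve_boundary (ps n) f)" for n
      by (auto simp: S_def ps_def)
    have kr: "kr_functional (S n) (E n)" for n
    proof (induct n)
      case 0 show ?case using T by (simp add: S0 E_def)
    next
      case (Suc n)
      then show ?case using P[OF Suc Epos[of "Suc n"]] by (simp add: good_def SS ps_def)
    qed
    have gd: "good (S n) (E n) (E (Suc n)) (ps n)" for n unfolding ps_def by (rule P[OF kr Epos])
    have Esums: "E sums (K + K * \<delta>)"
    proof -
      have "(\<lambda>n. K * \<delta> * (1/2)^Suc n) sums (K * \<delta> * 1)"
        by (intro sums_mult power_half_series)
      then have "(\<lambda>n. E (Suc n)) sums (K * \<delta>)" by (simp add: E_def)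
      then show ?thesis using sums_Suc_iff[of E "K * \<delta>"] by (simp add: E_def add.commute)
    qed
    have "\<exists>R\<in>rectifiable1. (\<forall>f\<in>Lip. boundary R f = boundary T f) \<and> mass R \<le> (\<Sum>n. c * E n)"
    proof (rule rectifiable_current_of_curves)
      show "admissible p" if "p \<in> set (ps n)" for p n using gd[of n] that by (simp add: good_def)
      show "curve_cost (ps n) \<le> c * E n" for n using gd[of n] by (simp add: good_def)
      show "summable (\<lambda>n. c * E n)" using sums_summable[OF Esums] by (rule summable_mult)
      fix f :: "'a \<Rightarrow> real" assume f: "f \<in> Lip"
      \<comment> \<open>Telescoping: \<open>S n\<close> is what is left after \<open>n\<close>
        steps. Its norm is at most \<open>E n\<close>, which tends to 0, so the series of curve
        boundaries reproduces the boundary of \<open>T\<close> exactly.\<close>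
      have part: "(\<Sum>k<n. curve_boundary (ps k) f) = boundary T f - S n f" for n
        by (induct n) (auto simp: S0 SS)
      have "(\<lambda>n. E n * lip_const f) \<longlonglongrightarrow> 0 * lip_const f"
        by (intro tendsto_mult_right summable_LIMSEQ_zero sums_summable[OF Esums])
      then have "(\<lambda>n. S n f) \<longlonglongrightarrow> 0"
        using kr_functionalD(3)[OF kr f] by (intro Lim_null_comparison[of "\<lambda>n. S n f"]) auto
      then have "(\<lambda>n. boundary T f - S n f) \<longlonglongrightarrow> boundary T f - 0" by (intro tendsto_diff tendsto_const)
      then show "(\<lambda>n. curve_boundary (ps n) f) sums boundary T f" by (simp add: sums_def part)
    qed
    moreover have "(\<Sum>n. c * E n) = c * (1 + \<delta>) * K"
      using sums_unique[OF sums_mult[OF Esums, of c]] by (simp add: algebra_simps)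
    ultimately show ?thesis by (simp add: K_def)
  qed
qed

end
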